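(* Consider the continuous-time Markov decision process (CTMDP) $\{S,A,q,c\}$ with value function $V^\ast(x)=\inf_\pi V(x,\pi)$ and the associated DTMDP $\{\mathbf X,\mathbf A,p,l\}$ described in the context, with value function $\mathbf V^\ast$. Then $\mathbf V^\ast((\theta,x))$ does not depend on $\theta\in(0,\infty)$ for $x\in S$, $V^\ast$ is lower semianalytic on $S$, and $$V^\ast(x)=\mathbf V^\ast((\theta,x)),\quad\forall x\in S,\ \theta\in(0,\infty).$$ Furthermore, for every $x\in S$, $$V^\ast(x)=\inf_{\rho\in\mathcal R}\left\{\int_0^\infty e^{-\int_0^\tau(q_x(\rho_s)-c(x,\rho_s))ds}\left(\int_S V^\ast(y)\tilde q(dy|x,\rho_\tau)\right)d\tau+e^{-\int_0^\infty q_x(\rho_s)ds}e^{\int_0^\infty c(x,\rho_s)ds}\right\}.$$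
   Context: CTMDP: $S$, $A$ are nonempty Borel spaces. The transition rate $q(dy|x,a)$ is a signed kernel on $\mathcal B(S)$ given $(x,a)\in S\times A$ with $\tilde q(\Gamma|x,a):=q(\Gamma\setminus\{x\}|x,a)\ge0$ for all $\Gamma\in\mathcal B(S)$, $q(S|x,a)=0$, and $\bar q_x:=\sup_{a\in A}q_x(a)<\infty$, where $q_x(a):=-q(\{x\}|x,a)$. The cost rate $c:S\times A\to[0,\infty)$ is measurable. Adjoin an isolated point $x_\infty\notin S$ and put $c(x_\infty,\cdot)=0$, $q_{x_\infty}(\cdot)=0$, $\tilde q(\cdot|x_\infty,\cdot)=0$. For a probability measure $\mu$ on $A$ write $q_x(\mu)=\int_A q_x(a)\mu(da)$, $\tilde q(dy|x,\mu)=\int_A\tilde q(dy|x,a)\mu(da)$, $c(x,\mu)=\int_A c(x,a)\mu(da)$. A policy $\pi=(\pi_n)_{n\ge0}$ is a sequence of stochastic kernels $\pi_n(da|x_0,\theta_1,x_1,\dots,\theta_n,x_n,s)$ on $A$ given $(x_0,\theta_1,\dots,\theta_n,x_n)\in S\times((0,\infty)\times S)^n$ and $s\in(0,\infty)$. For $x\in S$, $P_x^\pi$ is the probability measure on sequences $\omega=(x_0,\theta_1,x_1,\theta_2,\dots)$ ($\theta_n\in(0,\infty]$, $x_n\in S\cup\{x_\infty\}$, with all entries $(\infty,x_\infty)$ after the first infinite $\theta$) such that $x_0=x$ and, on $\{x_n\in S\}$, writing $\pi_n(\cdot|s)=\pi_n(\cdot|x_0,\dots,x_n,s)$: $P_x^\pi(\theta_{n+1}\in\Gamma_1,x_{n+1}\in\Gamma_2|x_0,\dots,x_n)=\int_{\Gamma_1}e^{-\int_0^t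 q_{x_n}(\pi_n(\cdot|s))ds}\tilde q(\Gamma_2|x_n,\pi_n(\cdot|t))dt$ for Borel $\Gamma_1\subseteq(0,\infty)$, $\Gamma_2\subseteq S$, and $P_x^\pi(\theta_{n+1}=\infty,x_{n+1}=x_\infty|x_0,\dots,x_n)=e^{-\int_0^\infty q_{x_n}(\pi_n(\cdot|s))ds}$; on $\{x_n=x_\infty\}$, $(\theta_{n+1},x_{n+1})=(\infty,x_\infty)$ a.s. The criterion is $V(x,\pi)=E_x^\pi\big[\exp\big(\sum_{n\ge0}\int_0^{\theta_{n+1}}\int_A c(x_n,a)\pi_n(da|x_0,\dots,x_n,s)ds\big)\big]$ (the exponential of the total cost accumulated along the trajectory), and $V^\ast(x)=\inf_\pi V(x,\pi)$. $\mathcal R$: the set of Borel measurable maps $t\in(0,\infty)\mapsto\rho_t\in\mathbb P(A)$ (probability measures on $A$ with the weak topology), identifying maps equal for Lebesgue-a.e. $t$; it carries the smallest $\sigma$-algebra making $\rho\mapsto\int_0^\infty e^{-t}f(t,\rho_t)dt$ measurable for every bounded measurable $f$ on $(0,\infty)\times\mathbb P(A)$ (it is a Borel space). Associated DTMDP $\{\mathbf X,\mathbf A,p,l\}$: state space $\mathbf X=((0,\infty)\times S)\cup\{(\infty,x_\infty)\}$ ($(\infty,x_\infty)$ isolated), action space $\mathbf A=\mathcal R$, transition kernel $p(\Gamma_1\times\Gamma_2|(\theta,x),\rho)=\int_{\Gamma_2}e^{-\int_0^t q_x(\rho_s)ds}\tilde q(\Gamma_1|x,\rho_t)dt$ for $\Gamma_1\in\mathcal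 B(S)$, $\Gamma_2\in\mathcal B((0,\infty))$, $p(\{(\infty,x_\infty)\}|(\theta,x),\rho)=e^{-\int_0^\infty q_x(\rho_s)ds}$, $p(\{(\infty,x_\infty)\}|(\infty,x_\infty),\rho)=1$; cost $l((\theta,x),\rho,(\tau,y))=\int_0^\infty I\{s<\tau\}c(x,\rho_s)ds$. Its value function is $\mathbf V^\ast(z)=\inf_\sigma\mathbf E_z^\sigma\big[e^{\sum_{n\ge0}l(Y_n,A_n,Y_{n+1})}\big]$ over all (history-dependent) strategies $\sigma$, where $\mathbf E_z^\sigma$ is expectation under the Ionescu-Tulcea measure with initial state $z$. Conventions: $0/0=0$, $0\cdot\infty=0$, $1/0=+\infty$, $\infty-\infty=\infty$. *)

theory Defs
  imports "HOL-Probability.Probability"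
begin

definition eexp :: "ereal \<Rightarrow> ennreal" where
  "eexp z = (if z = \<infinity> then \<infinity> else if z = -\<infinity> then 0 else ennreal (exp (real_of_ereal z)))"

definition analytic_in :: "'s::polish_space set \<Rightarrow> 's set \<Rightarrow> bool" where
  "analytic_in S E \<longleftrightarrow> (\<exists>B \<in> sets (borel :: ('s \<times> (nat \<Rightarrow> nat)) measure).
      B \<subseteq> S \<times> UNIV \<and> E = fst ` B)"

definition lower_semianalytic :: "'s::polish_space set \<Rightarrow> ('s \<Rightarrow> ennreal) \<Rightarrow> bool" where
  "lower_semianalytic S f \<longleftrightarrow> (\<forall>r::real. analytic_in S {x \<in> S. enn2ereal (f x) < ereal r})"

abbreviation BM :: "'s::polish_space set \<Rightarrow> 's measure" where
  "BM S \<equiv> restrict_space borel S"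

text \<open>State space S extended by the isolated cemetery point x_infinity, represented by None.\<close>
definition optM :: "'s::polish_space set \<Rightarrow> 's option measure" where
  "optM S = sigma (insert None (Some ` S))
      ({Some ` B | B. B \<in> sets (BM S)} \<union> {{None}})"

text \<open>The set ((0,oo) x S) \<union> {(oo, x_infinity)}; it is both the DTMDP state space
  and the range of the pairs (theta_n, x_n), n >= 1, of a CTMDP trajectory.\<close>
definition Xset :: "'s set \<Rightarrow> (ennreal \<times> 's option) set" where
  "Xset S = {(ennreal t, Some y) | t y. 0 < t \<and> y \<in> S} \<union> {(\<infinity>, None)}"

definition XM :: "'s::polish_space set \<Rightarrow> (ennreal \<times> 's option) measure" where
  "XM S = restrict_space (borel \<Otimes>\<^sub>M optM S) (Xset S)"

definition qmix :: "'s::polish_space set \<Rightarrow> ('s \<Rightarrow> 'a \<Rightarrow> 's measure) \<Rightarrow> 's \<Rightarrow> 'a measure \<Rightarrow> 's measure" where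
  "qmix S qt x \<mu> = measure_of S (sets (BM S)) (\<lambda>\<Gamma>. \<integral>\<^sup>+ a. emeasure (qt x a) \<Gamma> \<partial>\<mu>)"

definition Iq :: "('s \<Rightarrow> 'a \<Rightarrow> real) \<Rightarrow> 's \<Rightarrow> (real \<Rightarrow> 'a measure) \<Rightarrow> ennreal \<Rightarrow> ennreal" where
  "Iq qx x \<rho> T = (\<integral>\<^sup>+ s \<in> {s. 0 < s \<and> ennreal s < T}. (\<integral>\<^sup>+ a. ennreal (qx x a) \<partial>\<rho> s) \<partial>lborel)"

definition Ic :: "('s \<Rightarrow> 'a \<Rightarrow> real) \<Rightarrow> 's \<Rightarrow> (real \<Rightarrow> 'a measure) \<Rightarrow> ennreal \<Rightarrow> ennreal" where
  "Ic c x \<rho> T = (\<integral>\<^sup>+ s \<in> {s. 0 < s \<and> ennreal s < T}. (\<integral>\<^sup>+ a. ennreal (c x a) \<partial>\<rho> s) \<partial>lborel)"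

text \<open>The action space R of the DTMDP: measurable maps (0,oo) -> P(A) (weak topology;
  its Borel sigma-algebra is the one of prob_algebra), with the sigma-algebra generated by
  rho |-> int_0^oo e^{-t} f(t,rho_t) dt, f bounded measurable.  Maps that agree a.e. are
  not separated by this sigma-algebra, and all quantities below only depend on the a.e.-class.\<close>
definition Rset :: "'a::polish_space set \<Rightarrow> (real \<Rightarrow> 'a measure) set" where
  "Rset A = {\<rho>. \<rho> \<in> measurable (restrict_space borel {0<..}) (prob_algebra (BM A))}"

definition Rtest :: "'a::polish_space set \<Rightarrow> (real \<times> 'a measure \<Rightarrow> real) set" where
  "Rtest A = {f. f \<in> borel_measurable (restrict_space borel {0<..} \<Otimes>\<^sub>M prob_algebra (BM A)) \<and>
      (\<exists>K. \<forall>z \<in> space (restrict_space borel {0<..} \<Otimes>\<^sub>M prob_algebra (BM A)). \<bar>f z\<bar> \<le> K)}"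

definition RM :: "'a::polish_space set \<Rightarrow> (real \<Rightarrow> 'a measure) measure" where
  "RM A = sigma (Rset A)
     (\<Union>f \<in> Rtest A. {(\<lambda>\<rho>. LINT t:{0<..}|lborel. exp (- t) * f (t, \<rho> t)) -` B \<inter> Rset A | B. B \<in> sets borel})"

text \<open>Law of the next (sojourn time, state) when the current state is x in S and rho is used.\<close>
definition jumpLaw :: "'s::polish_space set \<Rightarrow> ('s \<Rightarrow> 'a \<Rightarrow> 's measure) \<Rightarrow> ('s \<Rightarrow> 'a \<Rightarrow> real)
     \<Rightarrow> 's \<Rightarrow> (real \<Rightarrow> 'a measure) \<Rightarrow> (ennreal \<times> 's option) measure" where
  "jumpLaw S qt qx x \<rho> = measure_of (space (XM S)) (sets (XM S))
     (\<lambda>E. (\<integral>\<^sup>+ t \<in> {0<..}. eexp (- enn2ereal (Iq qx x \<rho> (ennreal t))) *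
              emeasure (qmix S qt x (\<rho> t)) {y. (ennreal t, Some y) \<in> E} \<partial>lborel)
          + eexp (- enn2ereal (Iq qx x \<rho> \<infinity>)) * indicator E (\<infinity>, None))"

definition pker :: "'s::polish_space set \<Rightarrow> ('s \<Rightarrow> 'a \<Rightarrow> 's measure) \<Rightarrow> ('s \<Rightarrow> 'a \<Rightarrow> real)
     \<Rightarrow> ennreal \<times> 's option \<Rightarrow> (real \<Rightarrow> 'a measure) \<Rightarrow> (ennreal \<times> 's option) measure" where
  "pker S qt qx z \<rho> = (case snd z of None \<Rightarrow> return (XM S) (\<infinity>, None)
                                  | Some x \<Rightarrow> jumpLaw S qt qx x \<rho>)"

text \<open>Coordinate spaces of a trajectory: coordinate 0 carries (0, x_0) (dummy time 0),
  coordinate n >= 1 carries (theta_n, x_n).\<close>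
definition Tc :: "'s::polish_space set \<Rightarrow> nat \<Rightarrow> (ennreal \<times> 's option) measure" where
  "Tc S i = (if i = 0 then restrict_space (borel \<Otimes>\<^sub>M optM S) ((\<lambda>y. (0, Some y)) ` S) else XM S)"

text \<open>A policy: pi n h s is the kernel pi_n(da | x_0, theta_1, ..., x_n, s), jointly measurable.\<close>
definition policies :: "'s::polish_space set \<Rightarrow> 'a::polish_space set
     \<Rightarrow> (nat \<Rightarrow> (nat \<Rightarrow> ennreal \<times> 's option) \<Rightarrow> real \<Rightarrow> 'a measure) set" where
  "policies S A = {\<pi>. \<forall>n. (\<lambda>(h, s). \<pi> n h s) \<in>
      measurable (PiM {0..n} (Tc S) \<Otimes>\<^sub>M restrict_space borel {0<..}) (prob_algebra (BM A))}"

definition CTker :: "'s::polish_space set \<Rightarrow> ('s \<Rightarrow> 'a \<Rightarrow> 's measure) \<Rightarrow> ('s \<Rightarrow> 'a \<Rightarrow> real)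
     \<Rightarrow> 's \<Rightarrow> (nat \<Rightarrow> (nat \<Rightarrow> ennreal \<times> 's option) \<Rightarrow> real \<Rightarrow> 'a measure)
     \<Rightarrow> nat \<Rightarrow> (nat \<Rightarrow> ennreal \<times> 's option) \<Rightarrow> (ennreal \<times> 's option) measure" where
  "CTker S qt qx x \<pi> i h = (if i = 0 then return (Tc S 0) (0, Some x)
      else pker S qt qx (h (i - 1)) (\<pi> (i - 1) h))"

definition Ppol :: "'s::polish_space set \<Rightarrow> ('s \<Rightarrow> 'a \<Rightarrow> 's measure) \<Rightarrow> ('s \<Rightarrow> 'a \<Rightarrow> real)
     \<Rightarrow> 's \<Rightarrow> (nat \<Rightarrow> (nat \<Rightarrow> ennreal \<times> 's option) \<Rightarrow> real \<Rightarrow> 'a measure)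
     \<Rightarrow> (nat \<Rightarrow> ennreal \<times> 's option) measure" where
  "Ppol S qt qx x \<pi> = projective_family.lim UNIV
      (Ionescu_Tulcea.CI (CTker S qt qx x \<pi>) (Tc S)) (Tc S)"

text \<open>Total cost along a trajectory (c(x_infinity,.) = 0).\<close>
definition totcost :: "('s \<Rightarrow> 'a \<Rightarrow> real) \<Rightarrow> (nat \<Rightarrow> (nat \<Rightarrow> ennreal \<times> 's option) \<Rightarrow> real \<Rightarrow> 'a measure)
     \<Rightarrow> (nat \<Rightarrow> ennreal \<times> 's option) \<Rightarrow> ennreal" where
  "totcost c \<pi> \<omega> = (\<Sum>n. (case snd (\<omega> n) of None \<Rightarrow> 0
       | Some xn \<Rightarrow> Ic c xn (\<pi> n (restrict \<omega> {0..n})) (fst (\<omega> (Suc n)))))"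

definition Vpol :: "'s::polish_space set \<Rightarrow> ('s \<Rightarrow> 'a \<Rightarrow> 's measure) \<Rightarrow> ('s \<Rightarrow> 'a \<Rightarrow> real)
     \<Rightarrow> ('s \<Rightarrow> 'a \<Rightarrow> real) \<Rightarrow> 's \<Rightarrow> (nat \<Rightarrow> (nat \<Rightarrow> ennreal \<times> 's option) \<Rightarrow> real \<Rightarrow> 'a measure) \<Rightarrow> ennreal" where
  "Vpol S qt qx c x \<pi> = (\<integral>\<^sup>+ \<omega>. eexp (enn2ereal (totcost c \<pi> \<omega>)) \<partial>Ppol S qt qx x \<pi>)"

definition Vstar :: "'s::polish_space set \<Rightarrow> 'a::polish_space set \<Rightarrow> ('s \<Rightarrow> 'a \<Rightarrow> 's measure)
     \<Rightarrow> ('s \<Rightarrow> 'a \<Rightarrow> real) \<Rightarrow> ('s \<Rightarrow> 'a \<Rightarrow> real) \<Rightarrow> 's \<Rightarrow> ennreal" where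
  "Vstar S A qt qx c x = (INF \<pi> \<in> policies S A. Vpol S qt qx c x \<pi>)"

text \<open>Coordinates of a DTMDP history Y_0, A_0, Y_1, A_1, ...: even ones are states (Inl),
  odd ones are actions in R (Inr).\<close>
definition Dc :: "'s::polish_space set \<Rightarrow> 'a::polish_space set \<Rightarrow> nat
     \<Rightarrow> ((ennreal \<times> 's option) + (real \<Rightarrow> 'a measure)) measure" where
  "Dc S A i = (if even i then embed_measure (XM S) Inl else embed_measure (RM A) Inr)"

definition strategies :: "'s::polish_space set \<Rightarrow> 'a::polish_space set
     \<Rightarrow> (nat \<Rightarrow> (nat \<Rightarrow> (ennreal \<times> 's option) + (real \<Rightarrow> 'a measure)) \<Rightarrow> (real \<Rightarrow> 'a measure) measure) set" where
  "strategies S A = {\<sigma>. \<forall>n. \<sigma> n \<in> measurable (PiM {0..<2*n+1} (Dc S A)) (prob_algebra (RM A))}"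

definition DTker :: "'s::polish_space set \<Rightarrow> 'a::polish_space set \<Rightarrow> ('s \<Rightarrow> 'a \<Rightarrow> 's measure) \<Rightarrow> ('s \<Rightarrow> 'a \<Rightarrow> real)
     \<Rightarrow> ennreal \<times> 's option
     \<Rightarrow> (nat \<Rightarrow> (nat \<Rightarrow> (ennreal \<times> 's option) + (real \<Rightarrow> 'a measure)) \<Rightarrow> (real \<Rightarrow> 'a measure) measure)
     \<Rightarrow> nat \<Rightarrow> (nat \<Rightarrow> (ennreal \<times> 's option) + (real \<Rightarrow> 'a measure))
     \<Rightarrow> ((ennreal \<times> 's option) + (real \<Rightarrow> 'a measure)) measure" where
  "DTker S A qt qx z \<sigma> i h =
     (if i = 0 then return (Dc S A 0) (Inl z)
      else if odd i then distr (\<sigma> ((i - 1) div 2) h) (Dc S A i) Inr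
      else distr (pker S qt qx (projl (h (i - 2))) (projr (h (i - 1)))) (Dc S A i) Inl)"

definition Pstr :: "'s::polish_space set \<Rightarrow> 'a::polish_space set \<Rightarrow> ('s \<Rightarrow> 'a \<Rightarrow> 's measure) \<Rightarrow> ('s \<Rightarrow> 'a \<Rightarrow> real)
     \<Rightarrow> ennreal \<times> 's option
     \<Rightarrow> (nat \<Rightarrow> (nat \<Rightarrow> (ennreal \<times> 's option) + (real \<Rightarrow> 'a measure)) \<Rightarrow> (real \<Rightarrow> 'a measure) measure)
     \<Rightarrow> (nat \<Rightarrow> (ennreal \<times> 's option) + (real \<Rightarrow> 'a measure)) measure" where
  "Pstr S A qt qx z \<sigma> = projective_family.lim UNIV
      (Ionescu_Tulcea.CI (DTker S A qt qx z \<sigma>) (Dc S A)) (Dc S A)"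

text \<open>One-step cost l((theta,x),rho,(tau,y)) = int_0^oo I{s<tau} c(x,rho_s) ds, with c(x_infinity,.) = 0.\<close>
definition lcost :: "('s \<Rightarrow> 'a \<Rightarrow> real) \<Rightarrow> ennreal \<times> 's option \<Rightarrow> (real \<Rightarrow> 'a measure)
     \<Rightarrow> ennreal \<times> 's option \<Rightarrow> ennreal" where
  "lcost c z \<rho> z' = (case snd z of None \<Rightarrow> 0 | Some x \<Rightarrow> Ic c x \<rho> (fst z'))"

definition Vstr :: "'s::polish_space set \<Rightarrow> 'a::polish_space set \<Rightarrow> ('s \<Rightarrow> 'a \<Rightarrow> 's measure)
     \<Rightarrow> ('s \<Rightarrow> 'a \<Rightarrow> real) \<Rightarrow> ('s \<Rightarrow> 'a \<Rightarrow> real) \<Rightarrow> ennreal \<times> 's option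
     \<Rightarrow> (nat \<Rightarrow> (nat \<Rightarrow> (ennreal \<times> 's option) + (real \<Rightarrow> 'a measure)) \<Rightarrow> (real \<Rightarrow> 'a measure) measure)
     \<Rightarrow> ennreal" where
  "Vstr S A qt qx c z \<sigma> = (\<integral>\<^sup>+ \<omega>. eexp (enn2ereal
       (\<Sum>n. lcost c (projl (\<omega> (2*n))) (projr (\<omega> (2*n+1))) (projl (\<omega> (2*n+2)))))
     \<partial>Pstr S A qt qx z \<sigma>)"

definition Vbold :: "'s::polish_space set \<Rightarrow> 'a::polish_space set \<Rightarrow> ('s \<Rightarrow> 'a \<Rightarrow> 's measure)
     \<Rightarrow> ('s \<Rightarrow> 'a \<Rightarrow> real) \<Rightarrow> ('s \<Rightarrow> 'a \<Rightarrow> real) \<Rightarrow> ennreal \<times> 's option \<Rightarrow> ennreal" where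
  "Vbold S A qt qx c z = (INF \<sigma> \<in> strategies S A. Vstr S A qt qx c z \<sigma>)"


end

theory Submission
  imports Defs
begin

text \<open>
  Relaxed controls are coded by points of Baire space: there is a jointly measurable family
  \<open>relax z t\<close> which, up to null sets of times, exhausts all controls, and a universal function which
  up to null sets exhausts all measurable maps into Baire space. Hence policies that are deterministic
  on the level of controls are coded by a single parameter \<open>z\<close>, with a value jointly measurable in the
  state and \<open>z\<close>.

  A policy is in particular a strategy of the embedded process, so the DTMDP value is at most the
  CTMDP value, which is at most the infimum over codes. Conversely, a history-dependent randomised
  strategy is derandomised one stage after another by measurable selection, and monotone convergence
  over the number of stages closes the circle. The resulting representation of \<open>V\<^sup>*\<close> as an infimum of
  a measurable function over Baire space gives lower semianalyticity.

  In the optimality equation, \<open>\<ge>\<close> follows by conditioning on the first jump. For \<open>\<le>\<close>, replace \<open>V\<^sup>*\<close> by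
  a Borel function equal to it almost everywhere with respect to the first jump, select
  measurably codes that are optimal up to a factor \<open>1 + \<epsilon>\<close>, and concatenate. As \<open>V\<^sup>*\<close> is only
  lower semianalytic, its integral is handled through that Borel modification.
\<close>

section \<open>Measurable selection on Baire space\<close>

text \<open>Exact measurable selectors need not exist, and \<open>V\<close>, an infimum over an
  uncountable family, is not known to be Borel. Every selection is therefore made with respect to
  one fixed finite measure, the law of a history or of a first jump; an exceptional null set does no
  harm because only integrals against that measure are compared. Baire space serves as parameter
  space because the Souslin operation lives on its finite stems, which makes selection and coding
  combinatorial. A second obstacle is that a control matters only up to null sets of times:
  evaluation at a time is in general not a measurable operation on \<open>RM A\<close>, so every
  quantity has to be reached through integrals over time. The rest is soft: costs enter as
  nonnegative extended reals and the exponential turns sums into products, so values are increasing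
  limits of iterates of the one-stage operator \<open>step\<close>. For an integrand that is not
  measurable, the integral in the optimality equation is a supremum over simple functions below it.
  It is still monotone, so only the upper bound on \<open>V\<close> calls for a Borel
  substitute.\<close>

abbreviation baire :: "(nat \<Rightarrow> nat) measure" where
  "baire \<equiv> borel"

lemma sets_baire: "sets baire = sets (PiM UNIV (\<lambda>_. count_space UNIV))"
proof -
  have "sets (PiM UNIV (\<lambda>_::nat. count_space (UNIV::nat set))) = sets (PiM UNIV (\<lambda>_::nat. borel :: nat measure))"
    by (intro sets_PiM_cong) (auto simp: sets_borel_eq_count_space)
  then show ?thesis
    by (simp add: sets_PiM_equal_borel)
qed

lemma measurable_baire_iff:
  "f \<in> M \<rightarrow>\<^sub>M baire \<longleftrightarrow> (\<forall>i. (\<lambda>x. f x i) \<in> M \<rightarrow>\<^sub>M count_space UNIV)"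
  unfolding measurable_cong_sets[OF refl sets_baire]
proof safe
  fix i assume "f \<in> M \<rightarrow>\<^sub>M PiM UNIV (\<lambda>_. count_space UNIV)"
  then show "(\<lambda>x. f x i) \<in> M \<rightarrow>\<^sub>M count_space UNIV"
    by (rule measurable_compose[OF _ measurable_component_singleton]) simp
qed (auto intro!: measurable_PiM_single')

lemma measurable_baire_component [measurable (raw)]:
  "f \<in> M \<rightarrow>\<^sub>M baire \<Longrightarrow> (\<lambda>x. f x i) \<in> M \<rightarrow>\<^sub>M count_space UNIV"
  by (simp add: measurable_baire_iff)

lemma measurable_baireI:
  "(\<And>i. (\<lambda>x. f x i) \<in> M \<rightarrow>\<^sub>M count_space UNIV) \<Longrightarrow> f \<in> M \<rightarrow>\<^sub>M baire"
  by (simp add: measurable_baire_iff)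

abbreviation stem :: "(nat \<Rightarrow> nat) \<Rightarrow> nat \<Rightarrow> nat list" where
  "stem z k \<equiv> map z [0..<k]"

text \<open>Closedness of the section in the selected coordinate is encoded by letting the scheme see
  only the initial segments of \<open>y\<close>; \<open>w\<close> is the existential witness of the Souslin operation.\<close>
definition souslin :: "'a measure \<Rightarrow> ('a \<times> (nat \<Rightarrow> nat)) set \<Rightarrow> bool" where
  "souslin M B \<longleftrightarrow> (\<exists>R. (\<forall>s t. R s t \<in> sets M) \<and>
     B = {(x, y). x \<in> space M \<and> (\<exists>w. \<forall>k. x \<in> R (stem y k) (stem w k))})"

text \<open>The witness can carry the index of the union as its first entry. Its remaining entries
  then lag one place behind, so at depth \<open>Suc k\<close> the new scheme consults the old one at
  depth \<open>k\<close> and drops the last entry of the stem of \<open>y\<close>.\<close>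

lemma souslin_UN:
  fixes B :: "nat \<Rightarrow> ('a \<times> (nat \<Rightarrow> nat)) set"
  assumes "\<And>n. souslin M (B n)"
  shows "souslin M (\<Union>n. B n)"
proof -
  have "\<forall>n. \<exists>R. (\<forall>s t. R s t \<in> sets M) \<and>
      B n = {(x, y). x \<in> space M \<and> (\<exists>w. \<forall>k. x \<in> R (stem y k) (stem w k))}"
    using assms unfolding souslin_def by blast
  from choice[OF this] obtain R where R: "\<And>n s t. R n s t \<in> sets M"
    "\<And>n. B n = {(x, y). x \<in> space M \<and> (\<exists>w. \<forall>k. x \<in> R n (stem y k) (stem w k))}"
    by blast
  define R' where "R' s t = (case t of [] \<Rightarrow> space M | n # t \<Rightarrow> R n (take (length t) s) t)" for s t
  have Suc: "stem w (Suc k) = w 0 # stem (\<lambda>i. w (Suc i)) k" for w :: "nat \<Rightarrow> nat" and k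
    by (rule map_upt_Suc)
  have tk: "take k (stem y (Suc k)) = stem y k" for y k
    by (simp add: take_map del: upt_Suc)
  have R'Suc: "R' (stem y (Suc k)) (stem w (Suc k)) = R (w 0) (stem y k) (stem (\<lambda>i. w (Suc i)) k)" for y w k
    unfolding R'_def Suc[of w] by (simp add: tk del: upt_Suc)
  have "(\<exists>w. \<forall>k. x \<in> R' (stem y k) (stem w k)) \<longleftrightarrow> (\<exists>n w. \<forall>k. x \<in> R n (stem y k) (stem w k))"
    if x: "x \<in> space M" for x y
  proof safe
    fix w assume *: "\<forall>k. x \<in> R' (stem y k) (stem w k)"
    then have "\<forall>k. x \<in> R (w 0) (stem y k) (stem (\<lambda>i. w (Suc i)) k)"
      using R'Suc by metis
    then show "\<exists>n w. \<forall>k. x \<in> R n (stem y k) (stem w k)" by metis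
  next
    fix n w assume *: "\<forall>k. x \<in> R n (stem y k) (stem w k)"
    define w' where "w' i = (case i of 0 \<Rightarrow> n | Suc j \<Rightarrow> w j)" for i
    have w': "w' 0 = n" "(\<lambda>i. w' (Suc i)) = w"
      by (auto simp: w'_def)
    have "x \<in> R' (stem y k) (stem w' k)" for k
    proof (cases k)
      case 0 with x show ?thesis by (simp add: R'_def)
    next
      case (Suc j) with * show ?thesis by (simp add: R'Suc w' del: upt_Suc)
    qed
    then show "\<exists>w. \<forall>k. x \<in> R' (stem y k) (stem w k)" by blast
  qed
  note eq = this
  have "(\<Union>n. B n) = {(x, y). x \<in> space M \<and> (\<exists>w. \<forall>k. x \<in> R' (stem y k) (stem w k))}"
    unfolding R(2) by (intro set_eqI, rename_tac p, case_tac p) (simp add: eq cong: conj_cong)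
  moreover have "R' s t \<in> sets M" for s t
    using R(1) by (auto simp: R'_def split: list.split)
  ultimately show ?thesis
    unfolding souslin_def by blast
qed

text \<open>A single witness has to contain one witness for each \<open>n\<close>, and
  \<open>prod_encode\<close> interleaves them. A stem of the joint witness shows only part of each
  strand, so the condition for depth \<open>j\<close> of strand \<open>n\<close> is imposed once
  \<open>ok\<close> holds, that is, once all the entries it reads are visible. Every condition
  becomes visible eventually.\<close>

lemma souslin_INT:
  fixes B :: "nat \<Rightarrow> ('a \<times> (nat \<Rightarrow> nat)) set"
  assumes "\<And>n. souslin M (B n)"
  shows "souslin M (\<Inter>n. B n)"
proof -
  have "\<forall>n. \<exists>R. (\<forall>s t. R s t \<in> sets M) \<and>
      B n = {(x, y). x \<in> space M \<and> (\<exists>w. \<forall>k. x \<in> R (stem y k) (stem w k))}"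
    using assms unfolding souslin_def by blast
  from choice[OF this] obtain R where R: "\<And>n s t. R n s t \<in> sets M"
    "\<And>n. B n = {(x, y). x \<in> space M \<and> (\<exists>w. \<forall>k. x \<in> R n (stem y k) (stem w k))}"
    by blast
  define ok where "ok s t n j \<longleftrightarrow> j \<le> length s \<and> (\<forall>i<j. prod_encode (n, i) < length t)"
    for s t :: "nat list" and n j
  define T where "T s t n j = R n (take j s) (map (\<lambda>i. t ! prod_encode (n, i)) [0..<j])" for s t n j
  define R' where "R' s t = {x \<in> space M. \<forall>n j. ok s t n j \<longrightarrow> x \<in> T s t n j}" for s t
  have T_pre: "T (stem y k) (stem w k) n j = R n (stem y j) (stem (\<lambda>i. w (prod_encode (n, i))) j)"
    if "ok (stem y k) (stem w k) n j" for y w k n j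
  proof -
    have "take j (stem y k) = stem y j"
      using that by (simp add: ok_def take_map)
    moreover have "map (\<lambda>i. stem w k ! prod_encode (n, i)) [0..<j] = stem (\<lambda>i. w (prod_encode (n, i))) j"
      using that by (auto simp: ok_def)
    ultimately show ?thesis unfolding T_def by metis
  qed
  have big: "\<exists>k. ok (stem y k) (stem w k) n j" for y w n j
  proof -
    \<comment> \<open>The sum dominates each of its terms, and the summand \<open>j\<close> secures
      that the stem of \<open>y\<close> is long enough as well.\<close>
    have "\<forall>i<j. prod_encode (n, i) < Suc (j + (\<Sum>i<j. prod_encode (n, i)))"
      using member_le_sum[of _ "{..<j}" "\<lambda>i. prod_encode (n, i)"] by (force simp: less_Suc_eq_le intro: trans_le_add2)
    then show ?thesis
      by (intro exI[of _ "Suc (j + (\<Sum>i<j. prod_encode (n, i)))"]) (auto simp: ok_def)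
  qed
  have "(\<exists>w. \<forall>k. x \<in> R' (stem y k) (stem w k)) \<longleftrightarrow> (\<forall>n. \<exists>w. \<forall>k. x \<in> R n (stem y k) (stem w k))"
    if x: "x \<in> space M" for x y
  proof
    assume "\<exists>w. \<forall>k. x \<in> R' (stem y k) (stem w k)"
    then obtain w where w: "\<And>k. x \<in> R' (stem y k) (stem w k)" by blast
    have "x \<in> R n (stem y j) (stem (\<lambda>i. w (prod_encode (n, i))) j)" for n j
      using big[of y w n j] w T_pre unfolding R'_def by blast
    then show "\<forall>n. \<exists>w. \<forall>k. x \<in> R n (stem y k) (stem w k)" by blast
  next
    assume "\<forall>n. \<exists>w. \<forall>k. x \<in> R n (stem y k) (stem w k)"
    then obtain w where w: "\<And>n k. x \<in> R n (stem y k) (stem (w n) k)" by metis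
    define w' where "w' m = (case prod_decode m of (n, i) \<Rightarrow> w n i)" for m
    have "(\<lambda>i. w' (prod_encode (n, i))) = w n" for n
      by (auto simp: w'_def)
    then have "x \<in> R' (stem y k) (stem w' k)" for k
      using x w T_pre[of y k w'] unfolding R'_def by auto
    then show "\<exists>w. \<forall>k. x \<in> R' (stem y k) (stem w k)" by blast
  qed
  note eq = this
  have "(\<Inter>n. B n) = {(x, y). x \<in> space M \<and> (\<exists>w. \<forall>k. x \<in> R' (stem y k) (stem w k))}"
    unfolding R(2) by (intro set_eqI, rename_tac p, case_tac p) (simp add: eq cong: conj_cong)
  moreover have "R' s t \<in> sets M" for s t
  proof -
    have [measurable]: "T s t n j \<in> sets M" for n j
      unfolding T_def by (rule R)
    show ?thesis unfolding R'_def by measurable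
  qed
  ultimately show ?thesis
    unfolding souslin_def by blast
qed

text \<open>A condition on the single entry \<open>y i\<close> becomes visible once the stem is
  longer than \<open>i\<close>; before that the scheme imposes nothing.\<close>

lemma souslin_basic:
  assumes "\<And>m. F m \<in> sets M"
  shows "souslin M {(x, y). x \<in> F (y i)}"
proof -
  have pre: "x \<in> space M \<Longrightarrow>
     (\<forall>k. x \<in> (if i < length (stem y k) then F (stem y k ! i) else space M)) \<longleftrightarrow> x \<in> F (y i)" for x y
    by (auto dest: spec[of _ "Suc i"] simp del: upt_Suc)
  have sp: "x \<in> F n \<Longrightarrow> x \<in> space M" for x n
    using assms sets.sets_into_space by blast
  show ?thesis
    unfolding souslin_def
    using assms
    by (intro exI[of _ "\<lambda>s t. if i < length s then F (s ! i) else space M"] conjI)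
       (simp, simp only: pre cong: conj_cong, auto dest: sp)
qed

text \<open>Souslin sets are not closed under complement in general, so the sigma-algebra consists
  of the sets that are Souslin together with their complement: \<open>souslin_UN\<close> and
  \<open>souslin_INT\<close> exchange roles under complementation. Measurability of the two
  projections for it then covers the whole product.\<close>

lemma souslin_pair_sets:
  assumes "B \<in> sets (M \<Otimes>\<^sub>M baire)"
  shows "souslin M B"
proof -
  let ?\<Omega> = "space M \<times> (UNIV :: (nat \<Rightarrow> nat) set)"
  define \<S> where "\<S> = {B \<in> Pow ?\<Omega>. souslin M B \<and> souslin M (?\<Omega> - B)}"
  have UN: "(\<Union>n. A n) \<in> \<S>" if "range A \<subseteq> \<S>" for A :: "nat \<Rightarrow> _"
  proof -
    have eq: "?\<Omega> - (\<Union>n. A n) = (\<Inter>n. ?\<Omega> - A n)" by auto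
    have A: "souslin M (A n)" "souslin M (?\<Omega> - A n)" for n
      using that unfolding \<S>_def by blast+
    have "souslin M (\<Union>n. A n)" "souslin M (\<Inter>n. ?\<Omega> - A n)"
      by (rule souslin_UN, rule A) (rule souslin_INT, rule A)
    then show ?thesis
      using that unfolding eq[symmetric] unfolding \<S>_def by blast
  qed
  have emp: "{} \<in> \<S>"
  proof -
    have *: "{(x, y). x \<in> {}} = {}" "{(x, y). x \<in> space M} = ?\<Omega>" by auto
    have "souslin M {}" "souslin M ?\<Omega>"
      using souslin_basic[of "\<lambda>_. {}" M 0] souslin_basic[of "\<lambda>_. space M" M 0]
      unfolding * by auto
    then show ?thesis
      by (simp add: \<S>_def)
  qed
  have sub: "\<S> \<subseteq> Pow ?\<Omega>"
    unfolding \<S>_def by blast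
  have compl: "?\<Omega> - X \<in> \<S>" if "X \<in> \<S>" for X
  proof -
    have "?\<Omega> - (?\<Omega> - X) = X"
      using that by (simp add: \<S>_def double_diff)
    then show ?thesis
      using that by (simp add: \<S>_def)
  qed
  have sa: "sigma_algebra ?\<Omega> \<S>"
    unfolding sigma_algebra_iff2
    using UN emp sub compl by blast
  define N where "N = sigma ?\<Omega> \<S>"
  have N: "space N = ?\<Omega>" "sets N = \<S>"
    using sigma_algebra.sigma_sets_eq[OF sa] sub by (simp_all add: N_def space_measure_of)
  have bas: "{(x, y). x \<in> F (y i)} \<in> \<S>" if F: "\<And>m. F m \<in> sets M" for F i
  proof -
    have "?\<Omega> - {(x, y). x \<in> F (y i)} = {(x, y). x \<in> space M - F (y i)}" by auto
    then show ?thesis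
      using souslin_basic[of F M i, OF F] souslin_basic[of "\<lambda>m. space M - F m" M i] F sets.sets_into_space[OF F]
      by (auto simp: \<S>_def simp del: mem_Times_iff)
  qed
  have "fst \<in> N \<rightarrow>\<^sub>M M"
  proof (rule measurableI)
    fix A assume A: "A \<in> sets M"
    then have "fst -` A \<inter> space N = {(x, y). x \<in> A}"
      using sets.sets_into_space by (auto simp: N)
    then show "fst -` A \<inter> space N \<in> sets N"
      using bas[of "\<lambda>_. A" 0] A by (simp add: N)
  qed (auto simp: N)
  moreover have "snd \<in> N \<rightarrow>\<^sub>M baire"
  proof (rule measurable_baireI)
    fix i
    have "(\<lambda>x. snd x i) -` {a} \<inter> space N = {(x, y). x \<in> (if y i = a then space M else {})}" for a
      by (auto simp: N split: if_splits)
    moreover have "{(x, y). x \<in> (if y i = a then space M else {})} \<in> sets N" for a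
      unfolding N(2) by (rule bas) simp
    ultimately show "(\<lambda>x. snd x i) \<in> N \<rightarrow>\<^sub>M count_space UNIV"
      unfolding measurable_count_space_eq2_countable by simp
  qed
  ultimately have "(\<lambda>\<omega>. (fst \<omega>, snd \<omega>)) \<in> N \<rightarrow>\<^sub>M M \<Otimes>\<^sub>M baire"
    by (rule measurable_Pair)
  then have "(\<lambda>\<omega>. (fst \<omega>, snd \<omega>)) -` B \<inter> space N \<in> sets N"
    using assms by (rule measurable_sets)
  moreover have "(\<lambda>\<omega>. (fst \<omega>, snd \<omega>)) -` B \<inter> space N = B"
    using sets.sets_into_space[OF assms] by (auto simp: N space_pair_measure)
  ultimately show ?thesis
    by (simp add: N \<S>_def)
qed


text \<open>This is the argument of Choquet's capacitability theorem. Branches are bounded entry by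
  entry while the outer measure of the points still served stays above \<open>a\<close>. In the
  resulting finitely branching tree the existence of a branch is a measurable condition by Koenig's
  lemma, and taking the least viable entry at each node selects one measurably.\<close>

lemma souslin_selection_approx:
  fixes G :: "nat list \<Rightarrow> 'a set"
  assumes "finite_measure M"
  assumes G: "\<And>s. G s \<in> sets M" and dec: "\<And>s n. G (s @ [n]) \<subseteq> G s"
  defines "E \<equiv> {x. \<exists>v. \<forall>k. x \<in> G (stem v k)}"
  assumes a: "a < outer_measure_of M E"
  shows "\<exists>D \<phi>. D \<in> sets M \<and> a \<le> emeasure M D \<and> \<phi> \<in> M \<rightarrow>\<^sub>M baire \<and>
    (\<forall>x\<in>D. \<forall>k. x \<in> G (stem (\<phi> x) k))"
proof -
  interpret finite_measure M by fact
  define Eb where "Eb u k = {x. \<exists>v. (\<forall>i<k. v i \<le> u i) \<and> (\<forall>j. x \<in> G (stem v j))}"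
    for u :: "nat \<Rightarrow> nat" and k
  have Eb_step: "\<exists>r. a < outer_measure_of M (Eb (u(k := r)) (Suc k))" if lt: "a < outer_measure_of M (Eb u k)" for u k
  proof -
    have "Eb u k = (\<Union>r. Eb (u(k := r)) (Suc k))"
    proof safe
      fix x assume "x \<in> Eb u k"
      then obtain v where "\<forall>i<k. v i \<le> u i" "\<forall>j. x \<in> G (stem v j)"
        by (auto simp: Eb_def)
      then have "x \<in> Eb (u(k := v k)) (Suc k)"
        by (auto simp: Eb_def less_Suc_eq)
      then show "x \<in> (\<Union>r. Eb (u(k := r)) (Suc k))" by blast
    next
      fix x r assume "x \<in> Eb (u(k := r)) (Suc k)"
      then show "x \<in> Eb u k"
        unfolding Eb_def by (auto simp: less_Suc_eq)
    qed
    \<comment> \<open>Outer measure is continuous along increasing sequences of arbitrary sets; this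
      is what lets a finite bound \<open>r\<close> replace an unrestricted entry.\<close>
    moreover have "(SUP r. outer_measure_of M (Eb (u(k := r)) (Suc k))) =
        outer_measure_of M (\<Union>r. Eb (u(k := r)) (Suc k))"
    proof (rule SUP_outer_measure_of_incseq)
      show "Eb (u(k := n)) (Suc k) \<subseteq> space M" for n
        using sets.sets_into_space[OF G[of "[]"]] by (auto simp: Eb_def dest!: spec[of _ 0])
      show "incseq (\<lambda>r. Eb (u(k := r)) (Suc k))"
      proof (rule incseq_SucI, rule subsetI)
        fix r x assume "x \<in> Eb (u(k := r)) (Suc k)"
        then obtain v where "\<forall>i<Suc k. v i \<le> (u(k := r)) i" and v: "\<forall>j. x \<in> G (stem v j)"
          unfolding Eb_def by blast
        then have "\<forall>i<Suc k. v i \<le> (u(k := Suc r)) i"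
          by (auto simp: less_Suc_eq intro: le_SucI)
        with v show "x \<in> Eb (u(k := Suc r)) (Suc k)"
          unfolding Eb_def by blast
      qed
    qed
    ultimately have "a < (SUP r. outer_measure_of M (Eb (u(k := r)) (Suc k)))"
      using lt by simp
    then show ?thesis
      by (simp add: less_SUP_iff)
  qed
  have Eb_cong: "Eb u k = Eb u' k" if "\<And>i. i < k \<Longrightarrow> u i = u' i" for u u' k
    using that by (auto simp: Eb_def)
  have step: "\<exists>r. a < outer_measure_of M (Eb (u(k := r)) (Suc k))"
    if "\<forall>j<k. a < outer_measure_of M (Eb (u(j := u j)) (Suc j))" for u k
  proof (cases k)
    case 0
    have "Eb u 0 = E"
      by (simp add: Eb_def E_def)
    then show ?thesis
      using a 0 Eb_step[of u 0] by simp
  next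
    case (Suc j)
    then show ?thesis
      using that Eb_step[of u k] by auto
  qed
  \<comment> \<open>Updating \<open>u\<close> at \<open>k\<close> by its own value is vacuous; it
    only fits dependent choice, where the bound at \<open>k\<close> may depend on the earlier
    bounds.\<close>
  have "\<exists>u. \<forall>k. a < outer_measure_of M (Eb (u(k := u k)) (Suc k))"
  proof (rule dependent_wellorder_choice[of "\<lambda>u k r. a < outer_measure_of M (Eb (u(k := r)) (Suc k))"])
    fix r :: nat and f g :: "nat \<Rightarrow> nat" and k :: nat assume "\<And>y. y < k \<Longrightarrow> f y = g y"
    then show "(a < outer_measure_of M (Eb (f(k := r)) (Suc k))) = (a < outer_measure_of M (Eb (g(k := r)) (Suc k)))"
      by (subst Eb_cong[of "Suc k" "f(k := r)" "g(k := r)"]) auto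
  qed (use step in auto)
  then obtain u where "\<And>k. a < outer_measure_of M (Eb u (Suc k))"
    by auto
  moreover have "Eb u (Suc k) \<subseteq> Eb u k" for k
    unfolding Eb_def using less_SucI by blast
  ultimately have u: "a < outer_measure_of M (Eb u k)" for k
    using less_le_trans[OF _ outer_measure_of_mono] by blast
  define Bd where "Bd s \<longleftrightarrow> (\<forall>i<length s. s ! i \<le> u i)" for s
  have Bd_take: "Bd (take n s)" if "Bd s" for n s
    using that by (simp add: Bd_def)
  have fin: "finite {s. length s = k \<and> Bd s}" for k
  proof (rule finite_subset)
    have "x \<le> (\<Sum>i<length s. u i)" if "Bd s" "x \<in> set s" for s x
    proof -
      obtain i where i: "i < length s" "x = s ! i"
        using \<open>x \<in> set s\<close> by (auto simp: in_set_conv_nth)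
      then have "x \<le> u i"
        using \<open>Bd s\<close> by (simp add: Bd_def)
      also have "u i \<le> (\<Sum>i<length s. u i)"
        using i by (intro member_le_sum) auto
      finally show ?thesis .
    qed
    then show "{s. length s = k \<and> Bd s} \<subseteq> {s. set s \<subseteq> {..\<Sum>i<k. u i} \<and> length s = k}"
      by auto
  qed (simp add: finite_lists_length_eq)
  \<comment> \<open>Points of \<open>D\<close> have bounded stems of every length in the tree, not
    yet a branch through them. Each level is finite, so \<open>D\<close> is measurable and its
    measure is a limit from above.\<close>
  define D where "D = (\<Inter>k. \<Union>s\<in>{s. length s = k \<and> Bd s}. G s)"
  have Dm [measurable]: "D \<in> sets M"
    unfolding D_def by (rule sets.countable_INT) (auto intro!: sets.finite_UN G fin)
  have G_take: "G s \<subseteq> G (take n s)" for s n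
  proof (induction s rule: rev_induct)
    case (snoc y s)
    show ?case
    proof (cases "n \<le> length s")
      case True
      then have "take n (s @ [y]) = take n s" by simp
      then show ?thesis using subset_trans[OF dec[of s y] snoc] by simp
    next
      case False
      then have "take n (s @ [y]) = s @ [y]" by simp
      then show ?thesis by simp
    qed
  qed simp
  have "a \<le> emeasure M D"
  proof -
    have "emeasure M D = (INF k. emeasure M (\<Union>s\<in>{s. length s = k \<and> Bd s}. G s))"
      unfolding D_def
    proof (rule INF_emeasure_decseq[symmetric])
      show "decseq (\<lambda>k. \<Union>s\<in>{s. length s = k \<and> Bd s}. G s)"
      proof (rule decseq_SucI, safe)
        fix k s x assume "Bd s" "x \<in> G s" "length s = Suc k"
        then show "x \<in> \<Union> (G ` {s. length s = k \<and> Bd s})"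
          using G_take[of s k] by (intro UN_I[of "take k s"]) (auto simp: Bd_def)
      qed
    qed (use G fin in \<open>auto intro!: sets.finite_UN\<close>)
    also have "\<dots> \<ge> a"
    proof (rule INF_greatest)
      fix k
      have sub: "Eb u k \<subseteq> (\<Union>s\<in>{s. length s = k \<and> Bd s}. G s)"
      proof
        fix x assume "x \<in> Eb u k"
        then obtain v where v: "\<forall>i<k. v i \<le> u i" "\<forall>j. x \<in> G (stem v j)"
          by (auto simp: Eb_def)
        then show "x \<in> (\<Union>s\<in>{s. length s = k \<and> Bd s}. G s)"
          by (intro UN_I[of "stem v k"]) (auto simp: Bd_def)
      qed
      have "a < outer_measure_of M (Eb u k)" by (rule u)
      also have "\<dots> \<le> outer_measure_of M (\<Union>s\<in>{s. length s = k \<and> Bd s}. G s)"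
        by (rule outer_measure_of_mono[OF sub])
      also have "\<dots> = emeasure M (\<Union>s\<in>{s. length s = k \<and> Bd s}. G s)"
        using G fin by (intro outer_measure_of_eq sets.finite_UN) auto
      finally show "a \<le> emeasure M (\<Union>s\<in>{s. length s = k \<and> Bd s}. G s)" by simp
    qed
    finally show ?thesis .
  qed
  \<comment> \<open>\<open>T x s\<close> says that \<open>s\<close> has admissible extensions of
    every length. By finite branching this passes to some immediate successor, so a branch that
    follows \<open>T\<close> never gets stuck.\<close>
  define T where "T x s \<longleftrightarrow> (\<forall>k. \<exists>t. length t = k \<and> Bd (s @ t) \<and> x \<in> G (s @ t))" for x s
  have T_ext: "\<exists>n. T x (s @ [n])" if Ts: "T x s" for x s
  proof (rule ccontr)
    assume "\<nexists>n. T x (s @ [n])"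
    then have "\<forall>n. \<exists>k. \<forall>t. \<not> (length t = k \<and> Bd ((s @ [n]) @ t) \<and> x \<in> G ((s @ [n]) @ t))"
      unfolding T_def by blast
    from choice[OF this] obtain k where
      k: "\<And>n t. length t = k n \<Longrightarrow> Bd ((s @ [n]) @ t) \<Longrightarrow> x \<in> G ((s @ [n]) @ t) \<Longrightarrow> False"
      by blast
    \<comment> \<open>\<open>k n\<close> is a length at which the successor \<open>n\<close> fails.
      Only finitely many \<open>n\<close> are allowed at this node, and an extension longer than all
      these lengths contradicts one of the failures.\<close>
    define K where "K = Max (k ` {..u (length s)})"
    obtain t where t: "length t = Suc K" "Bd (s @ t)" "x \<in> G (s @ t)"
      using Ts unfolding T_def by blast
    then obtain n t' where t': "t = n # t'" "length t' = K"
      by (cases t) auto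
    have n: "n \<le> u (length s)"
      using t t' unfolding Bd_def by (auto dest!: spec[of _ "length s"])
    then have kn: "k n \<le> K"
      unfolding K_def by (intro Max_ge) auto
    have eq: "(s @ [n]) @ take (k n) t' = take (Suc (length s + k n)) (s @ t)"
      using t' by simp
    have "x \<in> G ((s @ [n]) @ take (k n) t')"
      unfolding eq using G_take t by blast
    moreover have "Bd ((s @ [n]) @ take (k n) t')"
      unfolding eq by (rule Bd_take[OF t(2)])
    moreover have "length (take (k n) t') = k n"
      using kn t' by simp
    ultimately show False
      using k by blast
  qed
  define sel where "sel x = rec_nat [] (\<lambda>_ s. s @ [LEAST n. T x (s @ [n])])" for x
  define \<phi> where "\<phi> x k = (LEAST n. T x (sel x k @ [n]))" for x k
  have sel_simps: "sel x 0 = []" "sel x (Suc k) = sel x k @ [\<phi> x k]" for x k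
    by (simp_all add: sel_def \<phi>_def)
  have sel_stem: "sel x k = stem (\<phi> x) k" for x k
    by (induction k) (simp_all add: sel_simps)
  have "\<forall>k. x \<in> G (stem (\<phi> x) k)" if "x \<in> D" for x
  proof -
    have "T x []"
      using that by (auto simp: D_def T_def)
    have "T x (sel x k)" for k
    proof (induction k)
      case (Suc k)
      from LeastI_ex[OF T_ext[OF Suc]] show ?case
        unfolding sel_simps \<phi>_def .
    qed (simp add: sel_simps \<open>T x []\<close>)
    then have "\<exists>t. length t = 0 \<and> Bd (sel x k @ t) \<and> x \<in> G (sel x k @ t)" for k
      unfolding T_def by blast
    then show ?thesis
      by (simp add: sel_stem)
  qed
  moreover have "\<phi> \<in> M \<rightarrow>\<^sub>M baire"
  proof (rule measurable_baireI)
    note [measurable] = G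
    have [measurable]: "Measurable.pred M (\<lambda>x. T x s)" for s
      unfolding T_def by measurable
    have [measurable]: "(\<lambda>x. sel x k) \<in> M \<rightarrow>\<^sub>M count_space UNIV" for k
    proof (induction k)
      case (Suc k)
      have "(\<lambda>x. s @ [LEAST n. T x (s @ [n])]) \<in> M \<rightarrow>\<^sub>M count_space UNIV" for s
        by measurable
      from measurable_compose_countable[OF this Suc] show ?case
        unfolding sel_simps \<phi>_def .
    qed (simp add: sel_simps)
    have "(\<lambda>x. LEAST n. T x (s @ [n])) \<in> M \<rightarrow>\<^sub>M count_space UNIV" for s
      by measurable
    from measurable_compose_countable[OF this] show "(\<lambda>x. \<phi> x k) \<in> M \<rightarrow>\<^sub>M count_space UNIV" for k
      unfolding \<phi>_def by simp
  qed
  ultimately show ?thesis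
    using \<open>a \<le> emeasure M D\<close> Dm by blast
qed

text \<open>This is the Jankov--von Neumann selection theorem, with universal measurability replaced by
  measurability up to a null set of the given measure.\<close>

theorem measurable_selection:
  assumes "finite_measure M" and B: "B \<in> sets (M \<Otimes>\<^sub>M baire)"
  obtains E N \<phi> where "E \<in> sets M" "N \<in> null_sets M" "fst ` B \<subseteq> E \<union> N" "\<phi> \<in> M \<rightarrow>\<^sub>M baire"
    "\<And>x. x \<in> E \<Longrightarrow> (x, \<phi> x) \<in> B"
proof -
  interpret finite_measure M by fact
  obtain R where R [measurable]: "\<And>s t. R s t \<in> sets M"
    and BR: "B = {(x, y). x \<in> space M \<and> (\<exists>w. \<forall>k. x \<in> R (stem y k) (stem w k))}"
    using souslin_pair_sets[OF B] unfolding souslin_def by blast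
  \<comment> \<open>One branch carries the selected coordinate \<open>y\<close> and the witness
    \<open>w\<close> at once; \<open>d1\<close> and \<open>d2\<close> separate them.\<close>
  define d1 d2 where "d1 = (\<lambda>n. fst (prod_decode n))" and "d2 = (\<lambda>n. snd (prod_decode n))"
  \<comment> \<open>Imposing the conditions of all shorter stems makes the scheme decrease along
    branches.\<close>
  define G where "G s = {x \<in> space M. \<forall>j\<le>length s. x \<in> R (map d1 (take j s)) (map d2 (take j s))}" for s
  have G: "G s \<in> sets M" for s
    unfolding G_def by measurable
  have dec: "G (s @ [n]) \<subseteq> G s" for s n
  proof
    fix x assume x: "x \<in> G (s @ [n])"
    have "x \<in> R (map d1 (take j s)) (map d2 (take j s))" if "j \<le> length s" for j
      using x that unfolding G_def by (auto dest!: spec[of _ j])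
    with x show "x \<in> G s" by (auto simp: G_def)
  qed
  have G_stem: "(\<forall>k. x \<in> G (stem v k)) \<longleftrightarrow> x \<in> space M \<and> (\<forall>k. x \<in> R (stem (\<lambda>i. d1 (v i)) k) (stem (\<lambda>i. d2 (v i)) k))"
    for x v
  proof -
    have "take j (stem v k) = stem v j" if "j \<le> k" for j k
      using that by (simp add: take_map)
    then show ?thesis
      by (auto simp: G_def o_def)
  qed
  define E0 where "E0 = {x. \<exists>v. \<forall>k. x \<in> G (stem v k)}"
  have E0: "fst ` B \<subseteq> E0"
  proof
    fix x assume "x \<in> fst ` B"
    then obtain y w where yw: "x \<in> space M" "\<forall>k. x \<in> R (stem y k) (stem w k)"
      by (auto simp: BR)
    then have "\<forall>k. x \<in> G (stem (\<lambda>i. prod_encode (y i, w i)) k)"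
      unfolding G_stem by (simp add: d1_def d2_def)
    then show "x \<in> E0" unfolding E0_def by blast
  qed
  have E0_sp: "E0 \<subseteq> space M"
    by (auto simp: E0_def G_def dest!: spec[of _ 0])
  \<comment> \<open>A measurable hull: the projection itself need not be measurable, so its outer
    measure stands in for its size.\<close>
  obtain U where U: "U \<in> sets M" "E0 \<subseteq> U" "outer_measure_of M E0 = emeasure M U"
    using outer_measure_of_attain[OF E0_sp] by blast
  have "\<exists>D \<phi>. D \<in> sets M \<and> emeasure M U \<le> emeasure M D + ennreal (1 / Suc m) \<and> \<phi> \<in> M \<rightarrow>\<^sub>M baire \<and>
      (\<forall>x\<in>D. \<forall>k. x \<in> G (stem (\<phi> x) k))" for m :: nat
  proof (cases "emeasure M U = 0")
    case True
    then show ?thesis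
      by (intro exI[of _ "{}"] exI[of _ "\<lambda>_ _. 0"]) auto
  next
    case False
    then have "emeasure M U - ennreal (1 / Suc m) < outer_measure_of M E0"
      unfolding U(3) by (intro ennreal_between) (auto simp: zero_less_iff_neq_zero less_top[symmetric])
    from souslin_selection_approx[OF \<open>finite_measure M\<close> G dec this[unfolded E0_def]] obtain D \<phi>
      where "D \<in> sets M" "emeasure M U - ennreal (1 / Suc m) \<le> emeasure M D" "\<phi> \<in> M \<rightarrow>\<^sub>M baire"
        "(\<forall>x\<in>D. \<forall>k. x \<in> G (stem (\<phi> x) k))"
      by blast
    then show ?thesis
      by (intro exI[of _ D] exI[of _ \<phi>]) (auto simp: ennreal_minus_le_iff add.commute)
  qed
  then have "\<forall>m. \<exists>p. fst p \<in> sets M \<and> emeasure M U \<le> emeasure M (fst p) + ennreal (1 / Suc m) \<and>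
     snd p \<in> M \<rightarrow>\<^sub>M baire \<and> (\<forall>x\<in>fst p. \<forall>k. x \<in> G (stem (snd p x) k))"
    by simp
  from choice[OF this] obtain p where p: "\<And>m::nat. fst (p m) \<in> sets M"
      "\<And>m. emeasure M U \<le> emeasure M (fst (p m)) + ennreal (1 / Suc m)"
      "\<And>m. snd (p m) \<in> M \<rightarrow>\<^sub>M baire"
      "\<And>m x k. x \<in> fst (p m) \<Longrightarrow> x \<in> G (stem (snd (p m) x) k)"
    by blast
  note [measurable] = p(1,3) U(1)
  \<comment> \<open>The \<open>m\<close>-th approximation misses at most \<open>1 / Suc m\<close> of
    the hull, so the union misses only a null set. Below, \<open>sl\<close> picks the first
    approximation that contains the point.\<close>
  define E where "E = (\<Union>m. fst (p m))"
  have E [measurable]: "E \<in> sets M"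
    unfolding E_def by measurable
  have "E \<subseteq> E0"
    using p(4) by (auto simp: E_def E0_def)
  with U have "E \<subseteq> U" by auto
  have "emeasure M U \<le> emeasure M E"
  proof (rule ennreal_le_epsilon)
    fix e :: real assume "0 < e"
    then obtain m where m: "1 / Suc m < e"
      using nat_approx_posE by blast
    have "emeasure M U \<le> emeasure M (fst (p m)) + ennreal (1 / Suc m)"
      by (rule p)
    also have "\<dots> \<le> emeasure M E + ennreal e"
      using m by (intro add_mono emeasure_mono ennreal_leI) (auto simp: E_def)
    finally show "emeasure M U \<le> emeasure M E + ennreal e" .
  qed
  then have "emeasure M (U - E) = 0"
    using \<open>E \<subseteq> U\<close> by (subst emeasure_Diff) (auto simp: diff_eq_0_ennreal less_top[symmetric])
  then have N: "U - E \<in> null_sets M"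
    using E U(1) by (intro null_setsI sets.Diff)
  define sl where "sl x = (LEAST m. x \<in> fst (p m))" for x
  have [measurable]: "sl \<in> M \<rightarrow>\<^sub>M count_space UNIV"
    unfolding sl_def by measurable
  define \<phi> where "\<phi> x i = d1 (snd (p (sl x)) x i)" for x i
  have "\<phi> \<in> M \<rightarrow>\<^sub>M baire"
  proof (rule measurable_baireI)
    fix i
    have "(\<lambda>x. d1 (snd (p m) x i)) \<in> M \<rightarrow>\<^sub>M count_space UNIV" for m
      by measurable
    from measurable_compose_countable[OF this, of sl] show "(\<lambda>x. \<phi> x i) \<in> M \<rightarrow>\<^sub>M count_space UNIV"
      unfolding \<phi>_def by measurable
  qed
  moreover have "(x, \<phi> x) \<in> B" if "x \<in> E" for x
  proof -
    have "x \<in> fst (p (sl x))"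
      using that unfolding sl_def E_def by (auto intro: LeastI)
    then have "\<forall>k. x \<in> G (stem (snd (p (sl x)) x) k)"
      using p(4) by blast
    then show ?thesis
      unfolding G_stem BR \<phi>_def by blast
  qed
  ultimately show thesis
    using that[of E "U - E" \<phi>] N U(2) E0 E by blast
qed

corollary measurable_selection_AE:
  assumes "finite_measure M" and P: "Measurable.pred (M \<Otimes>\<^sub>M baire) (\<lambda>(x, z). P x z)"
    and ex: "\<And>x. x \<in> space M \<Longrightarrow> \<exists>z. P x z"
  obtains \<phi> where "\<phi> \<in> M \<rightarrow>\<^sub>M baire" "AE x in M. P x (\<phi> x)"
proof -
  let ?B = "{p \<in> space (M \<Otimes>\<^sub>M baire). case p of (x, z) \<Rightarrow> P x z}"
  have "?B \<in> sets (M \<Otimes>\<^sub>M baire)"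
    using P by measurable
  then obtain E N \<phi>
    where *: "N \<in> null_sets M" "fst ` ?B \<subseteq> E \<union> N" "\<phi> \<in> M \<rightarrow>\<^sub>M baire" "\<And>x. x \<in> E \<Longrightarrow> (x, \<phi> x) \<in> ?B"
    by (rule measurable_selection[OF assms(1)]) blast
  have "fst ` ?B = space M"
  proof safe
    fix x assume x: "x \<in> space M"
    with ex obtain z where "P x z" by blast
    with x show "x \<in> fst ` ?B"
      by (intro image_eqI[of _ _ "(x, z)"]) (auto simp: space_pair_measure)
  qed (auto simp: space_pair_measure)
  then have "AE x in M. P x (\<phi> x)"
    using * by (intro AE_I'[OF *(1)]) auto
  with * show thesis by (intro that)
qed

section \<open>Universal functions and Borel retracts\<close>

text \<open>The empty set is added so that every open set, the empty one included, is a union of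
  basic sets indexed by all of \<open>nat\<close>.\<close>

definition basic_open :: "nat \<Rightarrow> 'p::second_countable_topology set" where
  "basic_open = from_nat_into (insert {} (SOME B. countable B \<and> topological_basis B))"

lemma basic_open_basis:
  "\<exists>B. countable B \<and> topological_basis B \<and> range (basic_open :: nat \<Rightarrow> 'p::second_countable_topology set) = insert {} B"
proof -
  let ?B = "SOME B::'p set set. countable B \<and> topological_basis B"
  have B: "countable ?B \<and> topological_basis ?B"
    by (rule someI_ex) (rule ex_countable_basis)
  then have "range (basic_open :: nat \<Rightarrow> 'p set) = insert {} ?B"
    unfolding basic_open_def by (intro range_from_nat_into) auto
  with B show ?thesis by blast
qed

lemma open_basic_open: "open (basic_open n :: 'p::second_countable_topology set)"
proof -
  obtain B :: "'p set set" where B: "topological_basis B" "range basic_open = insert {} B"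
    using basic_open_basis by blast
  have "basic_open n \<in> insert {} B"
    using B(2) by blast
  then show ?thesis
    using topological_basis_open[OF B(1)] by auto
qed

lemma open_imp_UN_basic_open:
  assumes "open (U :: 'p::second_countable_topology set)"
  shows "\<exists>w :: nat \<Rightarrow> nat. U = (\<Union>j. basic_open (w j))"
proof -
  obtain B :: "'p set set" where B: "countable B" "topological_basis B" "range basic_open = insert {} B"
    using basic_open_basis by blast
  obtain B' where B': "B' \<subseteq> B" "\<Union>B' = U"
    using B(2) assms unfolding topological_basis_def by blast
  then have "countable (insert {} B')"
    using B(1) countable_subset by blast
  then have rng: "range (from_nat_into (insert {} B')) = insert {} B'"
    by (intro range_from_nat_into) auto
  have "\<forall>j. \<exists>i. (basic_open i :: 'p set) = from_nat_into (insert {} B') j"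
  proof
    fix j
    have "from_nat_into (insert {} B') j \<in> range basic_open"
      using rng B'(1) unfolding B(3) by blast
    then show "\<exists>i. (basic_open i :: 'p set) = from_nat_into (insert {} B') j"
      by auto
  qed
  from choice[OF this] obtain w where w: "\<And>j. (basic_open (w j) :: 'p set) = from_nat_into (insert {} B') j"
    by blast
  have "(\<Union>j. basic_open (w j)) = U"
    unfolding w rng using B'(2) by simp
  then have "U = (\<Union>j. basic_open (w j))" ..
  then show ?thesis by (rule exI[of _ w])
qed

definition gdelta :: "(nat \<Rightarrow> nat) \<Rightarrow> 'p::second_countable_topology set" where
  "gdelta w = (\<Inter>i. \<Union>j. basic_open (w (prod_encode (i, j))))"

text \<open>Up to a null set every Borel set is a \<open>G\<^sub>\<delta>\<close>, so \<open>z\<close> can list codes of \<open>G\<^sub>\<delta>\<close> sets that play the role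
  of \<open>{p. \<phi> p k = m}\<close>; off a null set exactly one \<open>m\<close> is a candidate, and \<open>LEAST\<close> picks it.\<close>
definition universal :: "(nat \<Rightarrow> nat) \<Rightarrow> 'p::second_countable_topology \<Rightarrow> nat \<Rightarrow> nat" where
  "universal z p k = (LEAST m. p \<in> gdelta (\<lambda>l. z (prod_encode (k, prod_encode (m, l)))))"

lemma measurable_universal:
  assumes f: "f \<in> M \<rightarrow>\<^sub>M baire" and g: "g \<in> M \<rightarrow>\<^sub>M (borel :: 'p::second_countable_topology measure)"
  shows "(\<lambda>x. universal (f x) (g x)) \<in> M \<rightarrow>\<^sub>M baire"
proof (rule measurable_baireI)
  fix k
  have [measurable]: "Measurable.pred M (\<lambda>x. g x \<in> basic_open (f x i))" for i
  proof (rule measurable_compose_countable[where g="\<lambda>x. f x i" and f="\<lambda>j x. g x \<in> basic_open j"])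
    show "Measurable.pred M (\<lambda>x. g x \<in> basic_open j)" for j
      using g by (rule pred_sets2[rotated]) (simp add: open_basic_open)
    show "(\<lambda>x. f x i) \<in> M \<rightarrow>\<^sub>M count_space UNIV"
      using f by measurable
  qed
  show "(\<lambda>x. universal (f x) (g x) k) \<in> M \<rightarrow>\<^sub>M count_space UNIV"
    unfolding universal_def gdelta_def INT_iff UN_iff by measurable
qed

text \<open>Outer regularity gives open supersets of \<open>B\<close> with excess measure below
  \<open>1 / Suc i\<close>; their intersection contains \<open>B\<close> and exceeds it by a null
  set. Working modulo null sets is what removes the Borel complexity of \<open>B\<close>.\<close>

lemma gdelta_approx:
  fixes \<mu> :: "'p::polish_space measure"
  assumes "finite_measure \<mu>" and sets: "sets \<mu> = sets borel" and B: "B \<in> sets borel"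
  shows "\<exists>w. AE p in \<mu>. p \<in> gdelta w \<longleftrightarrow> p \<in> B"
proof -
  interpret finite_measure \<mu> by fact
  have "\<exists>U. open U \<and> B \<subseteq> U \<and> emeasure \<mu> U < emeasure \<mu> B + ennreal (1 / Suc i)" for i
  proof -
    have "emeasure \<mu> B < emeasure \<mu> B + ennreal (1 / Suc i)"
      by (simp add: emeasure_eq_measure ennreal_less_iff del: ennreal_plus flip: ennreal_plus)
    then have "(INF U \<in> {U. B \<subseteq> U \<and> open U}. emeasure \<mu> U) < emeasure \<mu> B + ennreal (1 / Suc i)"
      by (subst outer_regular[OF sets _ B, symmetric]) (auto simp: emeasure_finite)
    then show ?thesis
      by (auto simp: INF_less_iff)
  qed
  then have "\<forall>i. \<exists>w :: nat \<Rightarrow> nat. B \<subseteq> (\<Union>j. basic_open (w j)) \<and> emeasure \<mu> (\<Union>j. basic_open (w j)) < emeasure \<mu> B + ennreal (1 / Suc i)"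
    using open_imp_UN_basic_open by fast
  from choice[OF this] obtain w :: "nat \<Rightarrow> nat \<Rightarrow> nat" where
    "\<forall>i. B \<subseteq> (\<Union>j. basic_open (w i j)) \<and> emeasure \<mu> (\<Union>j. basic_open (w i j)) < emeasure \<mu> B + ennreal (1 / Suc i)"
    ..
  then have w: "B \<subseteq> (\<Union>j. basic_open (w i j))"
      "emeasure \<mu> (\<Union>j. basic_open (w i j)) < emeasure \<mu> B + ennreal (1 / Suc i)" for i
    by simp_all
  define w' where "w' n = (case prod_decode n of (i, j) \<Rightarrow> w i j)" for n
  have gd: "gdelta w' = (\<Inter>i. \<Union>j. basic_open (w i j))"
    by (simp add: gdelta_def w'_def)
  have ms [measurable]: "(\<Union>j. basic_open (w i j)) \<in> sets \<mu>" for i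
    by (auto simp: sets intro!: borel_open open_UN open_basic_open)
  have gm: "gdelta w' \<in> sets \<mu>"
    unfolding gd by (rule sets.countable_INT) (use ms in auto)
  have sub: "B \<subseteq> gdelta w'"
    using w(1) unfolding gd by auto
  have "emeasure \<mu> (gdelta w') \<le> emeasure \<mu> B"
  proof (rule ennreal_le_epsilon)
    fix e :: real assume "0 < e"
    then obtain i where i: "1 / Suc i < e"
      using nat_approx_posE by blast
    have "emeasure \<mu> (gdelta w') \<le> emeasure \<mu> (\<Union>j. basic_open (w i j))"
      by (rule emeasure_mono[OF _ ms]) (auto simp: gd)
    also have "\<dots> \<le> emeasure \<mu> B + ennreal (1 / Suc i)"
      using w(2)[of i] by simp
    also have "\<dots> \<le> emeasure \<mu> B + ennreal e"
      using i by (intro add_left_mono ennreal_leI) auto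
    finally show "emeasure \<mu> (gdelta w') \<le> emeasure \<mu> B + ennreal e" .
  qed
  then have "emeasure \<mu> (gdelta w' - B) = 0"
    using sub B gm by (subst emeasure_Diff) (auto simp: diff_eq_0_ennreal less_top[symmetric] sets)
  moreover have "gdelta w' - B \<in> sets \<mu>"
    using gm B sets by auto
  ultimately have "AE p in \<mu>. p \<notin> gdelta w' - B"
    by (intro AE_not_in null_setsI)
  then have "AE p in \<mu>. p \<in> gdelta w' \<longleftrightarrow> p \<in> B"
    using sub by (auto elim!: eventually_mono)
  then show ?thesis by blast
qed

text \<open>There are only countably many pairs of a coordinate and a value, so the exceptional null
  sets of all the approximations unite to one, and all the codes fit into a single
  \<open>z\<close>.\<close>

theorem universal_AE:
  fixes \<mu> :: "'p::polish_space measure"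
  assumes \<mu>: "finite_measure \<mu>" "sets \<mu> = sets borel" and \<phi>: "\<phi> \<in> borel \<rightarrow>\<^sub>M baire"
  shows "\<exists>z. AE p in \<mu>. universal z p = \<phi> p"
proof -
  have "\<exists>w. AE p in \<mu>. p \<in> gdelta w \<longleftrightarrow> \<phi> p k = m" for k m
  proof -
    have "{p \<in> space borel. \<phi> p k = m} \<in> sets borel"
      using \<phi> by measurable
    from gdelta_approx[OF \<mu> this] show ?thesis by simp
  qed
  then have "\<forall>km. \<exists>w. AE p in \<mu>. p \<in> gdelta w \<longleftrightarrow> \<phi> p (fst km) = snd km"
    by simp
  from choice[OF this] obtain w where w: "\<And>km. AE p in \<mu>. p \<in> gdelta (w km) \<longleftrightarrow> \<phi> p (fst km) = snd km"
    by blast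
  define z where "z n = (case prod_decode n of (k, n') \<Rightarrow> case prod_decode n' of (m, l) \<Rightarrow> w (k, m) l)" for n
  have z: "(\<lambda>l. z (prod_encode (k, prod_encode (m, l)))) = w (k, m)" for k m
    by (simp add: z_def)
  have "AE p in \<mu>. \<forall>km. p \<in> gdelta (w km) \<longleftrightarrow> \<phi> p (fst km) = snd km"
    unfolding AE_all_countable using w by blast
  then have "AE p in \<mu>. universal z p = \<phi> p"
  proof (rule eventually_mono)
    fix p assume p: "\<forall>km. p \<in> gdelta (w km) \<longleftrightarrow> \<phi> p (fst km) = snd km"
    have "universal z p k = \<phi> p k" for k
      unfolding universal_def z using p by (simp add: Least_equality)
    then show "universal z p = \<phi> p" by blast
  qed
  then show ?thesis by blast
qed

section \<open>Coding Baire space in the real line\<close>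

definition ternary :: "(nat \<Rightarrow> real) \<Rightarrow> real" where
  "ternary b = (\<Sum>k. b k / 3 ^ Suc k)"

lemma ternary_summable:
  assumes "\<And>k. b k \<in> {0, 1}"
  shows "summable (\<lambda>k. b k / 3 ^ Suc k :: real)"
proof (rule summable_comparison_test')
  show "summable (\<lambda>k. (1 / 3) ^ k :: real)"
    by (rule summable_geometric) simp
  show "norm (b n / 3 ^ Suc n) \<le> (1 / 3) ^ n" for n
    using assms[of n] by (auto simp: power_one_over divide_simps)
qed

lemma ternary_Suc:
  assumes "\<And>k. b k \<in> {0, 1}"
  shows "3 * ternary b = b 0 + ternary (\<lambda>k. b (Suc k))"
proof -
  have "ternary b = b 0 / 3 + (\<Sum>k. b (Suc k) / 3 ^ Suc (Suc k))"
    unfolding ternary_def using suminf_split_head[of "\<lambda>k. b k / 3 ^ Suc k", OF ternary_summable[of b, OF assms]] by simp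
  also have "(\<Sum>k. b (Suc k) / 3 ^ Suc (Suc k)) = (\<Sum>k. (b (Suc k) / 3 ^ Suc k) * (1 / 3))"
    by (simp add: field_simps)
  also have "\<dots> = ternary (\<lambda>k. b (Suc k)) * (1 / 3)"
    unfolding ternary_def by (rule suminf_mult2[symmetric]) (rule ternary_summable, rule assms)
  finally show ?thesis by simp
qed

lemma ternary_bounds:
  assumes "\<And>k. b k \<in> {0, 1}"
  shows "0 \<le> ternary b" "ternary b \<le> 1 / 2"
proof -
  have "0 \<le> b k" "b k \<le> 1" for k
    using assms[of k] by auto
  then show "0 \<le> ternary b"
    unfolding ternary_def by (intro suminf_nonneg ternary_summable assms) simp
  have "(\<lambda>k. (1 / 3) * (1 / 3) ^ k) sums ((1 / 3) * (1 / (1 - 1 / 3 :: real)))"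
    by (intro sums_mult geometric_sums) simp
  then have s: "(\<lambda>k. 1 / 3 ^ Suc k) sums (1 / 2 :: real)"
    by (simp add: power_one_over)
  have "ternary b \<le> (\<Sum>k. 1 / 3 ^ Suc k)"
    unfolding ternary_def using \<open>\<And>k. b k \<le> 1\<close> s
    by (intro suminf_le ternary_summable assms) (auto simp: divide_right_mono sums_iff)
  with s show "ternary b \<le> 1 / 2"
    by (simp add: sums_iff)
qed

text \<open>With digits 0 and 1 the tail of a base-three expansion is at most \<open>1 / 2\<close>,
  so it never carries over and the floor exposes each digit. In base two a tail of ones would be
  ambiguous.\<close>

lemma ternary_digit:
  assumes "\<And>k. b k \<in> {0, 1}"
  shows "real_of_int (\<lfloor>3 ^ Suc i * ternary b\<rfloor> mod 3) = b i"
  using assms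
proof (induction i arbitrary: b)
  case 0
  have "ternary (\<lambda>k. b (Suc k)) < 1" "0 \<le> ternary (\<lambda>k. b (Suc k))"
    using ternary_bounds[of "\<lambda>k. b (Suc k)"] 0 by auto
  moreover have "b 0 = 0 \<or> b 0 = 1" using 0[of 0] by auto
  ultimately have "\<lfloor>3 * ternary b\<rfloor> = (if b 0 = 0 then 0 else 1)"
    unfolding ternary_Suc[OF 0] by (auto simp: floor_eq_iff)
  with \<open>b 0 = 0 \<or> b 0 = 1\<close> show ?case by auto
next
  case (Suc i)
  have b0: "b 0 = 0 \<or> b 0 = 1" using Suc.prems[of 0] by auto
  define d :: int where "d = (if b 0 = 0 then 0 else 1)"
  have d: "b 0 = of_int d" using b0 by (auto simp: d_def)
  have "3 ^ Suc (Suc i) * ternary b = 3 ^ Suc i * (3 * ternary b)" by simp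
  also have "\<dots> = of_int (3 ^ Suc i * d) + 3 ^ Suc i * ternary (\<lambda>k. b (Suc k))"
    unfolding ternary_Suc[OF Suc.prems] by (simp add: d distrib_left)
  finally have "\<lfloor>3 ^ Suc (Suc i) * ternary b\<rfloor> = 3 ^ Suc i * d + \<lfloor>3 ^ Suc i * ternary (\<lambda>k. b (Suc k))\<rfloor>"
    by (simp only: int_add_floor)
  then have "\<lfloor>3 ^ Suc (Suc i) * ternary b\<rfloor> mod 3 = \<lfloor>3 ^ Suc i * ternary (\<lambda>k. b (Suc k))\<rfloor> mod 3"
    by (simp add: mult.assoc)
  then show ?case
    using Suc.IH[of "\<lambda>k. b (Suc k)"] Suc.prems by simp
qed

text \<open>The digits form the indicator of the graph of \<open>z\<close>, which turns arbitrary
  natural numbers into digits 0 and 1.\<close>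

definition baire_real :: "(nat \<Rightarrow> nat) \<Rightarrow> real" where
  "baire_real z = ternary (\<lambda>i. if z (fst (prod_decode i)) = snd (prod_decode i) then 1 else 0)"

definition real_baire :: "real \<Rightarrow> nat \<Rightarrow> nat" where
  "real_baire r n = (LEAST m. \<lfloor>3 ^ Suc (prod_encode (n, m)) * r\<rfloor> mod 3 = 1)"

lemma real_baire_inverse: "real_baire (baire_real z) = z"
proof
  fix n
  let ?b = "\<lambda>i. if z (fst (prod_decode i)) = snd (prod_decode i) then 1 else (0::real)"
  have b01: "?b k \<in> {0, 1}" for k by simp
  have "\<lfloor>3 ^ Suc (prod_encode (n, m)) * ternary ?b\<rfloor> mod 3 = 1 \<longleftrightarrow> z n = m" for m
    using ternary_digit[of ?b "prod_encode (n, m)", OF b01] by (simp split: if_splits)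
  then show "real_baire (baire_real z) n = z n"
    unfolding real_baire_def baire_real_def by (simp add: Least_equality)
qed

lemma measurable_real_baire [measurable]: "real_baire \<in> borel \<rightarrow>\<^sub>M baire"
proof (rule measurable_baireI)
  show "(\<lambda>r. real_baire r n) \<in> borel \<rightarrow>\<^sub>M count_space UNIV" for n
    unfolding real_baire_def by measurable
qed

lemma measurable_baire_real [measurable]: "baire_real \<in> baire \<rightarrow>\<^sub>M borel"
proof -
  have "(\<lambda>z. z i) \<in> baire \<rightarrow>\<^sub>M count_space UNIV" for i
    by (rule measurable_baire_component) simp
  then show ?thesis
    unfolding baire_real_def ternary_def by measurable
qed

text \<open>A point is coded by the least indices of dense points that approximate it ever more
  closely, and it is recovered as their limit. Codes that do not converge, or converge outside
  \<open>A\<close>, are sent to a fixed point \<open>a0\<close> of \<open>A\<close>.\<close>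

lemma baire_retract:
  fixes A :: "'a::polish_space set"
  assumes A: "A \<in> sets borel" "A \<noteq> {}"
  obtains j d where "j \<in> borel \<rightarrow>\<^sub>M baire" "d \<in> baire \<rightarrow>\<^sub>M restrict_space borel A" "\<And>a. a \<in> A \<Longrightarrow> d (j a) = a"
proof -
  obtain D :: "'a set" where D: "countable D" "\<And>X. open X \<Longrightarrow> X \<noteq> {} \<Longrightarrow> \<exists>d\<in>D. d \<in> X"
    using countable_dense_setE by blast
  then have "D \<noteq> {}" by fastforce
  define e where "e = from_nat_into D"
  have e: "range e = D"
    unfolding e_def using \<open>D \<noteq> {}\<close> D(1) by (rule range_from_nat_into)
  have dense: "\<exists>i. dist (e i) a < 1 / real (Suc n)" for a n
  proof -
    have "ball a (1 / real (Suc n)) \<noteq> {}" by (auto intro!: exI[of _ a])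
    from D(2)[OF open_ball this] show ?thesis
      unfolding e[symmetric] by (auto simp: dist_commute)
  qed
  define j where "j a n = (LEAST i. dist (e i) a < 1 / real (Suc n))" for a n
  have j: "dist (e (j a n)) a < 1 / real (Suc n)" for a n
    unfolding j_def using dense by (rule LeastI_ex)
  have j_lim: "(\<lambda>n. e (j a n)) \<longlonglongrightarrow> a" for a
  proof (rule metric_LIMSEQ_I)
    fix r :: real assume "0 < r"
    then obtain m where m: "1 / real (Suc m) < r"
      using nat_approx_posE by blast
    have "dist (e (j a n)) a < r" if "m \<le> n" for n
    proof -
      have "1 / real (Suc n) \<le> 1 / real (Suc m)"
        using that by (intro divide_left_mono) auto
      with j[of a n] m show ?thesis by linarith
    qed
    then show "\<exists>no. \<forall>n\<ge>no. dist (e (j a n)) a < r" by blast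
  qed
  obtain a0 where "a0 \<in> A" using A by auto
  define L where "L z = lim (\<lambda>n. if Cauchy (\<lambda>n. e (z n)) then e (z n) else a0)" for z :: "nat \<Rightarrow> nat"
  define d where "d z = (if L z \<in> A then L z else a0)" for z
  have comp [measurable]: "(\<lambda>z. e (z i)) \<in> baire \<rightarrow>\<^sub>M borel" for i
  proof -
    have "(\<lambda>z. z i) \<in> baire \<rightarrow>\<^sub>M count_space UNIV"
      by (rule measurable_baire_component) simp
    then show ?thesis by (rule measurable_compose) simp
  qed
  have [measurable]: "L \<in> baire \<rightarrow>\<^sub>M borel"
  proof (rule borel_measurable_LIMSEQ_metric)
    have [measurable]: "Measurable.pred baire (\<lambda>z. Cauchy (\<lambda>n. e (z n)))"
      unfolding pred_def by (rule sets_Collect_Cauchy) (rule comp)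
    show "(\<lambda>z. if Cauchy (\<lambda>n. e (z n)) then e (z n) else a0) \<in> baire \<rightarrow>\<^sub>M borel" for n
      by measurable
    fix z :: "nat \<Rightarrow> nat"
    have "convergent (\<lambda>n. if Cauchy (\<lambda>n. e (z n)) then e (z n) else a0)"
      by (cases "Cauchy (\<lambda>n. e (z n))") (auto simp: Cauchy_convergent_iff convergent_const)
    then show "(\<lambda>n. if Cauchy (\<lambda>n. e (z n)) then e (z n) else a0) \<longlonglongrightarrow> L z"
      by (simp add: L_def convergent_LIMSEQ_iff)
  qed
  show thesis
  proof
    show "j \<in> borel \<rightarrow>\<^sub>M baire"
    proof (rule measurable_baireI)
      show "(\<lambda>a. j a n) \<in> borel \<rightarrow>\<^sub>M count_space UNIV" for n
        unfolding j_def by measurable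
    qed
    have "d \<in> baire \<rightarrow>\<^sub>M borel"
      using A(1) unfolding d_def by measurable
    then show "d \<in> baire \<rightarrow>\<^sub>M restrict_space borel A"
      by (rule measurable_restrict_space2[rotated]) (auto simp: d_def \<open>a0 \<in> A\<close>)
    fix a assume "a \<in> A"
    have "Cauchy (\<lambda>n. e (j a n))"
      using j_lim by (rule LIMSEQ_imp_Cauchy)
    then have "L (j a) = a"
      unfolding L_def using j_lim by (simp add: limI)
    with \<open>a \<in> A\<close> show "d (j a) = a"
      by (simp add: d_def)
  qed
qed

section \<open>Relaxed controls\<close>

lemma prob_space_unit_interval: "prob_space (restrict_space lborel {0<..<1::real})"
  by (auto simp: emeasure_restrict_space space_restrict_space intro!: prob_spaceI)

lemma space_pos: "space (restrict_space borel {0<..}) = {0::real<..}"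
  by (simp add: space_restrict_space)

lemma measurable_pos_ident:
  "(\<lambda>t. t) \<in> restrict_space borel {0::real<..} \<rightarrow>\<^sub>M borel"
  "(\<lambda>t. t) \<in> restrict_space lborel {0::real<..} \<rightarrow>\<^sub>M borel"
  by (simp_all add: measurable_restrict_space1)

text \<open>The exponential law has the null sets of Lebesgue measure on the positive half-line but
  is finite, and its density is the weight in the generators of \<open>RM A\<close>. It replaces
  Lebesgue measure wherever a probability is required.\<close>

definition exp_pos :: "real measure" where
  "exp_pos = density (restrict_space lborel {0<..}) (\<lambda>t. ennreal (exp (- t)))"

lemma sets_exp_pos [measurable_cong, simp]: "sets exp_pos = sets (restrict_space borel {0<..})"
  by (simp add: exp_pos_def sets_restrict_space)

lemma space_exp_pos [simp]: "space exp_pos = {0<..}"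
  by (simp add: exp_pos_def space_restrict_space)

context
  notes measurable_pos_ident [measurable]
begin

lemma nn_integral_pos_eq:
  assumes "f \<in> borel_measurable (restrict_space borel {0<..})"
  shows "(\<integral>\<^sup>+ t \<in> {0<..}. f t \<partial>lborel) = (\<integral>\<^sup>+ t. ennreal (exp t) * f t \<partial>exp_pos)"
proof -
  have [measurable]: "f \<in> borel_measurable (restrict_space lborel {0<..})"
    using assms by (simp cong: measurable_cong_sets add: sets_restrict_space)
  have "(\<integral>\<^sup>+ t. ennreal (exp t) * f t \<partial>exp_pos)
      = (\<integral>\<^sup>+ t. ennreal (exp (- t)) * (ennreal (exp t) * f t) \<partial>restrict_space lborel {0<..})"
    unfolding exp_pos_def by (rule nn_integral_density) measurable
  also have "\<dots> = (\<integral>\<^sup>+ t. f t \<partial>restrict_space lborel {0<..})"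
    by (simp add: mult.assoc[symmetric] ennreal_mult'[symmetric] exp_minus)
  finally show ?thesis
    by (simp add: nn_integral_restrict_space)
qed

lemma prob_space_exp_pos: "prob_space exp_pos"
proof
  have "emeasure exp_pos (space exp_pos) = (\<integral>\<^sup>+ t. ennreal (exp (- t)) * indicator {0<..} t \<partial>lborel)"
    unfolding exp_pos_def
    by (subst emeasure_density)
       (auto simp: space_restrict_space nn_integral_restrict_space sets_restrict_space
         intro!: nn_integral_cong split: split_indicator)
  also have "\<dots> = (\<integral>\<^sup>+ t. ennreal (exponential_density 1 t) \<partial>lborel)"
    using AE_lborel_singleton[of 0]
    by (intro nn_integral_cong_AE) (auto simp: exponential_density_def elim!: eventually_mono split: split_indicator)
  also have "\<dots> = 1"
    using prob_space.emeasure_space_1[OF prob_space_exponential_density[of 1]]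
    by (simp add: emeasure_density)
  finally show "emeasure exp_pos (space exp_pos) = 1" .
qed

lemma AE_exp_pos: "(AE t in exp_pos. P t) \<longleftrightarrow> (AE t in lborel. 0 < t \<longrightarrow> P t)"
proof -
  have "(AE t in exp_pos. P t) \<longleftrightarrow> (AE t in restrict_space lborel {0<..}. P t)"
    unfolding exp_pos_def by (subst AE_density) auto
  also have "\<dots> \<longleftrightarrow> (AE t in lborel. t \<in> {0<..} \<longrightarrow> P t)"
    by (subst AE_restrict_space_iff) auto
  finally show ?thesis by simp
qed

end

text \<open>The distribution of the law \<open>\<rho> t\<close> transported to the line is realised by its quantile function on
  the unit interval, and quantile functions of \<open>(t, u)\<close> are coded by \<open>universal_AE\<close>.\<close>
theorem universal_relaxed_control:
  fixes A :: "'a::polish_space set"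
  assumes A: "A \<in> sets borel" "A \<noteq> {}"
  obtains \<Phi> :: "(nat \<Rightarrow> nat) \<Rightarrow> real \<Rightarrow> 'a measure"
  where "(\<lambda>(z, t). \<Phi> z t) \<in> baire \<Otimes>\<^sub>M borel \<rightarrow>\<^sub>M prob_algebra (BM A)"
    "\<And>\<rho>. \<rho> \<in> Rset A \<Longrightarrow> \<exists>z. AE t in lborel. 0 < t \<longrightarrow> \<Phi> z t = \<rho> t"
proof -
  obtain j d where j [measurable]: "j \<in> borel \<rightarrow>\<^sub>M baire" and d [measurable]: "d \<in> baire \<rightarrow>\<^sub>M BM A"
    and dj: "\<And>a. a \<in> A \<Longrightarrow> d (j a) = a"
    using baire_retract[OF A] by blast
  define U where "U = restrict_space lborel {0<..<1::real}"
  have sU [measurable_cong]: "sets U = sets (restrict_space borel {0<..<1})"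
    by (simp add: U_def sets_restrict_space)
  have spU: "space U = {0<..<1}"
    by (simp add: U_def space_restrict_space)
  interpret U: prob_space U
    unfolding U_def by (rule prob_space_unit_interval)
  interpret E: prob_space exp_pos
    by (rule prob_space_exp_pos)
  interpret EU: pair_prob_space exp_pos U ..
  have [measurable]: "(\<lambda>x. x) \<in> U \<rightarrow>\<^sub>M borel" "(\<lambda>x. x) \<in> exp_pos \<rightarrow>\<^sub>M borel"
    by (simp_all add: U_def measurable_restrict_space1 measurable_cong_sets[OF sets_exp_pos refl])
  define \<Phi> where "\<Phi> z t = distr U (BM A) (\<lambda>u. d (universal z (t, u)))" for z and t :: real
  have "(\<lambda>(z, t). \<Phi> z t) \<in> baire \<Otimes>\<^sub>M borel \<rightarrow>\<^sub>M prob_algebra (BM A)"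
    unfolding \<Phi>_def case_prod_unfold
  proof (rule measurable_distr_prob_space2[where M=U])
    show "(\<lambda>_. U) \<in> baire \<Otimes>\<^sub>M borel \<rightarrow>\<^sub>M prob_algebra U"
      by (rule measurable_const) (simp add: space_prob_algebra U.prob_space_axioms)
    have "(\<lambda>x. x) \<in> U \<rightarrow>\<^sub>M (borel :: real measure)"
      by measurable
    then have "snd \<in> (baire \<Otimes>\<^sub>M (borel :: real measure)) \<Otimes>\<^sub>M U \<rightarrow>\<^sub>M borel"
      by (rule measurable_compose[OF measurable_snd])
    then show "(\<lambda>(x, u). d (universal (fst x) (snd x, u))) \<in> (baire \<Otimes>\<^sub>M borel) \<Otimes>\<^sub>M U \<rightarrow>\<^sub>M BM A"
      unfolding case_prod_unfold
      by (intro measurable_compose[OF measurable_universal d] borel_measurable_Pair) measurable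
  qed
  moreover have "\<exists>z. AE t in lborel. 0 < t \<longrightarrow> \<Phi> z t = \<rho> t" if \<rho>: "\<rho> \<in> Rset A" for \<rho>
  proof -
    have \<rho>m [measurable]: "\<rho> \<in> restrict_space borel {0<..} \<rightarrow>\<^sub>M prob_algebra (BM A)"
      using \<rho> by (simp add: Rset_def)
    have \<rho>t: "prob_space (\<rho> t)" "sets (\<rho> t) = sets (BM A)" if "0 < t" for t
      using measurable_space[OF \<rho>m, of t] that by (auto simp: space_pos space_prob_algebra)
    have jA [measurable]: "(\<lambda>a. baire_real (j a)) \<in> BM A \<rightarrow>\<^sub>M borel"
      by (rule measurable_restrict_space1) measurable
    \<comment> \<open>The law of the action is moved to the real line, where the order provides a
      quantile function; \<open>real_baire\<close> followed by \<open>d\<close> undoes the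
      coding.\<close>
    define \<nu> where "\<nu> t = distr (\<rho> t) borel (\<lambda>a. baire_real (j a))" for t
    have \<nu>m: "\<nu> \<in> restrict_space borel {0<..} \<rightarrow>\<^sub>M prob_algebra borel"
      unfolding \<nu>_def by measurable
    have \<nu>t: "cdf_distribution (\<nu> t)" if "0 < t" for t
    proof -
      interpret prob_space "\<nu> t"
        unfolding \<nu>_def using \<rho>t[OF that] by (intro prob_space.prob_space_distr) (auto cong: measurable_cong_sets)
      show ?thesis
        by standard (simp add: \<nu>_def)
    qed
    \<comment> \<open>The quantile function of \<open>\<nu> t\<close>. Its sublevel sets are
      described by the distribution function, which makes it jointly measurable in time and
      level.\<close>
    define I where "I t u = Inf {x. u \<le> cdf (\<nu> t) x}" for t u
    have I_le: "I t u \<le> x \<longleftrightarrow> u \<le> cdf (\<nu> t) x" if "0 < t" "0 < u" "u < 1" for t u x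
    proof -
      interpret cdf_distribution "\<nu> t" using \<nu>t that by simp
      show ?thesis using pseudoinverse[of u x] that by (simp add: I_def)
    qed
    have [measurable]: "(\<lambda>t. cdf (\<nu> t) x) \<in> borel_measurable (restrict_space borel {0<..})" for x
      unfolding cdf_def by (rule measurable_compose[OF \<nu>m measurable_measure_prob_algebra]) simp
    define X where "X = {0::real<..} \<times> {0::real<..<1}"
    have X: "X \<in> sets borel"
      unfolding X_def borel_prod[symmetric] by measurable
    have fX: "fst \<in> restrict_space borel X \<rightarrow>\<^sub>M restrict_space borel {0::real<..}"
      by (rule measurable_restrict_space2) (auto simp: space_restrict_space X_def borel_prod[symmetric] intro!: measurable_restrict_space1)
    have sX: "snd \<in> restrict_space borel X \<rightarrow>\<^sub>M (borel :: real measure)"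
      by (auto simp: borel_prod[symmetric] intro!: measurable_restrict_space1)
    have "(\<lambda>p. I (fst p) (snd p)) \<in> borel_measurable (restrict_space borel X)"
    proof (subst borel_measurable_iff_le, rule allI)
      fix x
      have "{p \<in> space (restrict_space borel X). I (fst p) (snd p) \<le> x}
          = {p \<in> space (restrict_space borel X). snd p \<le> cdf (\<nu> (fst p)) x}"
        by (auto simp: space_restrict_space X_def I_le)
      also have "\<dots> \<in> sets (restrict_space borel X)"
        using fX sX by measurable
      finally show "{p \<in> space (restrict_space borel X). I (fst p) (snd p) \<le> x} \<in> sets (restrict_space borel X)" .
    qed
    then have F: "(\<lambda>p. real_baire (I (fst p) (snd p))) \<in> restrict_space borel X \<rightarrow>\<^sub>M baire"
      by (rule measurable_compose) simp
    \<comment> \<open>\<open>universal_AE\<close> asks for a map on the whole plane, so the quantile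
      code is extended by a constant outside \<open>X\<close>, a set of full measure for the law
      \<open>\<mu>\<close> below.\<close>
    define \<phi> where "\<phi> p = (if p \<in> X then real_baire (I (fst p) (snd p)) else (\<lambda>_. 0))" for p
    have \<phi>: "\<phi> \<in> borel \<rightarrow>\<^sub>M baire"
      unfolding \<phi>_def using F X by (subst (asm) measurable_restrict_space_iff[where c="\<lambda>_. 0"]) auto
    define \<mu> where "\<mu> = distr (exp_pos \<Otimes>\<^sub>M U) borel (\<lambda>p. (fst p, snd p))"
    have idm: "(\<lambda>p. (fst p, snd p)) \<in> exp_pos \<Otimes>\<^sub>M U \<rightarrow>\<^sub>M (borel :: (real \<times> real) measure)"
      unfolding borel_prod[symmetric]
      by (intro measurable_Pair measurable_compose[OF measurable_fst] measurable_compose[OF measurable_snd]) measurable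
    have "finite_measure \<mu>"
      unfolding \<mu>_def using EU.prob_space_distr[OF idm] by (rule prob_space.finite_measure)
    then obtain z where "AE p in \<mu>. universal z p = \<phi> p"
      using universal_AE[OF _ _ \<phi>, of \<mu>] by (auto simp: \<mu>_def)
    then have "AE p in exp_pos \<Otimes>\<^sub>M U. universal z p = \<phi> p"
      unfolding \<mu>_def using AE_distrD[OF idm] by force
    then have "AE t in exp_pos. AE u in U. universal z (t, u) = \<phi> (t, u)"
      by (rule EU.AE_pair)
    then have "AE t in lborel. 0 < t \<longrightarrow> (AE u in U. universal z (t, u) = \<phi> (t, u))"
      by (simp add: AE_exp_pos)
    then have "AE t in lborel. 0 < t \<longrightarrow> \<Phi> z t = \<rho> t"
    proof (rule eventually_mono, intro impI)
      fix t :: real assume *: "0 < t \<longrightarrow> (AE u in U. universal z (t, u) = \<phi> (t, u))" and t: "0 < t"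
      interpret cdf_distribution "\<nu> t" by (rule \<nu>t[OF t])
      have It: "I t = (\<lambda>u. Inf {x. u \<le> cdf (\<nu> t) x})"
        by (simp add: I_def fun_eq_iff)
      have Itm [measurable]: "I t \<in> borel_measurable U"
        using measurable_CI unfolding It by (simp cong: measurable_cong_sets add: sU)
      have zt: "(\<lambda>u. universal z (t, u)) \<in> U \<rightarrow>\<^sub>M baire"
        by (intro measurable_universal borel_measurable_Pair) measurable
      have "\<Phi> z t = distr U (BM A) (\<lambda>u. d (real_baire (I t u)))"
        unfolding \<Phi>_def
      proof (rule distr_cong_AE[OF refl refl])
        show "AE u in U. d (universal z (t, u)) = d (real_baire (I t u))"
          using *[rule_format, OF t] AE_space by eventually_elim (use t in \<open>auto simp: \<phi>_def X_def spU\<close>)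
      qed (use zt in measurable)
      also have "\<dots> = distr (distr U borel (I t)) (BM A) (\<lambda>r. d (real_baire r))"
        by (subst distr_distr) (auto simp: comp_def)
      also have "distr U borel (I t) = \<nu> t"
        using distr_I_eq_M unfolding It U_def .
      also have "distr (\<nu> t) (BM A) (\<lambda>r. d (real_baire r)) = distr (\<rho> t) (BM A) (\<lambda>a. d (real_baire (baire_real (j a))))"
        unfolding \<nu>_def using \<rho>t[OF t] by (subst distr_distr) (auto simp: comp_def cong: measurable_cong_sets)
      also have "\<dots> = distr (\<rho> t) (BM A) (\<lambda>a. a)"
        using sets_eq_imp_space_eq[OF \<rho>t(2)[OF t]]
        by (intro distr_cong refl) (auto simp: real_baire_inverse dj space_restrict_space)
      also have "\<dots> = \<rho> t"
        by (rule distr_id2) (simp add: \<rho>t[OF t])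
      finally show "\<Phi> z t = \<rho> t" .
    qed
    then show ?thesis by blast
  qed
  ultimately show thesis by (rule that)
qed

section \<open>The sigma-algebra on controls\<close>

lemma sets_RM_gen: "f \<in> Rtest A \<Longrightarrow> B \<in> sets borel \<Longrightarrow>
    (\<lambda>\<rho>. LINT t:{0<..}|lborel. exp (- t) * f (t, \<rho> t)) -` B \<inter> Rset A \<in> sets (RM A)"
  unfolding RM_def by (subst sets_measure_of) (auto intro!: sigma_sets.Basic)

lemma space_RM [simp]: "space (RM A) = Rset A"
  unfolding RM_def by (rule space_measure_of) auto

lemma RsetD: "\<rho> \<in> Rset A \<Longrightarrow> \<rho> \<in> restrict_space borel {0<..} \<rightarrow>\<^sub>M prob_algebra (BM A)"
  by (simp add: Rset_def)

context
  notes measurable_pos_ident [measurable]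
begin

lemma Rtest_integral:
  assumes "\<rho> \<in> Rset A" "f \<in> Rtest A"
  shows "(LINT t:{0<..}|lborel. exp (- t) * f (t, \<rho> t)) = (LINT t|exp_pos. f (t, \<rho> t))"
proof -
  have [measurable]: "\<rho> \<in> restrict_space borel {0<..} \<rightarrow>\<^sub>M prob_algebra (BM A)"
    "f \<in> borel_measurable (restrict_space borel {0<..} \<Otimes>\<^sub>M prob_algebra (BM A))"
    using assms by (simp_all add: Rset_def Rtest_def)
  have m: "(\<lambda>t. f (t, \<rho> t)) \<in> borel_measurable (restrict_space borel {0<..})"
    by measurable
  then have "(\<lambda>t. f (t, \<rho> t)) \<in> borel_measurable (restrict_space lborel {0<..})"
    by (simp cong: measurable_cong_sets add: sets_restrict_space)
  then show ?thesis
    unfolding exp_pos_def set_lebesgue_integral_def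
    by (subst integral_density) (auto simp: integral_restrict_space)
qed

end

text \<open>For a jointly measurable family each generating functional of \<open>RM A\<close>
  becomes a parameter integral against the probability \<open>exp_pos\<close>, which is measurable
  in the parameter.\<close>

lemma measurable_RM:
  assumes "\<And>y. y \<in> space Y \<Longrightarrow> g y \<in> Rset A"
    and g: "(\<lambda>(y, t). g y t) \<in> Y \<Otimes>\<^sub>M restrict_space borel {0<..} \<rightarrow>\<^sub>M prob_algebra (BM A)"
  shows "g \<in> Y \<rightarrow>\<^sub>M RM A"
  unfolding RM_def
proof (rule measurable_measure_of)
  fix D assume "D \<in> (\<Union>f \<in> Rtest A. {(\<lambda>\<rho>. LINT t:{0<..}|lborel. exp (- t) * f (t, \<rho> t)) -` B \<inter> Rset A | B. B \<in> sets borel})"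
  then obtain f B where f: "f \<in> Rtest A" and B: "B \<in> sets borel"
    and D: "D = (\<lambda>\<rho>. LINT t:{0<..}|lborel. exp (- t) * f (t, \<rho> t)) -` B \<inter> Rset A"
    by blast
  interpret E: prob_space exp_pos
    by (rule prob_space_exp_pos)
  have [measurable]: "f \<in> borel_measurable (restrict_space borel {0<..} \<Otimes>\<^sub>M prob_algebra (BM A))"
    using f by (simp add: Rtest_def)
  note [measurable] = g
  have "(\<lambda>y. LINT t|exp_pos. f (t, g y t)) \<in> borel_measurable Y"
    by measurable
  then have "(\<lambda>y. LINT t|exp_pos. f (t, g y t)) -` B \<inter> space Y \<in> sets Y"
    using B by (rule measurable_sets)
  also have "(\<lambda>y. LINT t|exp_pos. f (t, g y t)) -` B \<inter> space Y = g -` D \<inter> space Y"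
    using assms(1) by (auto simp: D Rtest_integral[OF _ f])
  finally show "g -` D \<inter> space Y \<in> sets Y" .
qed (use assms(1) in auto)

text \<open>The generators see a control only through integrals over time, and the sets that do not
  separate two given controls form a sigma-algebra. This is what allows an arbitrary control to be
  replaced by a coded one.\<close>

lemma RM_AE_invariant:
  assumes D: "D \<in> sets (RM A)" and "\<rho> \<in> Rset A" "\<rho>' \<in> Rset A"
    and ae: "AE t in lborel. 0 < t \<longrightarrow> \<rho> t = \<rho>' t"
  shows "\<rho> \<in> D \<longleftrightarrow> \<rho>' \<in> D"
proof -
  have "D \<in> sigma_sets (Rset A) (\<Union>f \<in> Rtest A. {(\<lambda>\<rho>. LINT t:{0<..}|lborel. exp (- t) * f (t, \<rho> t)) -` B \<inter> Rset A | B. B \<in> sets borel})"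
    using D unfolding RM_def by (subst (asm) sets_measure_of) auto
  then show ?thesis
  proof induction
    case (Basic D)
    then obtain f B where f: "f \<in> Rtest A"
      and D: "D = (\<lambda>\<rho>. LINT t:{0<..}|lborel. exp (- t) * f (t, \<rho> t)) -` B \<inter> Rset A"
      by blast
    have [measurable]: "f \<in> borel_measurable (restrict_space borel {0<..} \<Otimes>\<^sub>M prob_algebra (BM A))"
      using f by (simp add: Rtest_def)
    note [measurable] = RsetD[OF assms(2)] RsetD[OF assms(3)]
    have "(LINT t|exp_pos. f (t, \<rho> t)) = (LINT t|exp_pos. f (t, \<rho>' t))"
      using ae[folded AE_exp_pos] by (intro integral_cong_AE) (measurable, auto elim: eventually_mono)
    with f show ?case
      using assms(2,3) by (simp add: D Rtest_integral)
  qed (use assms(2,3) in auto)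
qed

lemma RM_AE_cong:
  fixes f :: "_ \<Rightarrow> ennreal"
  assumes f: "f \<in> borel_measurable (RM A)" and \<rho>: "\<rho> \<in> Rset A" "\<rho>' \<in> Rset A"
    and ae: "AE t in lborel. 0 < t \<longrightarrow> \<rho> t = \<rho>' t"
  shows "f \<rho> = f \<rho>'"
proof -
  have "f -` {f \<rho>'} \<inter> space (RM A) \<in> sets (RM A)"
    using f by (rule measurable_sets) simp
  from RM_AE_invariant[OF this \<rho> ae] show ?thesis
    using \<rho> by simp
qed

text \<open>Evaluation at a single time is in general not measurable on \<open>RM A\<close>, but the
  joint law of a random time and the action law used then is: its mass on a set \<open>G\<close> is
  the generating functional of the indicator of \<open>G\<close>.\<close>

lemma measurable_RM_graph:
  "(\<lambda>\<rho>. distr exp_pos (restrict_space borel {0<..} \<Otimes>\<^sub>M prob_algebra (BM A)) (\<lambda>t. (t, \<rho> t)))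
    \<in> RM A \<rightarrow>\<^sub>M subprob_algebra (restrict_space borel {0<..} \<Otimes>\<^sub>M prob_algebra (BM A))"
  (is "?K \<in> _ \<rightarrow>\<^sub>M subprob_algebra ?N")
proof (rule measurable_subprob_algebra)
  interpret E: prob_space exp_pos
    by (rule prob_space_exp_pos)
  have gr: "(\<lambda>t. (t, \<rho> t)) \<in> exp_pos \<rightarrow>\<^sub>M ?N" if "\<rho> \<in> Rset A" for \<rho>
    using RsetD[OF that] by (intro measurable_Pair) (auto cong: measurable_cong_sets)
  show "subprob_space (?K \<rho>)" if "\<rho> \<in> space (RM A)" for \<rho>
    using gr that by (intro prob_space_imp_subprob_space E.prob_space_distr) auto
  fix G assume G: "G \<in> sets ?N"
  then have f: "indicator G \<in> Rtest A"
    by (auto simp: Rtest_def indicator_def intro!: exI[of _ 1])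
  have eq: "emeasure (?K \<rho>) G = ennreal (LINT t:{0<..}|lborel. exp (- t) * indicator G (t, \<rho> t))"
    if \<rho>: "\<rho> \<in> space (RM A)" for \<rho>
  proof -
    have m: "(\<lambda>t. (t, \<rho> t)) -` G \<inter> space exp_pos \<in> sets exp_pos"
      using gr \<rho> G by (intro measurable_sets[of _ _ ?N]) auto
    have "emeasure (?K \<rho>) G = emeasure exp_pos ((\<lambda>t. (t, \<rho> t)) -` G \<inter> space exp_pos)"
      using gr \<rho> G by (intro emeasure_distr) auto
    also have "\<dots> = ennreal (LINT t|exp_pos. indicator ((\<lambda>t. (t, \<rho> t)) -` G \<inter> space exp_pos) t)"
      using m by (simp add: E.emeasure_eq_measure)
    also have "(LINT t|exp_pos. indicator ((\<lambda>t. (t, \<rho> t)) -` G \<inter> space exp_pos) t :: real)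
        = (LINT t|exp_pos. indicator G (t, \<rho> t))"
      by (intro Bochner_Integration.integral_cong) (auto split: split_indicator)
    finally show ?thesis
      using Rtest_integral[OF _ f] \<rho> by simp
  qed
  have "(\<lambda>\<rho>. LINT t:{0<..}|lborel. exp (- t) * (indicator G (t, \<rho> t) :: real)) \<in> borel_measurable (RM A)"
    using sets_RM_gen[OF f] by (intro measurableI) auto
  then show "(\<lambda>\<rho>. emeasure (?K \<rho>) G) \<in> borel_measurable (RM A)"
    by (subst measurable_cong[OF eq]) auto
qed simp

text \<open>The time integral is one against the kernel of \<open>measurable_RM_graph\<close>, with
  \<open>exp t\<close> removing the weight. It makes accumulated rates and jump integrals measurable
  in the control.\<close>

theorem measurable_RM_integral:
  assumes F: "F \<in> borel_measurable (Y \<Otimes>\<^sub>M (restrict_space borel {0<..} \<Otimes>\<^sub>M prob_algebra (BM A)))"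
    and g: "g \<in> Y \<rightarrow>\<^sub>M RM A"
  shows "(\<lambda>y. \<integral>\<^sup>+ t \<in> {0<..}. F (y, t, g y t) \<partial>lborel) \<in> borel_measurable Y"
proof -
  let ?N = "restrict_space borel {0::real<..} \<Otimes>\<^sub>M prob_algebra (BM A)"
  note [measurable] = F
  have ex: "(\<lambda>w. ennreal (exp (fst w))) \<in> borel_measurable ?N"
    by (rule measurable_compose[OF measurable_fst]) (use measurable_pos_ident in measurable)
  have exY: "(\<lambda>p. ennreal (exp (fst (snd p)))) \<in> borel_measurable (Y \<Otimes>\<^sub>M ?N)"
    by (rule measurable_compose[OF measurable_snd ex])
  have eq: "(\<integral>\<^sup>+ t \<in> {0<..}. F (y, t, g y t) \<partial>lborel)
      = (\<integral>\<^sup>+ w. ennreal (exp (fst w)) * F (y, w) \<partial>distr exp_pos ?N (\<lambda>t. (t, g y t)))"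
    if y: "y \<in> space Y" for y
  proof -
    have [measurable]: "g y \<in> restrict_space borel {0<..} \<rightarrow>\<^sub>M prob_algebra (BM A)"
      using measurable_space[OF g y] by (simp add: Rset_def)
    have Fy [measurable]: "(\<lambda>w. F (y, w)) \<in> borel_measurable ?N"
      using y by measurable
    have "(\<lambda>t. F (y, t, g y t)) \<in> borel_measurable (restrict_space borel {0<..})"
      using y by measurable
    then show ?thesis
      by (simp add: nn_integral_pos_eq)
        (subst nn_integral_distr, auto cong: measurable_cong_sets intro!: borel_measurable_times_ennreal ex)
  qed
  have "(\<lambda>y. \<integral>\<^sup>+ w. ennreal (exp (fst w)) * F (y, w) \<partial>distr exp_pos ?N (\<lambda>t. (t, g y t))) \<in> borel_measurable Y"
    by (rule nn_integral_measurable_subprob_algebra2[where N="?N"])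
       (use exY in measurable, rule measurable_compose[OF g measurable_RM_graph])
  then show ?thesis
    by (subst measurable_cong[OF eq]) auto
qed

section \<open>Exponentials and the survival function\<close>

abbreviation exp_plus :: "ennreal \<Rightarrow> ennreal" where
  "exp_plus x \<equiv> eexp (enn2ereal x)"

abbreviation exp_minus :: "ennreal \<Rightarrow> ennreal" where
  "exp_minus x \<equiv> eexp (- enn2ereal x)"

lemma eexp_simps [simp]: "eexp (ereal r) = ennreal (exp r)" "eexp \<infinity> = \<infinity>" "eexp (-\<infinity>) = 0"
  by (simp_all add: eexp_def)

lemma exp_plus_0 [simp]: "exp_plus 0 = 1"
  by (simp add: eexp_def zero_ennreal.rep_eq)

lemma exp_plus_mono: "x \<le> y \<Longrightarrow> exp_plus x \<le> exp_plus y"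
  by (cases x; cases y) (auto simp: ennreal_le_iff top_unique)

lemma one_le_exp_plus: "1 \<le> exp_plus x"
  using exp_plus_mono[of 0 x] by simp

lemma exp_plus_add: "exp_plus (x + y) = exp_plus x * exp_plus y"
  by (cases x; cases y)
     (auto simp: exp_add ennreal_mult ennreal_mult_top ennreal_top_mult ennreal_plus[symmetric]
       simp del: ennreal_plus)

text \<open>For \<open>x\<close> and \<open>y\<close> both infinite the left side is infinite while
  the product is 0; finiteness of \<open>y\<close> excludes that case.\<close>

lemma eexp_diff:
  assumes "y < \<infinity>"
  shows "eexp (enn2ereal x - enn2ereal y) = exp_plus x * exp_minus y"
  using assms
  by (cases x; cases y)
     (auto simp: exp_diff exp_minus ennreal_mult[symmetric] divide_inverse ennreal_top_mult)

lemma measurable_exp_plus [measurable]: "exp_plus \<in> borel_measurable borel"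
proof -
  have "exp_plus x = (if x = \<infinity> then \<infinity> else ennreal (exp (enn2real x)))" for x
    by (cases x) auto
  then show ?thesis
    by (subst measurable_cong) auto
qed

lemma measurable_exp_minus [measurable]: "exp_minus \<in> borel_measurable borel"
proof -
  have "exp_minus x = (if x = \<infinity> then 0 else ennreal (exp (- enn2real x)))" for x
    by (cases x) auto
  then show ?thesis
    by (subst measurable_cong) auto
qed

text \<open>The bound \<open>x \<le> exp_plus x\<close> settles an infinite supremum; for a finite
  one continuity of the real exponential suffices. The exponential of a total cost can thus be
  computed from finite horizons.\<close>

lemma exp_plus_SUP:
  assumes "incseq f"
  shows "exp_plus (SUP n. f n) = (SUP n. exp_plus (f n))"
proof (cases "SUP n. f n" rule: ennreal_cases)
  case top
  have "x \<le> exp_plus x" for x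
  proof (cases x)
    case (real r)
    then have "r \<le> exp r"
      using exp_ge_add_one_self[of r] by linarith
    with real show ?thesis by (simp add: ennreal_leI)
  qed simp
  then have "(SUP n. f n) \<le> (SUP n. exp_plus (f n))"
    by (intro SUP_mono) auto
  then have "(SUP n. exp_plus (f n)) = top"
    unfolding top by (simp only: top_unique)
  moreover have "exp_plus (SUP n. f n) = top"
    unfolding top by simp
  ultimately show ?thesis by (simp only:)
next
  case (real r)
  have fin: "f n \<noteq> \<infinity>" for n
    using SUP_upper[of n UNIV f] unfolding real by (auto simp: top_unique)
  have "f \<longlonglongrightarrow> ennreal r"
    using LIMSEQ_SUP[OF assms] real by simp
  then have "(\<lambda>n. enn2real (f n)) \<longlonglongrightarrow> r"
    using real by (intro tendsto_enn2real) auto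
  then have "(\<lambda>n. ennreal (exp (enn2real (f n)))) \<longlonglongrightarrow> ennreal (exp r)"
    by (intro tendsto_ennrealI tendsto_exp)
  moreover have "ennreal (exp (enn2real (f n))) = exp_plus (f n)" for n
    using fin[of n] by (cases "f n") auto
  ultimately have "(\<lambda>n. exp_plus (f n)) \<longlonglongrightarrow> exp_plus (SUP n. f n)"
    using real by simp
  moreover have "(\<lambda>n. exp_plus (f n)) \<longlonglongrightarrow> (SUP n. exp_plus (f n))"
    using assms by (intro LIMSEQ_SUP) (auto simp: incseq_def intro: exp_plus_mono)
  ultimately show ?thesis
    by (rule LIMSEQ_unique)
qed

text \<open>A set function passed to \<open>measure_of\<close> yields the zero measure unless it is
  countably additive. A functional on nonnegative functions that is additive, homogeneous and
  continuous along increasing sequences delivers countable additivity and the integral formula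
  together; \<open>qmix\<close> and \<open>jumpLaw\<close> both arise this way.\<close>

lemma measure_of_functional:
  fixes \<Lambda> :: "('x \<Rightarrow> ennreal) \<Rightarrow> ennreal" and M :: "'x measure"
  assumes add: "\<And>f g. f \<in> borel_measurable M \<Longrightarrow> g \<in> borel_measurable M \<Longrightarrow> \<Lambda> (\<lambda>x. f x + g x) = \<Lambda> f + \<Lambda> g"
    and mult: "\<And>f c. f \<in> borel_measurable M \<Longrightarrow> \<Lambda> (\<lambda>x. c * f x) = c * \<Lambda> f"
    and sup: "\<And>F. (\<And>i. F i \<in> borel_measurable M) \<Longrightarrow> incseq F \<Longrightarrow> \<Lambda> (\<lambda>x. SUP i::nat. F i x) = (SUP i. \<Lambda> (F i))"
    and cong: "\<And>f g. (\<And>x. x \<in> space M \<Longrightarrow> f x = g x) \<Longrightarrow> \<Lambda> f = \<Lambda> g"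
    and \<mu>: "\<And>E. E \<in> sets M \<Longrightarrow> \<mu> E = \<Lambda> (indicator E)"
    and f: "f \<in> borel_measurable M"
  shows "(\<integral>\<^sup>+ x. f x \<partial>measure_of (space M) (sets M) \<mu>) = \<Lambda> f"
proof -
  let ?N = "measure_of (space M) (sets M) \<mu>"
  have zero: "\<Lambda> (\<lambda>_. 0) = 0"
    using mult[of "\<lambda>_. 0" 0] by simp
  have fsum: "\<Lambda> (\<lambda>x. \<Sum>i<n. F i x) = (\<Sum>i<n. \<Lambda> (F i))"
    if [measurable]: "\<And>i. F i \<in> borel_measurable M" for F and n :: nat
    by (induction n) (simp_all add: zero add)
  have em: "emeasure ?N E = \<Lambda> (indicator E)" if "E \<in> sets M" for E
  proof (subst emeasure_measure_of[OF refl])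
    show "positive (sets ?N) \<mu>"
      using \<mu>[of "{}"] zero by (simp add: positive_def indicator_def[abs_def])
    show "countably_additive (sets ?N) \<mu>"
    proof (rule countably_additiveI)
      fix D :: "nat \<Rightarrow> _" assume D: "range D \<subseteq> sets ?N" "disjoint_family D"
      then have Dm [measurable]: "D i \<in> sets M" for i
        by auto
      have ind: "indicator (\<Union>i. D i) x = (SUP n. \<Sum>i<n. indicator (D i) x :: ennreal)" for x
        using suminf_indicator[OF D(2), of x] by (simp add: suminf_eq_SUP)
      have "\<mu> (\<Union>i. D i) = \<Lambda> (\<lambda>x. SUP n. \<Sum>i<n. indicator (D i) x)"
        by (subst \<mu>) (auto intro!: cong simp: ind)
      also have "\<dots> = (SUP n. \<Lambda> (\<lambda>x. \<Sum>i<n. indicator (D i) x))"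
        by (intro sup) (auto simp: incseq_def le_fun_def intro!: sum_mono2)
      also have "\<dots> = (\<Sum>i. \<mu> (D i))"
        by (simp add: fsum \<mu> suminf_eq_SUP)
      finally show "(\<Sum>i. \<mu> (D i)) = \<mu> (\<Union>i. D i)" by simp
    qed
  qed (use that \<mu> sets.sets_into_space in auto)
  have f': "f \<in> borel_measurable ?N"
    using f by (simp cong: measurable_cong_sets)
  then show ?thesis
  proof (induction rule: borel_measurable_induct)
    case (cong f g)
    have "\<Lambda> f = \<Lambda> g"
      using cong(3) by (intro assms(4)) simp
    moreover have "(\<integral>\<^sup>+ x. f x \<partial>?N) = (\<integral>\<^sup>+ x. g x \<partial>?N)"
      using cong(3) by (rule nn_integral_cong)
    ultimately show ?case using cong(4) by simp
  next
    case (set E)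
    then show ?case using em[of E] by simp
  next
    case (mult u c)
    then show ?case
      by (subst nn_integral_cmult) (auto simp: assms(2) cong: measurable_cong_sets)
  next
    case (add u v)
    then show ?case
      by (subst nn_integral_add) (auto simp: assms(1) cong: measurable_cong_sets)
  next
    case (seq U)
    then have "(\<integral>\<^sup>+ x. (SUP i. U i x) \<partial>?N) = (SUP i. \<integral>\<^sup>+ x. U i x \<partial>?N)"
      by (intro nn_integral_monotone_convergence_SUP) auto
    with seq show ?case
      using sup[of U] by (simp add: image_image Sup_fun_def cong: measurable_cong_sets)
  qed
qed

lemma nn_integral_exp_pos:
  assumes "f \<in> borel_measurable exp_pos"
  shows "(\<integral>\<^sup>+ t. f t \<partial>exp_pos) = (\<integral>\<^sup>+ t \<in> {0<..}. ennreal (exp (- t)) * f t \<partial>lborel)"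
proof -
  have [measurable]: "f \<in> borel_measurable (restrict_space borel {0<..})"
    using assms by (simp cong: measurable_cong_sets)
  have "(\<lambda>t. ennreal (exp (- t)) * f t) \<in> borel_measurable (restrict_space borel {0<..})"
    using measurable_pos_ident(1) by measurable
  from nn_integral_pos_eq[OF this] show ?thesis
    by (simp add: mult.assoc[symmetric] ennreal_mult[symmetric] exp_minus)
qed

lemma emeasure_exp_pos_Ioi:
  "emeasure exp_pos {a \<in> space exp_pos. r < ennreal a} = exp_minus r"
proof (cases r)
  case (real x)
  have eq: "{a \<in> space exp_pos. r < ennreal a} = {x<..}"
    using real by (auto simp: ennreal_less_iff)
  have x: "{x<..} \<in> sets exp_pos"
    using real by (auto simp: sets_restrict_space image_iff intro!: bexI[of _ "{x<..}"])
  have "emeasure exp_pos {x<..} = (\<integral>\<^sup>+ a. ennreal (exp (- a)) * indicator {x<..} a \<partial>restrict_space lborel {0<..})"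
    unfolding exp_pos_def using x[unfolded exp_pos_def] measurable_pos_ident(2)
    by (intro emeasure_density) auto
  also have "\<dots> = (\<integral>\<^sup>+ a. ennreal (exp (- a)) * indicator {x..} a \<partial>lborel)"
  proof (subst nn_integral_restrict_space)
    show "(\<integral>\<^sup>+ a. ennreal (exp (- a)) * indicator {x<..} a * indicator {0<..} a \<partial>lborel)
        = (\<integral>\<^sup>+ a. ennreal (exp (- a)) * indicator {x..} a \<partial>lborel)"
    proof (rule nn_integral_cong_AE)
      show "AE a in lborel. ennreal (exp (- a)) * indicator {x<..} a * indicator {0<..} a = ennreal (exp (- a)) * indicator {x..} a"
        using AE_lborel_singleton[of x] by eventually_elim (use real in \<open>auto split: split_indicator\<close>)
    qed
  qed simp
  also have "\<dots> = ennreal (0 - (- exp (- x)))"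
  proof (rule nn_integral_FTC_atLeast)
    have "((\<lambda>a::real. exp (- a)) \<longlongrightarrow> 0) at_top"
      by (rule filterlim_compose[OF exp_at_bot filterlim_uminus_at_bot_at_top])
    then show "((\<lambda>a. - exp (- a)) \<longlongrightarrow> (0::real)) at_top"
      using tendsto_minus by fastforce
  qed (auto intro!: derivative_eq_intros)
  finally show ?thesis
    using real unfolding eq by simp
qed simp

text \<open>The source of the total mass one of the jump law. As \<open>g\<close> is only
  measurable, no derivative of \<open>G\<close> is taken: \<open>exp_minus (G (ennreal t))\<close>
  is the probability that an exponential variable exceeds \<open>G (ennreal t)\<close>, and after an
  exchange of integrals the rate accumulated before \<open>G\<close> reaches a level
  \<open>a\<close> is \<open>min (ennreal a) (G \<infinity>)\<close>.\<close>

lemma survival_integral: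
  fixes g :: "real \<Rightarrow> ennreal"
  assumes g [measurable]: "g \<in> borel_measurable borel" and K: "\<And>t. g t \<le> ennreal K" and g0: "\<And>t. t \<le> 0 \<Longrightarrow> g t = 0"
  defines "G \<equiv> \<lambda>T. \<integral>\<^sup>+ s \<in> {s. ennreal s < T}. g s \<partial>lborel"
  shows "(\<integral>\<^sup>+ t. exp_minus (G (ennreal t)) * g t \<partial>lborel) + exp_minus (G \<infinity>) = 1"
proof -
  interpret E: prob_space exp_pos
    by (rule prob_space_exp_pos)
  interpret P: pair_sigma_finite lborel exp_pos ..
  have G_mono: "T \<le> T' \<Longrightarrow> G T \<le> G T'" for T T'
    unfolding G_def by (intro nn_integral_mono) (auto split: split_indicator)
  have [measurable]: "(\<lambda>t. G (ennreal t)) \<in> borel_measurable borel"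
    unfolding G_def by measurable
  \<comment> \<open>The bound \<open>K\<close> makes \<open>G\<close> Lipschitz on the nonnegative
    half-line, which supplies continuity from the right.\<close>
  have Grow: "G (ennreal (\<tau> + d)) \<le> G (ennreal \<tau>) + ennreal K * ennreal d" if "0 \<le> \<tau>" "0 \<le> d" for \<tau> d
  proof -
    have "G (ennreal (\<tau> + d)) \<le> (\<integral>\<^sup>+ s. g s * indicator {s. ennreal s < ennreal \<tau>} s + ennreal K * indicator {\<tau>..\<tau> + d} s \<partial>lborel)"
      unfolding G_def using that
    proof (intro nn_integral_mono)
      fix s
      show "g s * indicator {s. ennreal s < ennreal (\<tau> + d)} s
          \<le> g s * indicator {s. ennreal s < ennreal \<tau>} s + ennreal K * indicator {\<tau>..\<tau> + d} s"
      proof (cases "0 < s")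
        case True
        then show ?thesis
          using that K[of s] by (auto simp: ennreal_less_iff split: split_indicator simp del: ennreal_plus)
      qed (simp add: g0)
    qed
    also have "\<dots> = G (ennreal \<tau>) + ennreal K * ennreal d"
      using that by (subst nn_integral_add) (auto simp: G_def nn_integral_cmult)
    finally show ?thesis .
  qed
  have G_SUP: "G T' = (SUP n::nat. G (ennreal (T n)))"
    if "incseq T" and lim: "\<And>s. 0 < s \<Longrightarrow> ennreal s < T' \<longleftrightarrow> (\<exists>n. ennreal s < ennreal (T n))" for T T'
  proof -
    have "G T' = (\<integral>\<^sup>+ s. (SUP n. g s * indicator {s. ennreal s < ennreal (T n)} s) \<partial>lborel)"
      unfolding G_def
    proof (intro nn_integral_cong)
      fix s :: real
      show "g s * indicator {s. ennreal s < T'} s = (SUP n. g s * indicator {s. ennreal s < ennreal (T n)} s)"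
      proof (cases "0 < s \<and> ennreal s < T'")
        case True
        then obtain n where "ennreal s < ennreal (T n)"
          using lim by blast
        then have "g s \<le> (SUP n. g s * indicator {s. ennreal s < ennreal (T n)} s)"
          by (intro SUP_upper2[of n]) auto
        moreover have "(SUP n. g s * indicator {s. ennreal s < ennreal (T n)} s) \<le> g s"
          by (intro SUP_least) (auto split: split_indicator)
        ultimately have "(SUP n. g s * indicator {s. ennreal s < ennreal (T n)} s) = g s"
          by (rule antisym[rotated])
        moreover have "g s * indicator {s. ennreal s < T'} s = g s"
          using True by simp
        ultimately show ?thesis by (simp only:)
      next
        case False
        have "g s * indicator {s. ennreal s < ennreal (T n)} s = 0" for n
          using False lim[of s] g0[of s] by (cases "0 < s") (auto split: split_indicator)
        moreover have "g s * indicator {s. ennreal s < T'} s = 0"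
          using False g0[of s] by (cases "0 < s") (auto split: split_indicator)
        ultimately show ?thesis by (simp only: SUP_const) simp
      qed
    qed
    also have "\<dots> = (SUP n. G (ennreal (T n)))"
      unfolding G_def
    proof (intro nn_integral_monotone_convergence_SUP)
      show "incseq (\<lambda>n s. g s * indicator {s. ennreal s < ennreal (T n)} s)"
        unfolding incseq_def le_fun_def
      proof (intro allI impI mult_left_mono)
        fix m n :: nat and s assume "m \<le> n"
        then have "ennreal (T m) \<le> ennreal (T n)"
          using \<open>incseq T\<close> by (intro ennreal_leI) (auto simp: incseq_def)
        then show "(indicator {s. ennreal s < ennreal (T m)} s :: ennreal) \<le> indicator {s. ennreal s < ennreal (T n)} s"
          by (auto simp: indicator_def)
      qed simp
    qed measurable
    finally show ?thesis .
  qed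
  have level: "(\<integral>\<^sup>+ t. g t * indicator {t. G (ennreal t) < ennreal a} t \<partial>lborel) = min (ennreal a) (G \<infinity>)" if a: "0 < a" for a
  proof (cases "\<forall>t. G (ennreal t) < ennreal a")
    case True
    have "G \<infinity> = (SUP n::nat. G (ennreal (real n)))"
    proof (rule G_SUP)
      fix s :: real assume "0 < s"
      obtain n :: nat where "\<bar>s\<bar> < real n" using reals_Archimedean2 by blast
      then have "ennreal s < ennreal (real n)"
        using \<open>0 < s\<close> by (intro ennreal_lessI) auto
      then show "ennreal s < \<infinity> \<longleftrightarrow> (\<exists>n::nat. ennreal s < ennreal (real n))"
        by auto
    qed (simp add: incseq_def)
    also have "\<dots> \<le> ennreal a"
      using True by (intro SUP_least less_imp_le) auto
    finally have "min (ennreal a) (G \<infinity>) = G \<infinity>"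
      by (simp add: min_def antisym)
    with True show ?thesis
      by (simp add: G_def)
  next
    case False
    define X where "X = {t. 0 \<le> t \<and> ennreal a \<le> G (ennreal t)}"
    have G0: "G 0 = 0"
      by (simp add: G_def)
    have "X \<noteq> {}"
    proof -
      obtain t where t: "ennreal a \<le> G (ennreal t)" using False by (auto simp: not_less)
      then have "0 \<le> t"
        using a G0 by (rule_tac ccontr) (auto simp: ennreal_neg)
      with t show ?thesis by (auto simp: X_def)
    qed
    have bdd: "bdd_below X" by (auto simp: X_def intro!: bdd_belowI[of _ 0])
    \<comment> \<open>The first time at which \<open>G\<close> reaches the level \<open>a\<close>.
      Continuity from the left bounds \<open>G\<close> there by \<open>a\<close> from above, and the
      growth estimate bounds it from below.\<close>
    define \<tau> where "\<tau> = Inf X"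
    have \<tau>0: "0 \<le> \<tau>"
      unfolding \<tau>_def using \<open>X \<noteq> {}\<close> by (intro cInf_greatest) (auto simp: X_def)
    have below: "G (ennreal t) < ennreal a" if "t < \<tau>" for t
    proof (cases "0 \<le> t")
      case True
      then show ?thesis
        using that cInf_lower[OF _ bdd, of t] unfolding \<tau>_def[symmetric] by (auto simp: X_def not_le[symmetric])
    next
      case False
      then show ?thesis using a G0 by (simp add: ennreal_neg)
    qed
    have above: "ennreal a \<le> G (ennreal t)" if tt: "\<tau> < t" for t
    proof -
      obtain t' where "t' \<in> X" "t' < t"
        using tt unfolding \<tau>_def cInf_less_iff[OF \<open>X \<noteq> {}\<close> bdd] by blast
      then show ?thesis
        using G_mono[of "ennreal t'" "ennreal t"] by (auto simp: X_def intro: order_trans ennreal_leI)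
    qed
    have "G (ennreal \<tau>) \<le> ennreal a"
    proof -
      have "G (ennreal \<tau>) = (SUP n::nat. G (ennreal (\<tau> - 1 / real (Suc n))))"
      proof (rule G_SUP)
        show "incseq (\<lambda>n. \<tau> - 1 / real (Suc n))"
          unfolding incseq_def by (auto intro!: divide_left_mono)
      next
        fix s :: real assume "0 < s"
        show "ennreal s < ennreal \<tau> \<longleftrightarrow> (\<exists>n. ennreal s < ennreal (\<tau> - 1 / real (Suc n)))"
        proof
          assume "ennreal s < ennreal \<tau>"
          then have "s < \<tau>"
            using \<open>0 < s\<close> by (simp add: ennreal_less_iff)
          then obtain n where "1 / real (Suc n) < \<tau> - s"
            using nat_approx_posE[of "\<tau> - s"] by auto
          then have "ennreal s < ennreal (\<tau> - 1 / real (Suc n))"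
            using \<open>0 < s\<close> by (intro ennreal_lessI) linarith+
          then show "\<exists>n. ennreal s < ennreal (\<tau> - 1 / real (Suc n))" ..
        next
          assume "\<exists>n. ennreal s < ennreal (\<tau> - 1 / real (Suc n))"
          then obtain n where "ennreal s < ennreal (\<tau> - 1 / real (Suc n))" ..
          also have "\<dots> \<le> ennreal \<tau>"
            by (intro ennreal_leI) simp
          finally show "ennreal s < ennreal \<tau>" .
        qed
      qed
      also have "\<dots> \<le> ennreal a"
        using below by (intro SUP_least less_imp_le) auto
      finally show ?thesis .
    qed
    moreover have "ennreal a \<le> G (ennreal \<tau>)"
    proof (rule ennreal_le_epsilon)
      fix e :: real assume "0 < e"
      \<comment> \<open>Adding 1 keeps the divisor positive and still yields
        \<open>K * d \<le> e\<close>, whatever the sign of \<open>K\<close>.\<close>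
      define d where "d = e / (\<bar>K\<bar> + 1)"
      have "0 < d" "K * d \<le> e"
        using \<open>0 < e\<close> by (auto simp: d_def divide_simps mult_mono)
      have "ennreal a \<le> G (ennreal (\<tau> + d))"
        using above[of "\<tau> + d"] \<open>0 < d\<close> by simp
      also have "\<dots> \<le> G (ennreal \<tau>) + ennreal K * ennreal d"
        using Grow \<tau>0 \<open>0 < d\<close> by simp
      also have "\<dots> \<le> G (ennreal \<tau>) + ennreal e"
        using \<open>K * d \<le> e\<close> \<open>0 < d\<close> by (intro add_left_mono) (auto simp: ennreal_mult''[symmetric] intro!: ennreal_leI)
      finally show "ennreal a \<le> G (ennreal \<tau>) + ennreal e" .
    qed
    ultimately have "G (ennreal \<tau>) = ennreal a"
      by (rule antisym)
    moreover have "(\<integral>\<^sup>+ t. g t * indicator {t. G (ennreal t) < ennreal a} t \<partial>lborel)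
        = (\<integral>\<^sup>+ t. g t * indicator {t. ennreal t < ennreal \<tau>} t \<partial>lborel)"
    proof (rule nn_integral_cong_AE)
      show "AE t in lborel. g t * indicator {t. G (ennreal t) < ennreal a} t = g t * indicator {t. ennreal t < ennreal \<tau>} t"
        using AE_lborel_singleton[of \<tau>]
      proof eventually_elim
        case (elim t)
        then consider "t < \<tau>" | "\<tau> < t" by linarith
        then show ?case
        proof cases
          case 1
          then show ?thesis
            using below[of t] g0[of t] by (cases "0 < t") (auto split: split_indicator simp: ennreal_less_iff)
        next
          case 2
          then have "\<not> ennreal t < ennreal \<tau>"
            using \<tau>0 by (simp add: ennreal_less_iff)
          with above[OF 2] show ?thesis
            by (auto split: split_indicator)
        qed
      qed
    qed
    moreover have "(\<integral>\<^sup>+ t. g t * indicator {t. ennreal t < ennreal \<tau>} t \<partial>lborel) = G (ennreal \<tau>)"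
      by (simp add: G_def)
    moreover have "ennreal a \<le> G \<infinity>"
      using \<open>G (ennreal \<tau>) = ennreal a\<close> G_mono[of "ennreal \<tau>" \<infinity>] by simp
    ultimately show ?thesis
      by (simp add: min_def)
  qed
  have [measurable]: "(\<lambda>x. x) \<in> exp_pos \<rightarrow>\<^sub>M borel"
    using measurable_pos_ident(1) by (simp cong: measurable_cong_sets)
  then have [measurable]: "snd \<in> lborel \<Otimes>\<^sub>M exp_pos \<rightarrow>\<^sub>M (borel :: real measure)"
    "fst \<in> exp_pos \<Otimes>\<^sub>M lborel \<rightarrow>\<^sub>M (borel :: real measure)"
    by (rule measurable_compose[OF measurable_snd] measurable_compose[OF measurable_fst])+
  have "(\<integral>\<^sup>+ t. exp_minus (G (ennreal t)) * g t \<partial>lborel)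
      = (\<integral>\<^sup>+ t. \<integral>\<^sup>+ a. g t * indicator {p. G (ennreal (fst p)) < ennreal (snd p)} (t, a) \<partial>exp_pos \<partial>lborel)"
  proof (rule nn_integral_cong)
    fix t
    have "(\<integral>\<^sup>+ a. g t * indicator {p. G (ennreal (fst p)) < ennreal (snd p)} (t, a) \<partial>exp_pos)
        = (\<integral>\<^sup>+ a. g t * indicator {a \<in> space exp_pos. G (ennreal t) < ennreal a} a \<partial>exp_pos)"
      by (intro nn_integral_cong) (auto split: split_indicator)
    also have "\<dots> = g t * emeasure exp_pos {a \<in> space exp_pos. G (ennreal t) < ennreal a}"
      by (intro nn_integral_cmult_indicator) measurable
    finally show "exp_minus (G (ennreal t)) * g t
        = (\<integral>\<^sup>+ a. g t * indicator {p. G (ennreal (fst p)) < ennreal (snd p)} (t, a) \<partial>exp_pos)"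
      by (simp add: emeasure_exp_pos_Ioi mult.commute del: space_exp_pos)
  qed
  also have "\<dots> = (\<integral>\<^sup>+ a. \<integral>\<^sup>+ t. g t * indicator {p. G (ennreal (fst p)) < ennreal (snd p)} (t, a) \<partial>lborel \<partial>exp_pos)"
    by (rule P.Fubini'[symmetric]) measurable
  also have "\<dots> = (\<integral>\<^sup>+ a. min (ennreal a) (G \<infinity>) \<partial>exp_pos)"
  proof (rule nn_integral_cong)
    fix a assume "a \<in> space exp_pos"
    then have "0 < a" by simp
    from level[OF this] show "(\<integral>\<^sup>+ t. g t * indicator {p. G (ennreal (fst p)) < ennreal (snd p)} (t, a) \<partial>lborel) = min (ennreal a) (G \<infinity>)"
      by (simp add: indicator_def)
  qed
  \<comment> \<open>The minimum is the length of the interval of all \<open>b\<close> below both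
    bounds; a second exchange of integrals then leaves the exponential tail in
    \<open>b\<close>.\<close>
  also have "\<dots> = (\<integral>\<^sup>+ a. \<integral>\<^sup>+ b. indicator {p. 0 < fst p \<and> fst p < snd p \<and> ennreal (fst p) < G \<infinity>} (b, a) \<partial>lborel \<partial>exp_pos)"
  proof (rule nn_integral_cong)
    fix a assume "a \<in> space exp_pos"
    then have a: "0 < a" by simp
    show "min (ennreal a) (G \<infinity>) = (\<integral>\<^sup>+ b. indicator {p. 0 < fst p \<and> fst p < snd p \<and> ennreal (fst p) < G \<infinity>} (b, a) \<partial>lborel)"
    proof (cases "G \<infinity>")
      case (real L)
      have "(\<integral>\<^sup>+ b. indicator {p. 0 < fst p \<and> fst p < snd p \<and> ennreal (fst p) < G \<infinity>} (b, a) \<partial>lborel)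
          = (\<integral>\<^sup>+ b. indicator {0<..<min a L} b \<partial>lborel)"
        using real by (intro nn_integral_cong) (auto simp: ennreal_less_iff split: split_indicator)
      with real a show ?thesis by (simp add: min_def)
    next
      case top
      have "(\<integral>\<^sup>+ b. indicator {p. 0 < fst p \<and> fst p < snd p \<and> ennreal (fst p) < G \<infinity>} (b, a) \<partial>lborel)
          = (\<integral>\<^sup>+ b. indicator {0<..<a} b \<partial>lborel)"
        using top by (intro nn_integral_cong) (auto split: split_indicator)
      with top a show ?thesis by simp
    qed
  qed
  also have "\<dots> = (\<integral>\<^sup>+ b. \<integral>\<^sup>+ a. indicator {p. 0 < fst p \<and> fst p < snd p \<and> ennreal (fst p) < G \<infinity>} (b, a) \<partial>exp_pos \<partial>lborel)"
    by (rule P.Fubini') measurable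
  also have "\<dots> = (\<integral>\<^sup>+ b. ennreal (exp (- b)) * indicator {b. 0 < b \<and> ennreal b < G \<infinity>} b \<partial>lborel)"
  proof (rule nn_integral_cong)
    fix b :: real
    show "(\<integral>\<^sup>+ a. indicator {p. 0 < fst p \<and> fst p < snd p \<and> ennreal (fst p) < G \<infinity>} (b, a) \<partial>exp_pos)
        = ennreal (exp (- b)) * indicator {b. 0 < b \<and> ennreal b < G \<infinity>} b"
    proof (cases "0 < b \<and> ennreal b < G \<infinity>")
      case True
      then have "(\<integral>\<^sup>+ a. indicator {p. 0 < fst p \<and> fst p < snd p \<and> ennreal (fst p) < G \<infinity>} (b, a) \<partial>exp_pos)
          = (\<integral>\<^sup>+ a. indicator {a \<in> space exp_pos. ennreal b < ennreal a} a \<partial>exp_pos)"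
        by (intro nn_integral_cong) (auto split: split_indicator simp: ennreal_less_iff)
      also have "\<dots> = exp_minus (ennreal b)"
        by (subst nn_integral_indicator) (measurable, rule emeasure_exp_pos_Ioi)
      finally show ?thesis
        using True by simp
    next
      case False
      then show ?thesis by (auto simp: indicator_def)
    qed
  qed
  also have "\<dots> = emeasure exp_pos {b \<in> space exp_pos. ennreal b < G \<infinity>}"
  proof -
    have m: "{b \<in> space exp_pos. ennreal b < G \<infinity>} \<in> sets exp_pos"
      by measurable
    have "emeasure exp_pos {b \<in> space exp_pos. ennreal b < G \<infinity>} = (\<integral>\<^sup>+ b. indicator {b \<in> space exp_pos. ennreal b < G \<infinity>} b \<partial>exp_pos)"
      using m by (rule nn_integral_indicator[symmetric])
    also have "\<dots> = (\<integral>\<^sup>+ b. ennreal (exp (- b)) * indicator {b. 0 < b \<and> ennreal b < G \<infinity>} b \<partial>lborel)"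
      using m by (subst nn_integral_exp_pos) (auto intro!: nn_integral_cong split: split_indicator)
    finally show ?thesis by simp
  qed
  \<comment> \<open>The two sets differ in at most one point, and the closed version is the
    complement of the tail beyond \<open>G \<infinity>\<close>.\<close>
  also have "\<dots> = emeasure exp_pos {b \<in> space exp_pos. ennreal b \<le> G \<infinity>}"
  proof (rule emeasure_eq_AE)
    show "AE b in exp_pos. (b \<in> {b \<in> space exp_pos. ennreal b < G \<infinity>}) = (b \<in> {b \<in> space exp_pos. ennreal b \<le> G \<infinity>})"
      unfolding AE_exp_pos using AE_lborel_singleton[of "enn2real (G \<infinity>)"]
      by eventually_elim (cases "G \<infinity>", auto simp: ennreal_less_iff)
  qed measurable
  finally have "(\<integral>\<^sup>+ t. exp_minus (G (ennreal t)) * g t \<partial>lborel) + exp_minus (G \<infinity>)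
     = emeasure exp_pos {b \<in> space exp_pos. ennreal b \<le> G \<infinity>} + emeasure exp_pos {b \<in> space exp_pos. G \<infinity> < ennreal b}"
    by (simp add: emeasure_exp_pos_Ioi del: space_exp_pos)
  also have "\<dots> = emeasure exp_pos ({b \<in> space exp_pos. ennreal b \<le> G \<infinity>} \<union> {b \<in> space exp_pos. G \<infinity> < ennreal b})"
    by (rule plus_emeasure) (measurable, auto)
  also have "{b \<in> space exp_pos. ennreal b \<le> G \<infinity>} \<union> {b \<in> space exp_pos. G \<infinity> < ennreal b} = space exp_pos"
    by auto
  finally show ?thesis
    using E.emeasure_space_1 by simp
qed

section \<open>The jump law\<close>

locale ctmdp =
  fixes S :: "'s::polish_space set" and A :: "'a::polish_space set"
    and qt :: "'s \<Rightarrow> 'a \<Rightarrow> 's measure"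
    and qx :: "'s \<Rightarrow> 'a \<Rightarrow> real"
    and c :: "'s \<Rightarrow> 'a \<Rightarrow> real"
  assumes S_borel: "S \<in> sets borel" and S_ne: "S \<noteq> {}"
    and A_borel: "A \<in> sets borel" and A_ne: "A \<noteq> {}"
    and qt_sets: "\<And>x a. x \<in> S \<Longrightarrow> a \<in> A \<Longrightarrow> sets (qt x a) = sets (BM S)"
    and qt_finite: "\<And>x a. x \<in> S \<Longrightarrow> a \<in> A \<Longrightarrow> emeasure (qt x a) S < \<infinity>"
    and qt_meas: "\<And>\<Gamma>. \<Gamma> \<in> sets (BM S) \<Longrightarrow>
         (\<lambda>(x, a). emeasure (qt x a) \<Gamma>) \<in> borel_measurable (BM S \<Otimes>\<^sub>M BM A)"
    and conservative: "\<And>x a. x \<in> S \<Longrightarrow> a \<in> A \<Longrightarrow> qx x a = measure (qt x a) S"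
    and stable: "\<And>x. x \<in> S \<Longrightarrow> \<exists>K. \<forall>a \<in> A. qx x a \<le> K"
    and c_meas: "(\<lambda>(x, a). c x a) \<in> borel_measurable (BM S \<Otimes>\<^sub>M BM A)"
begin

abbreviation PA :: "'a measure measure" where "PA \<equiv> prob_algebra (BM A)"
abbreviation pos :: "real measure" where "pos \<equiv> restrict_space borel {0<..}"

lemma space_S [simp]: "space (BM S) = S" and space_A [simp]: "space (BM A) = A"
  by (simp_all add: space_restrict_space)

lemma PA_D:
  assumes "\<mu> \<in> space PA"
  shows "prob_space \<mu>" "sets \<mu> = sets (BM A)" "space \<mu> = A"
  using assms sets_eq_imp_space_eq[of \<mu> "BM A"] by (auto simp: space_prob_algebra)

lemma space_qt: "x \<in> S \<Longrightarrow> a \<in> A \<Longrightarrow> space (qt x a) = S"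
  using sets_eq_imp_space_eq[OF qt_sets] by simp

lemma emeasure_qt: "x \<in> S \<Longrightarrow> a \<in> A \<Longrightarrow> emeasure (qt x a) S = ennreal (qx x a)"
  using qt_finite[of x a] by (simp add: conservative emeasure_eq_ennreal_measure)

lemma qx_nonneg: "x \<in> S \<Longrightarrow> a \<in> A \<Longrightarrow> 0 \<le> qx x a"
  by (simp add: conservative)

lemma measurable_on_SA:
  assumes r: "(\<lambda>(x, a). r x a) \<in> BM S \<Otimes>\<^sub>M BM A \<rightarrow>\<^sub>M N" and "f \<in> Y \<rightarrow>\<^sub>M BM S" "g \<in> Y \<rightarrow>\<^sub>M BM A"
  shows "(\<lambda>y. r (f y) (g y)) \<in> Y \<rightarrow>\<^sub>M N"
  using measurable_compose[OF measurable_Pair[OF assms(2,3)] r] by simp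

lemma qx_meas: "(\<lambda>(x, a). qx x a) \<in> borel_measurable (BM S \<Otimes>\<^sub>M BM A)"
proof -
  have "S \<in> sets (BM S)"
    using sets.top[of "BM S"] by simp
  note [measurable] = qt_meas[OF this]
  have "(\<lambda>p. enn2real (case p of (x, a) \<Rightarrow> emeasure (qt x a) S)) \<in> borel_measurable (BM S \<Otimes>\<^sub>M BM A)"
    by measurable
  then show ?thesis
    by (rule measurable_cong[THEN iffD1, rotated]) (auto simp: space_pair_measure emeasure_qt qx_nonneg)
qed

lemmas measurable_qx [measurable (raw)] = measurable_on_SA[OF qx_meas]

section \<open>Averaged rates and integrals against the jump kernel\<close>

definition mean :: "('s \<Rightarrow> 'a \<Rightarrow> real) \<Rightarrow> 's \<Rightarrow> 'a measure \<Rightarrow> ennreal" where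
  "mean r x \<mu> = (\<integral>\<^sup>+ a. ennreal (r x a) \<partial>\<mu>)"

lemma measurable_mean:
  assumes r: "(\<lambda>(x, a). r x a) \<in> borel_measurable (BM S \<Otimes>\<^sub>M BM A)"
    and [measurable]: "f \<in> Y \<rightarrow>\<^sub>M BM S" and m: "m \<in> Y \<rightarrow>\<^sub>M PA"
  shows "(\<lambda>y. mean r (f y) (m y)) \<in> borel_measurable Y"
  unfolding mean_def
proof (rule nn_integral_measurable_subprob_algebra2)
  note [measurable (raw)] = measurable_on_SA[OF r]
  show "(\<lambda>(y, a). ennreal (r (f y) a)) \<in> borel_measurable (Y \<Otimes>\<^sub>M BM A)"
    by measurable
qed (rule measurable_prob_algebraD[OF m])

text \<open>The common shape of \<open>Iq\<close> and \<open>Ic\<close>, so that measurability in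
  the control is proved once.\<close>

definition Irate :: "('s \<Rightarrow> 'a \<Rightarrow> real) \<Rightarrow> 's \<Rightarrow> (real \<Rightarrow> 'a measure) \<Rightarrow> ennreal \<Rightarrow> ennreal" where
  "Irate r x \<rho> T = (\<integral>\<^sup>+ s \<in> {s. 0 < s \<and> ennreal s < T}. mean r x (\<rho> s) \<partial>lborel)"

lemma Iq_eq: "Iq r x \<rho> T = Irate r x \<rho> T" and Ic_eq: "Ic r x \<rho> T = Irate r x \<rho> T"
  by (simp_all add: Iq_def Ic_def Irate_def mean_def)

lemma measurable_Irate:
  assumes r: "(\<lambda>(x, a). r x a) \<in> borel_measurable (BM S \<Otimes>\<^sub>M BM A)"
    and f: "f \<in> Y \<rightarrow>\<^sub>M BM S" and \<rho>: "\<rho> \<in> Y \<rightarrow>\<^sub>M RM A" and T: "T \<in> borel_measurable Y"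
  shows "(\<lambda>y. Irate r (f y) (\<rho> y) (T y)) \<in> borel_measurable Y"
proof -
  let ?N = "Y \<Otimes>\<^sub>M (pos \<Otimes>\<^sub>M PA)"
  have *: "(\<lambda>p. fst (snd p)) \<in> ?N \<rightarrow>\<^sub>M (borel :: real measure)"
    by (rule measurable_compose[OF _ measurable_pos_ident(1)]) measurable
  have [measurable]: "(\<lambda>p. ennreal (fst (snd p))) \<in> borel_measurable ?N"
    by (rule measurable_compose[OF *]) measurable
  have [measurable]: "(\<lambda>p. T (fst p)) \<in> borel_measurable ?N"
    by (rule measurable_compose[OF measurable_fst T])
  have [measurable]: "(\<lambda>p. mean r (f (fst p)) (snd (snd p))) \<in> borel_measurable ?N"
    by (rule measurable_mean[OF r]) (auto intro: measurable_compose[OF measurable_fst f])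
  \<comment> \<open>The varying time limit \<open>T\<close> enters as an indicator in the integrand,
    since \<open>measurable_RM_integral\<close> integrates over all positive times.\<close>
  have "(\<lambda>p. mean r (f (fst p)) (snd (snd p)) * indicator {p \<in> space ?N. ennreal (fst (snd p)) < T (fst p)} p) \<in> borel_measurable ?N"
    by measurable
  from measurable_RM_integral[OF this \<rho>]
  have "(\<lambda>y. \<integral>\<^sup>+ t \<in> {0<..}. mean r (f y) (\<rho> y t) * indicator {p \<in> space ?N. ennreal (fst (snd p)) < T (fst p)} (y, t, \<rho> y t) \<partial>lborel) \<in> borel_measurable Y"
    by simp
  moreover have "(\<integral>\<^sup>+ t \<in> {0<..}. mean r (f y) (\<rho> y t) * indicator {p \<in> space ?N. ennreal (fst (snd p)) < T (fst p)} (y, t, \<rho> y t) \<partial>lborel)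
     = Irate r (f y) (\<rho> y) (T y)" if y: "y \<in> space Y" for y
  proof -
    have "\<rho> y t \<in> space PA" if "0 < t" for t
      using measurable_space[OF RsetD, of "\<rho> y" A t] measurable_space[OF \<rho> y] that by (simp add: space_pos)
    then show ?thesis
      unfolding Irate_def using y
      by (intro nn_integral_cong) (auto simp: space_pair_measure space_pos split: split_indicator)
  qed
  ultimately show ?thesis
    by (subst measurable_cong[symmetric]) auto
qed

lemmas measurable_Iq = measurable_Irate[OF qx_meas, folded Iq_eq]
lemmas measurable_Ic = measurable_Irate[OF c_meas, folded Ic_eq]

lemma mean_qx_bound:
  assumes "x \<in> S"
  obtains K where "0 \<le> K" "\<And>\<mu>. \<mu> \<in> space PA \<Longrightarrow> mean qx x \<mu> \<le> ennreal K"
proof -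
  obtain K where K: "\<And>a. a \<in> A \<Longrightarrow> qx x a \<le> K"
    using stable[OF assms] by blast
  have "mean qx x \<mu> \<le> ennreal (max K 0)" if \<mu>: "\<mu> \<in> space PA" for \<mu>
  proof -
    interpret prob_space \<mu> using PA_D[OF \<mu>] by simp
    have "mean qx x \<mu> \<le> (\<integral>\<^sup>+ a. ennreal (max K 0) \<partial>\<mu>)"
      unfolding mean_def using K PA_D[OF \<mu>] by (intro nn_integral_mono ennreal_leI) (auto simp: le_max_iff_disj)
    then show ?thesis by (simp add: emeasure_space_1)
  qed
  then show thesis by (intro that[of "max K 0"]) auto
qed

lemma Rset_space: "\<rho> \<in> Rset A \<Longrightarrow> 0 < t \<Longrightarrow> \<rho> t \<in> space PA"
  using measurable_space[OF RsetD, of \<rho> A t] by (simp add: space_pos)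

lemma Iq_finite:
  assumes x: "x \<in> S" and \<rho>: "\<rho> \<in> Rset A"
  shows "Iq qx x \<rho> (ennreal t) < \<infinity>"
proof -
  obtain K where K: "0 \<le> K" "\<And>\<mu>. \<mu> \<in> space PA \<Longrightarrow> mean qx x \<mu> \<le> ennreal K"
    using mean_qx_bound[OF x] by blast
  have "Iq qx x \<rho> (ennreal t) \<le> (\<integral>\<^sup>+ s. ennreal K * indicator {0..\<bar>t\<bar>} s \<partial>lborel)"
    unfolding Iq_eq Irate_def using K(2) Rset_space[OF \<rho>]
    by (intro nn_integral_mono) (auto simp: ennreal_less_iff split: split_indicator)
  also have "\<dots> < \<infinity>"
    by (subst nn_integral_cmult_indicator) (auto simp: ennreal_mult_less_top)
  finally show ?thesis .
qed

text \<open>The measures \<open>qt x a\<close> are finite without a common bound on their mass.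
  Dividing by \<open>1 + qx x a\<close> gives a subprobability kernel, to which the measurability of
  kernel integrals applies, and the factor is restored afterwards.\<close>

lemma measurable_qt_integral:
  assumes f [measurable]: "(\<lambda>(y, s). f y s) \<in> borel_measurable (Y \<Otimes>\<^sub>M BM S)"
    and x [measurable]: "x \<in> Y \<rightarrow>\<^sub>M BM S" and a [measurable]: "a \<in> Y \<rightarrow>\<^sub>M BM A"
  shows "(\<lambda>y. \<integral>\<^sup>+ s. f y s \<partial>qt (x y) (a y)) \<in> borel_measurable Y"
proof -
  define N where "N y = scale_measure (ennreal (1 / (1 + qx (x y) (a y)))) (qt (x y) (a y))" for y
  have xa: "x y \<in> S" "a y \<in> A" if "y \<in> space Y" for y
    using measurable_space[OF x that] measurable_space[OF a that] by simp_all
  have "N \<in> Y \<rightarrow>\<^sub>M subprob_algebra (BM S)"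
  proof (rule measurable_subprob_algebra)
    fix y assume y: "y \<in> space Y"
    show "sets (N y) = sets (BM S)"
      using qt_sets xa[OF y] by (simp add: N_def)
    show "subprob_space (N y)"
    proof
      have "emeasure (N y) (space (N y)) = ennreal (1 / (1 + qx (x y) (a y)) * qx (x y) (a y))"
        using xa[OF y] by (simp add: N_def space_scale_measure space_qt emeasure_qt qx_nonneg ennreal_mult''[symmetric])
      also have "\<dots> \<le> 1"
        using qx_nonneg[OF xa[OF y]] by (simp add: divide_simps)
      finally show "emeasure (N y) (space (N y)) \<le> 1" .
      show "space (N y) \<noteq> {}"
        using xa[OF y] S_ne by (simp add: N_def space_scale_measure space_qt)
    qed
  next
    fix \<Gamma> assume "\<Gamma> \<in> sets (BM S)"
    from measurable_on_SA[OF qt_meas[OF this] x a]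
    show "(\<lambda>y. emeasure (N y) \<Gamma>) \<in> borel_measurable Y"
      unfolding N_def by simp
  qed
  then have "(\<lambda>y. \<integral>\<^sup>+ s. f y s \<partial>N y) \<in> borel_measurable Y"
    by (rule nn_integral_measurable_subprob_algebra2[OF f])
  then have "(\<lambda>y. ennreal (1 + qx (x y) (a y)) * (\<integral>\<^sup>+ s. f y s \<partial>N y)) \<in> borel_measurable Y"
    by measurable
  moreover have "ennreal (1 + qx (x y) (a y)) * (\<integral>\<^sup>+ s. f y s \<partial>N y) = (\<integral>\<^sup>+ s. f y s \<partial>qt (x y) (a y))"
    if y: "y \<in> space Y" for y
  proof -
    have "(\<lambda>s. f y s) \<in> borel_measurable (qt (x y) (a y))"
      using measurable_Pair2[OF f y] unfolding measurable_cong_sets[OF qt_sets[OF xa[OF y]] refl] by simp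
    then have "(\<integral>\<^sup>+ s. f y s \<partial>N y) = ennreal (1 / (1 + qx (x y) (a y))) * (\<integral>\<^sup>+ s. f y s \<partial>qt (x y) (a y))"
      unfolding N_def by (rule nn_integral_scale_measure)
    moreover have "ennreal (1 + qx (x y) (a y)) * ennreal (1 / (1 + qx (x y) (a y))) = 1"
      using qx_nonneg[OF xa[OF y]] by (simp add: ennreal_mult[symmetric] del: ennreal_plus)
    ultimately show ?thesis
      by (simp add: mult.assoc[symmetric] del: ennreal_plus)
  qed
  ultimately show ?thesis
    by (subst measurable_cong[symmetric]) auto
qed

lemma measurable_qt_integral_at:
  assumes x: "x \<in> S" and f: "f \<in> borel_measurable (BM S)"
  shows "(\<lambda>a. \<integral>\<^sup>+ s. f s \<partial>qt x a) \<in> borel_measurable (BM A)"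
  using x f by (intro measurable_qt_integral) (auto intro: measurable_compose[OF measurable_snd])

lemma borel_measurable_qt: "x \<in> S \<Longrightarrow> a \<in> A \<Longrightarrow> borel_measurable (qt x a) = borel_measurable (BM S)"
  by (rule measurable_cong_sets[OF qt_sets refl])

lemma borel_measurable_PA: "\<mu> \<in> space PA \<Longrightarrow> borel_measurable \<mu> = borel_measurable (BM A)"
  by (rule measurable_cong_sets[OF PA_D(2) refl])

lemma sets_qmix [simp]: "sets (qmix S qt x \<mu>) = sets (BM S)"
  unfolding qmix_def using sets.space_closed[of "BM S"] sets.sigma_sets_eq[of "BM S"] by (simp add: space_S)

lemma space_qmix [simp]: "space (qmix S qt x \<mu>) = S"
  using sets_eq_imp_space_eq[OF sets_qmix] by simp

lemma nn_integral_qmix: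
  assumes x: "x \<in> S" and \<mu>: "\<mu> \<in> space PA" and f: "f \<in> borel_measurable (BM S)"
  shows "(\<integral>\<^sup>+ s. f s \<partial>qmix S qt x \<mu>) = (\<integral>\<^sup>+ a. \<integral>\<^sup>+ s. f s \<partial>qt x a \<partial>\<mu>)"
proof -
  define \<Lambda> where "\<Lambda> f = (\<integral>\<^sup>+ a. \<integral>\<^sup>+ s. f s \<partial>qt x a \<partial>\<mu>)" for f :: "'s \<Rightarrow> ennreal"
  have m: "(\<lambda>a. \<integral>\<^sup>+ s. f s \<partial>qt x a) \<in> borel_measurable \<mu>" if "f \<in> borel_measurable (BM S)" for f
    using measurable_qt_integral_at[OF x that] by (simp add: borel_measurable_PA[OF \<mu>])
  have "(\<integral>\<^sup>+ s. f s \<partial>measure_of (space (BM S)) (sets (BM S)) (\<lambda>\<Gamma>. \<integral>\<^sup>+ a. emeasure (qt x a) \<Gamma> \<partial>\<mu>)) = \<Lambda> f"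
  proof (rule measure_of_functional)
    fix f g :: "'s \<Rightarrow> ennreal" assume fg: "f \<in> borel_measurable (BM S)" "g \<in> borel_measurable (BM S)"
    have "\<Lambda> (\<lambda>x. f x + g x) = (\<integral>\<^sup>+ a. (\<integral>\<^sup>+ s. f s \<partial>qt x a) + (\<integral>\<^sup>+ s. g s \<partial>qt x a) \<partial>\<mu>)"
      unfolding \<Lambda>_def using fg by (intro nn_integral_cong nn_integral_add) (auto simp: PA_D[OF \<mu>] borel_measurable_qt x)
    then show "\<Lambda> (\<lambda>x. f x + g x) = \<Lambda> f + \<Lambda> g"
      unfolding \<Lambda>_def using m fg by (simp add: nn_integral_add)
  next
    fix f :: "'s \<Rightarrow> ennreal" and c assume f: "f \<in> borel_measurable (BM S)"
    have "\<Lambda> (\<lambda>x. c * f x) = (\<integral>\<^sup>+ a. c * (\<integral>\<^sup>+ s. f s \<partial>qt x a) \<partial>\<mu>)"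
      unfolding \<Lambda>_def using f by (intro nn_integral_cong nn_integral_cmult) (auto simp: PA_D[OF \<mu>] borel_measurable_qt x)
    then show "\<Lambda> (\<lambda>x. c * f x) = c * \<Lambda> f"
      unfolding \<Lambda>_def using m f by (simp add: nn_integral_cmult)
  next
    fix F :: "nat \<Rightarrow> 's \<Rightarrow> ennreal" assume F: "\<And>i. F i \<in> borel_measurable (BM S)" "incseq F"
    have "\<Lambda> (\<lambda>x. SUP i. F i x) = (\<integral>\<^sup>+ a. (SUP i. \<integral>\<^sup>+ s. F i s \<partial>qt x a) \<partial>\<mu>)"
      unfolding \<Lambda>_def using F
      by (intro nn_integral_cong nn_integral_monotone_convergence_SUP) (auto simp: PA_D[OF \<mu>] borel_measurable_qt x)
    also have "\<dots> = (SUP i. \<Lambda> (F i))"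
      unfolding \<Lambda>_def using F m
      by (intro nn_integral_monotone_convergence_SUP) (auto simp: incseq_def le_fun_def intro!: nn_integral_mono)
    finally show "\<Lambda> (\<lambda>x. SUP i. F i x) = (SUP i. \<Lambda> (F i))" .
  next
    fix f g :: "'s \<Rightarrow> ennreal" assume "\<And>s. s \<in> space (BM S) \<Longrightarrow> f s = g s"
    then show "\<Lambda> f = \<Lambda> g"
      unfolding \<Lambda>_def by (intro nn_integral_cong) (auto simp: PA_D[OF \<mu>] space_qt x)
  next
    fix E assume "E \<in> sets (BM S)"
    then show "(\<integral>\<^sup>+ a. emeasure (qt x a) E \<partial>\<mu>) = \<Lambda> (indicator E)"
      unfolding \<Lambda>_def by (intro nn_integral_cong) (auto simp: PA_D[OF \<mu>] qt_sets x)
  qed (rule f)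
  then show ?thesis
    by (simp add: qmix_def \<Lambda>_def)
qed

lemma measurable_qmix_integral:
  assumes f [measurable]: "(\<lambda>(y, s). f y s) \<in> borel_measurable (Y \<Otimes>\<^sub>M BM S)"
    and x [measurable]: "x \<in> Y \<rightarrow>\<^sub>M BM S" and m: "m \<in> Y \<rightarrow>\<^sub>M PA"
  shows "(\<lambda>y. \<integral>\<^sup>+ s. f y s \<partial>qmix S qt (x y) (m y)) \<in> borel_measurable Y"
proof -
  have "(\<lambda>(y, a). \<integral>\<^sup>+ s. f y s \<partial>qt (x y) a) \<in> borel_measurable (Y \<Otimes>\<^sub>M BM A)"
    unfolding case_prod_unfold by (rule measurable_qt_integral) measurable
  then have "(\<lambda>y. \<integral>\<^sup>+ a. \<integral>\<^sup>+ s. f y s \<partial>qt (x y) a \<partial>m y) \<in> borel_measurable Y"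
    by (rule nn_integral_measurable_subprob_algebra2) (rule measurable_prob_algebraD[OF m])
  moreover have "(\<integral>\<^sup>+ a. \<integral>\<^sup>+ s. f y s \<partial>qt (x y) a \<partial>m y) = (\<integral>\<^sup>+ s. f y s \<partial>qmix S qt (x y) (m y))"
    if y: "y \<in> space Y" for y
    using measurable_space[OF x y] measurable_space[OF m y] measurable_Pair2[OF f y]
    by (intro nn_integral_qmix[symmetric]) simp_all
  ultimately show ?thesis
    by (subst measurable_cong[symmetric]) auto
qed

lemma emeasure_qmix_space:
  assumes x: "x \<in> S" and \<mu>: "\<mu> \<in> space PA"
  shows "emeasure (qmix S qt x \<mu>) S = mean qx x \<mu>"
proof -
  have "emeasure (qmix S qt x \<mu>) S = (\<integral>\<^sup>+ s. 1 \<partial>qmix S qt x \<mu>)"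
    by simp
  also have "\<dots> = (\<integral>\<^sup>+ a. \<integral>\<^sup>+ s. 1 \<partial>qt x a \<partial>\<mu>)"
    using x \<mu> by (intro nn_integral_qmix) auto
  also have "\<dots> = mean qx x \<mu>"
    unfolding mean_def using x by (intro nn_integral_cong) (simp add: PA_D[OF \<mu>] space_qt emeasure_qt)
  finally show ?thesis .
qed

section \<open>The cemetery and the space of jumps\<close>

lemma sets_S_subset: "B \<in> sets (BM S) \<Longrightarrow> B \<subseteq> S"
  using sets.sets_into_space[of B "BM S"] by simp

lemma optM_gen_subset:
  "{Some ` B | B. B \<in> sets (BM S)} \<union> {{None}} \<subseteq> Pow (insert None (Some ` S))"
  using sets_S_subset by blast

lemma space_optM [simp]: "space (optM S) = insert None (Some ` S)"
  unfolding optM_def by (rule space_measure_of[OF optM_gen_subset])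

lemma sets_optM_gen: "B \<in> sets (BM S) \<Longrightarrow> Some ` B \<in> sets (optM S)" "{None} \<in> sets (optM S)"
  unfolding optM_def sets_measure_of[OF optM_gen_subset]
  by (auto intro: sigma_sets.Basic)

lemma measurable_Some [measurable]: "Some \<in> BM S \<rightarrow>\<^sub>M optM S"
  unfolding optM_def
proof (rule measurable_measure_of)
  fix E assume "E \<in> {Some ` B | B. B \<in> sets (BM S)} \<union> {{None}}"
  then consider B where "E = Some ` B" "B \<in> sets (BM S)" | "E = {None}" by blast
  then show "Some -` E \<inter> space (BM S) \<in> sets (BM S)"
  proof cases
    case 1
    then have "Some -` E \<inter> space (BM S) = B"
      using sets_S_subset by auto
    with 1 show ?thesis by simp
  next
    case 2
    then have "Some -` E \<inter> space (BM S) = {}" by auto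
    then show ?thesis by (simp only: sets.empty_sets)
  qed
qed (use optM_gen_subset in auto)

text \<open>An arbitrary state stands in for the cemetery, so that a function of a state can be
  applied to a coordinate before it is known to carry one.\<close>

definition default :: "'s option \<Rightarrow> 's" where
  "default o' = (case o' of None \<Rightarrow> (SOME x. x \<in> S) | Some x \<Rightarrow> x)"

lemma default_Some [simp]: "default (Some x) = x"
  by (simp add: default_def)

lemma default_None: "default None \<in> S"
  using S_ne by (simp add: default_def some_in_eq)

lemma measurable_default [measurable]: "default \<in> optM S \<rightarrow>\<^sub>M BM S"
proof (rule measurableI)
  fix B assume B: "B \<in> sets (BM S)"
  then have "default -` B \<inter> space (optM S) = Some ` B \<union> (if default None \<in> B then {None} else {})"
    using sets_S_subset by auto
  note eq = this
  show "default -` B \<inter> space (optM S) \<in> sets (optM S)"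
    unfolding eq by (rule sets.Un) (use B sets_optM_gen in auto)
qed (auto simp: default_None)

lemma pred_None [measurable]: "Measurable.pred (optM S) (\<lambda>o'. o' = None)"
proof -
  have "{o' \<in> space (optM S). o' = None} = {None}" by auto
  then show ?thesis
    using sets_optM_gen(2) by (simp add: pred_def)
qed

lemma measurable_case_option:
  assumes [measurable]: "o' \<in> Y \<rightarrow>\<^sub>M optM S" and "f \<in> borel_measurable Y"
    "(\<lambda>y. g y (default (o' y))) \<in> borel_measurable Y"
  shows "(\<lambda>y. case o' y of None \<Rightarrow> f y :: ennreal | Some x \<Rightarrow> g y x) \<in> borel_measurable Y"
proof -
  have "(\<lambda>y. if o' y = None then f y else g y (default (o' y))) \<in> borel_measurable Y"
    using assms by measurable
  also have "(\<lambda>y. if o' y = None then f y else g y (default (o' y))) = (\<lambda>y. case o' y of None \<Rightarrow> f y | Some x \<Rightarrow> g y x)"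
    by (auto split: option.split)
  finally show ?thesis .
qed

lemma space_XM [simp]: "space (XM S) = Xset S"
  unfolding XM_def by (auto simp: space_restrict_space space_pair_measure Xset_def)

lemma measurable_XM_iff: "f \<in> Y \<rightarrow>\<^sub>M XM S \<longleftrightarrow> f \<in> Y \<rightarrow>\<^sub>M borel \<Otimes>\<^sub>M optM S \<and> f \<in> space Y \<rightarrow> Xset S"
  unfolding XM_def measurable_restrict_space2_iff by auto

lemma measurable_fst_XM [measurable]: "fst \<in> XM S \<rightarrow>\<^sub>M borel"
  and measurable_snd_XM [measurable]: "snd \<in> XM S \<rightarrow>\<^sub>M optM S"
  unfolding XM_def by (auto intro: measurable_restrict_space1)

lemma measurable_jump_pair:
  assumes t: "t \<in> Y \<rightarrow>\<^sub>M pos" and x: "x \<in> Y \<rightarrow>\<^sub>M BM S"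
  shows "(\<lambda>y. (ennreal (t y), Some (x y))) \<in> Y \<rightarrow>\<^sub>M XM S"
  unfolding measurable_XM_iff
proof
  have "t \<in> borel_measurable Y"
    by (rule measurable_compose[OF t measurable_pos_ident(1)])
  then show "(\<lambda>y. (ennreal (t y), Some (x y))) \<in> Y \<rightarrow>\<^sub>M borel \<Otimes>\<^sub>M optM S"
    using x by measurable
  show "(\<lambda>y. (ennreal (t y), Some (x y))) \<in> space Y \<rightarrow> Xset S"
    using measurable_space[OF t] measurable_space[OF x] by (auto simp: Xset_def space_pos)
qed

lemma end_in_Xset [simp]: "(\<infinity>, None) \<in> Xset S" "(top, None) \<in> Xset S"
  by (simp_all add: Xset_def)

text \<open>The jump law as a functional on nonnegative functions, the form in which linearity and
  monotone continuity can be checked.\<close>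

definition jump_integral :: "'s \<Rightarrow> (real \<Rightarrow> 'a measure) \<Rightarrow> (ennreal \<times> 's option \<Rightarrow> ennreal) \<Rightarrow> ennreal" where
  "jump_integral x \<rho> f =
    (\<integral>\<^sup>+ t \<in> {0<..}. exp_minus (Iq qx x \<rho> (ennreal t)) * (\<integral>\<^sup>+ s. f (ennreal t, Some s) \<partial>qmix S qt x (\<rho> t)) \<partial>lborel)
    + exp_minus (Iq qx x \<rho> \<infinity>) * f (\<infinity>, None)"

lemma measurable_jump_integral:
  assumes f [measurable]: "(\<lambda>(y, z). f y z) \<in> borel_measurable (Y \<Otimes>\<^sub>M XM S)"
    and x [measurable]: "x \<in> Y \<rightarrow>\<^sub>M BM S" and \<rho> [measurable]: "\<rho> \<in> Y \<rightarrow>\<^sub>M RM A"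
  shows "(\<lambda>y. jump_integral (x y) (\<rho> y) (f y)) \<in> borel_measurable Y"
  unfolding jump_integral_def
proof (intro borel_measurable_add borel_measurable_times_ennreal)
  let ?N = "Y \<Otimes>\<^sub>M (pos \<Otimes>\<^sub>M PA)"
  have *: "(\<lambda>p. fst (snd p)) \<in> ?N \<rightarrow>\<^sub>M (borel :: real measure)"
    by (rule measurable_compose[OF _ measurable_pos_ident(1)]) measurable
  have [measurable]: "(\<lambda>p. ennreal (fst (snd p))) \<in> borel_measurable ?N"
    by (rule measurable_compose[OF *]) measurable
  have [measurable]: "(\<lambda>p. Iq qx (x (fst p)) (\<rho> (fst p)) (ennreal (fst (snd p)))) \<in> borel_measurable ?N"
    by (rule measurable_Iq) measurable
  have [measurable]: "(\<lambda>p. \<integral>\<^sup>+ s. f (fst p) (ennreal (fst (snd p)), Some s) \<partial>qmix S qt (x (fst p)) (snd (snd p))) \<in> borel_measurable ?N"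
  proof (rule measurable_qmix_integral)
    have "(\<lambda>q. (ennreal (fst (snd (fst q))), Some (snd q))) \<in> ?N \<Otimes>\<^sub>M BM S \<rightarrow>\<^sub>M XM S"
      by (rule measurable_jump_pair) measurable
    then have "(\<lambda>q. (fst (fst q), ennreal (fst (snd (fst q))), Some (snd q))) \<in> ?N \<Otimes>\<^sub>M BM S \<rightarrow>\<^sub>M Y \<Otimes>\<^sub>M XM S"
      by measurable
    from measurable_compose[OF this f]
    show "(\<lambda>(p, s). f (fst p) (ennreal (fst (snd p)), Some s)) \<in> borel_measurable (?N \<Otimes>\<^sub>M BM S)"
      by (simp add: case_prod_unfold)
  qed measurable
  have "(\<lambda>p. exp_minus (Iq qx (x (fst p)) (\<rho> (fst p)) (ennreal (fst (snd p)))) *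
      (\<integral>\<^sup>+ s. f (fst p) (ennreal (fst (snd p)), Some s) \<partial>qmix S qt (x (fst p)) (snd (snd p)))) \<in> borel_measurable ?N"
    by measurable
  from measurable_RM_integral[OF this \<rho>]
  show "(\<lambda>y. \<integral>\<^sup>+ t \<in> {0<..}. exp_minus (Iq qx (x y) (\<rho> y) (ennreal t)) * (\<integral>\<^sup>+ s. f y (ennreal t, Some s) \<partial>qmix S qt (x y) (\<rho> y t)) \<partial>lborel) \<in> borel_measurable Y"
    by simp
  have "(\<lambda>y. Iq qx (x y) (\<rho> y) \<infinity>) \<in> borel_measurable Y"
    by (rule measurable_Iq) measurable
  then show "(\<lambda>y. exp_minus (Iq qx (x y) (\<rho> y) \<infinity>)) \<in> borel_measurable Y"
    by measurable
  have "(\<lambda>y. (y, \<infinity>, None)) \<in> Y \<rightarrow>\<^sub>M Y \<Otimes>\<^sub>M XM S"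
    by (intro measurable_Pair measurable_ident_sets[OF refl] measurable_const) simp
  from measurable_compose[OF this f] show "(\<lambda>y. f y (\<infinity>, None)) \<in> borel_measurable Y"
    by simp
qed

lemma measurable_Rset_mean_kernel:
  assumes x: "x \<in> S" and \<rho>: "\<rho> \<in> Rset A" and f: "f \<in> borel_measurable (XM S)"
  shows "(\<lambda>t. exp_minus (Iq qx x \<rho> (ennreal t)) * (\<integral>\<^sup>+ s. f (ennreal t, Some s) \<partial>qmix S qt x (\<rho> t))) \<in> borel_measurable pos"
    (is "?F \<in> _")
    and "0 < t \<Longrightarrow> (\<lambda>s. f (ennreal t, Some s)) \<in> borel_measurable (BM S)"
proof -
  have [measurable]: "(\<lambda>t. ennreal t) \<in> borel_measurable pos"
    by (rule measurable_restrict_space1) measurable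
  have *: "(\<lambda>t. Iq qx x \<rho> (ennreal t)) \<in> borel_measurable pos"
    by (rule measurable_Iq) (use x \<rho> in auto)
  have **: "(\<lambda>t. \<integral>\<^sup>+ s. f (ennreal t, Some s) \<partial>qmix S qt x (\<rho> t)) \<in> borel_measurable pos"
  proof (rule measurable_qmix_integral)
    have "(\<lambda>q. (ennreal (fst q), Some (snd q))) \<in> pos \<Otimes>\<^sub>M BM S \<rightarrow>\<^sub>M XM S"
      by (rule measurable_jump_pair) measurable
    from measurable_compose[OF this f]
    show "(\<lambda>(t, s). f (ennreal t, Some s)) \<in> borel_measurable (pos \<Otimes>\<^sub>M BM S)"
      by (simp add: case_prod_unfold)
  qed (use x RsetD[OF \<rho>] in auto)
  show "?F \<in> borel_measurable pos"
    using * ** by measurable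
  assume t: "0 < t"
  have "(\<lambda>s. (ennreal t, Some s)) \<in> BM S \<rightarrow>\<^sub>M XM S"
    using t by (intro measurable_jump_pair) (auto simp: space_pos)
  from measurable_compose[OF this f] show "(\<lambda>s. f (ennreal t, Some s)) \<in> borel_measurable (BM S)" .
qed

lemma borel_measurable_lborel_pos:
  "f \<in> borel_measurable pos \<Longrightarrow> (\<lambda>t. f t * indicator {0<..} t :: ennreal) \<in> borel_measurable lborel"
  by (subst (asm) borel_measurable_restrict_space_iff_ennreal) (auto simp: mult.commute)

lemma sets_jumpLaw [simp]: "sets (jumpLaw S qt qx x \<rho>) = sets (XM S)"
  unfolding jumpLaw_def using sets.space_closed[of "XM S"] sets.sigma_sets_eq[of "XM S"] by simp

lemma space_jumpLaw [simp]: "space (jumpLaw S qt qx x \<rho>) = Xset S"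
  using sets_eq_imp_space_eq[OF sets_jumpLaw] by simp

lemma nn_integral_jumpLaw:
  assumes x: "x \<in> S" and \<rho>: "\<rho> \<in> Rset A" and f: "f \<in> borel_measurable (XM S)"
  shows "(\<integral>\<^sup>+ z. f z \<partial>jumpLaw S qt qx x \<rho>) = jump_integral x \<rho> f"
  unfolding jumpLaw_def
proof (rule measure_of_functional)
  note m = measurable_Rset_mean_kernel[OF x \<rho>]
  note mp = borel_measurable_lborel_pos[OF m(1)]
  note qm = measurable_cong_sets[OF sets_qmix refl, where N = borel]
  {
    fix f g :: "ennreal \<times> 's option \<Rightarrow> ennreal" assume fg: "f \<in> borel_measurable (XM S)" "g \<in> borel_measurable (XM S)"
    have "(\<integral>\<^sup>+ t \<in> {0<..}. exp_minus (Iq qx x \<rho> (ennreal t)) * (\<integral>\<^sup>+ s. f (ennreal t, Some s) + g (ennreal t, Some s) \<partial>qmix S qt x (\<rho> t)) \<partial>lborel)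
       = (\<integral>\<^sup>+ t. exp_minus (Iq qx x \<rho> (ennreal t)) * (\<integral>\<^sup>+ s. f (ennreal t, Some s) \<partial>qmix S qt x (\<rho> t)) * indicator {0<..} t
          + exp_minus (Iq qx x \<rho> (ennreal t)) * (\<integral>\<^sup>+ s. g (ennreal t, Some s) \<partial>qmix S qt x (\<rho> t)) * indicator {0<..} t \<partial>lborel)"
      using m(2) fg by (intro nn_integral_cong) (auto simp: nn_integral_add qm distrib_left split: split_indicator)
    then show "jump_integral x \<rho> (\<lambda>x. f x + g x) = jump_integral x \<rho> f + jump_integral x \<rho> g"
      unfolding jump_integral_def using mp fg by (simp add: nn_integral_add distrib_left algebra_simps)
  next
    fix f :: "ennreal \<times> 's option \<Rightarrow> ennreal" and r assume f: "f \<in> borel_measurable (XM S)"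
    have "(\<integral>\<^sup>+ t \<in> {0<..}. exp_minus (Iq qx x \<rho> (ennreal t)) * (\<integral>\<^sup>+ s. r * f (ennreal t, Some s) \<partial>qmix S qt x (\<rho> t)) \<partial>lborel)
       = (\<integral>\<^sup>+ t. r * (exp_minus (Iq qx x \<rho> (ennreal t)) * (\<integral>\<^sup>+ s. f (ennreal t, Some s) \<partial>qmix S qt x (\<rho> t)) * indicator {0<..} t) \<partial>lborel)"
      using m(2) f by (intro nn_integral_cong) (auto simp: nn_integral_cmult qm mult_ac split: split_indicator)
    then show "jump_integral x \<rho> (\<lambda>x. r * f x) = r * jump_integral x \<rho> f"
      unfolding jump_integral_def using mp[OF f] by (simp add: nn_integral_cmult distrib_left mult_ac)
  next
    fix F :: "nat \<Rightarrow> ennreal \<times> 's option \<Rightarrow> ennreal" assume F: "\<And>i. F i \<in> borel_measurable (XM S)" "incseq F"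
    have le: "F i z \<le> F j z" if "i \<le> j" for i j z
      using F(2) that unfolding incseq_def le_fun_def by blast
    have "(\<integral>\<^sup>+ t \<in> {0<..}. exp_minus (Iq qx x \<rho> (ennreal t)) * (\<integral>\<^sup>+ s. (SUP i. F i (ennreal t, Some s)) \<partial>qmix S qt x (\<rho> t)) \<partial>lborel)
       = (\<integral>\<^sup>+ t. (SUP i. exp_minus (Iq qx x \<rho> (ennreal t)) * (\<integral>\<^sup>+ s. F i (ennreal t, Some s) \<partial>qmix S qt x (\<rho> t)) * indicator {0<..} t) \<partial>lborel)"
    proof (intro nn_integral_cong)
      fix t :: real
      show "exp_minus (Iq qx x \<rho> (ennreal t)) * (\<integral>\<^sup>+ s. (SUP i. F i (ennreal t, Some s)) \<partial>qmix S qt x (\<rho> t)) * indicator {0<..} t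
         = (SUP i. exp_minus (Iq qx x \<rho> (ennreal t)) * (\<integral>\<^sup>+ s. F i (ennreal t, Some s) \<partial>qmix S qt x (\<rho> t)) * indicator {0<..} t)"
      proof (cases "0 < t")
        case True
        have "(\<integral>\<^sup>+ s. (SUP i. F i (ennreal t, Some s)) \<partial>qmix S qt x (\<rho> t)) = (SUP i. \<integral>\<^sup>+ s. F i (ennreal t, Some s) \<partial>qmix S qt x (\<rho> t))"
          using m(2)[OF F(1) True] le
          by (intro nn_integral_monotone_convergence_SUP) (auto simp: qm incseq_def le_fun_def)
        with True show ?thesis
          by (simp add: SUP_mult_left_ennreal)
      qed simp
    qed
    also have "\<dots> = (SUP i. \<integral>\<^sup>+ t \<in> {0<..}. exp_minus (Iq qx x \<rho> (ennreal t)) * (\<integral>\<^sup>+ s. F i (ennreal t, Some s) \<partial>qmix S qt x (\<rho> t)) \<partial>lborel)"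
      using mp[OF F(1)] le
      by (intro nn_integral_monotone_convergence_SUP) (auto simp: incseq_def le_fun_def intro!: mult_right_mono mult_left_mono nn_integral_mono)
    finally show "jump_integral x \<rho> (\<lambda>x. SUP i. F i x) = (SUP i. jump_integral x \<rho> (F i))"
      unfolding jump_integral_def using le
      by (simp add: SUP_mult_left_ennreal)
         (subst ennreal_SUP_add, auto simp: incseq_def intro!: mult_right_mono mult_left_mono nn_integral_mono)
  next
    fix f g :: "ennreal \<times> 's option \<Rightarrow> ennreal" assume *: "\<And>z. z \<in> space (XM S) \<Longrightarrow> f z = g z"
    have "(\<integral>\<^sup>+ t \<in> {0<..}. exp_minus (Iq qx x \<rho> (ennreal t)) * (\<integral>\<^sup>+ s. f (ennreal t, Some s) \<partial>qmix S qt x (\<rho> t)) \<partial>lborel)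
       = (\<integral>\<^sup>+ t \<in> {0<..}. exp_minus (Iq qx x \<rho> (ennreal t)) * (\<integral>\<^sup>+ s. g (ennreal t, Some s) \<partial>qmix S qt x (\<rho> t)) \<partial>lborel)"
    proof (intro nn_integral_cong)
      fix t :: real
      have "(\<integral>\<^sup>+ s. f (ennreal t, Some s) \<partial>qmix S qt x (\<rho> t)) = (\<integral>\<^sup>+ s. g (ennreal t, Some s) \<partial>qmix S qt x (\<rho> t))" if "0 < t"
        using that by (intro nn_integral_cong *) (auto simp: Xset_def)
      then show "exp_minus (Iq qx x \<rho> (ennreal t)) * (\<integral>\<^sup>+ s. f (ennreal t, Some s) \<partial>qmix S qt x (\<rho> t)) * indicator {0<..} t
        = exp_minus (Iq qx x \<rho> (ennreal t)) * (\<integral>\<^sup>+ s. g (ennreal t, Some s) \<partial>qmix S qt x (\<rho> t)) * indicator {0<..} t"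
        by (simp split: split_indicator)
    qed
    then show "jump_integral x \<rho> f = jump_integral x \<rho> g"
      unfolding jump_integral_def using *[of "(\<infinity>, None)"] by simp
  next
    fix E assume E: "E \<in> sets (XM S)"
    then have i: "indicator E \<in> borel_measurable (XM S)" by simp
    have "emeasure (qmix S qt x (\<rho> t)) {y. (ennreal t, Some y) \<in> E} = (\<integral>\<^sup>+ s. indicator E (ennreal t, Some s) \<partial>qmix S qt x (\<rho> t))"
      if t: "0 < t" for t
    proof -
      have "(\<lambda>s. (ennreal t, Some s)) \<in> BM S \<rightarrow>\<^sub>M XM S"
        using t by (intro measurable_jump_pair) (auto simp: space_pos)
      from measurable_sets[OF this E] have "{y \<in> S. (ennreal t, Some y) \<in> E} \<in> sets (BM S)"
        by (simp add: vimage_def Int_def conj_commute)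
      moreover have eq: "{y. (ennreal t, Some y) \<in> E} = {y \<in> S. (ennreal t, Some y) \<in> E}"
        using sets.sets_into_space[OF E] by (auto simp: Xset_def)
      ultimately have "emeasure (qmix S qt x (\<rho> t)) {y. (ennreal t, Some y) \<in> E} = (\<integral>\<^sup>+ s. indicator {y. (ennreal t, Some y) \<in> E} s \<partial>qmix S qt x (\<rho> t))"
        by (subst nn_integral_indicator) (simp_all add: eq)
      then show ?thesis by (simp add: indicator_def)
    qed
    then show "(\<integral>\<^sup>+ t \<in> {0<..}. exp_minus (Iq qx x \<rho> (ennreal t)) * emeasure (qmix S qt x (\<rho> t)) {y. (ennreal t, Some y) \<in> E} \<partial>lborel)
        + exp_minus (Iq qx x \<rho> \<infinity>) * indicator E (\<infinity>, None) = jump_integral x \<rho> (indicator E)"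
      unfolding jump_integral_def by (intro arg_cong2[where f="(+)"] nn_integral_cong) (auto split: split_indicator)
  }
qed (rule f)

lemma prob_space_jumpLaw:
  assumes x: "x \<in> S" and \<rho>: "\<rho> \<in> Rset A"
  shows "prob_space (jumpLaw S qt qx x \<rho>)"
proof
  obtain K where K: "0 \<le> K" "\<And>\<mu>. \<mu> \<in> space PA \<Longrightarrow> mean qx x \<mu> \<le> ennreal K"
    using mean_qx_bound[OF x] by blast
  \<comment> \<open>The jump intensity at time \<open>t\<close> is the total mass of
    \<open>qmix\<close>. It is set to zero for \<open>t \<le> 0\<close> because
    \<open>survival_integral\<close> works on the whole real line.\<close>
  define g where "g t = mean qx x (\<rho> t) * indicator {0<..} t" for t
  have g: "g \<in> borel_measurable borel"
    using borel_measurable_lborel_pos[OF measurable_mean[OF qx_meas _ RsetD[OF \<rho>], of "\<lambda>_. x"]] x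
    unfolding g_def by simp
  have gI: "(\<integral>\<^sup>+ s \<in> {s. ennreal s < T}. g s \<partial>lborel) = Iq qx x \<rho> T" for T
    unfolding Iq_eq Irate_def g_def by (intro nn_integral_cong) (auto split: split_indicator)
  have "emeasure (jumpLaw S qt qx x \<rho>) (space (jumpLaw S qt qx x \<rho>)) = (\<integral>\<^sup>+ z. 1 \<partial>jumpLaw S qt qx x \<rho>)"
    by simp
  also have "\<dots> = jump_integral x \<rho> (\<lambda>_. 1)"
    using x \<rho> by (rule nn_integral_jumpLaw) simp
  also have "\<dots> = (\<integral>\<^sup>+ t. exp_minus (Iq qx x \<rho> (ennreal t)) * g t \<partial>lborel) + exp_minus (Iq qx x \<rho> \<infinity>)"
    unfolding jump_integral_def g_def using x Rset_space[OF \<rho>]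
    by (intro arg_cong2[where f="(+)"] nn_integral_cong) (auto simp: emeasure_qmix_space split: split_indicator)
  also have "\<dots> = 1"
    using survival_integral[OF g, of K] K Rset_space[OF \<rho>] unfolding gI
    by (auto simp: g_def split: split_indicator)
  finally show "emeasure (jumpLaw S qt qx x \<rho>) (space (jumpLaw S qt qx x \<rho>)) = 1" .
qed

end

section \<open>Policies and their values\<close>

lemma (in Ionescu_Tulcea) nn_integral_C_Suc:
  assumes f: "f \<in> borel_measurable (PiM {0..<Suc n} M)"
  shows "(\<integral>\<^sup>+ h. f h \<partial>C 0 (Suc n) (\<lambda>_. undefined)) = (\<integral>\<^sup>+ h. \<integral>\<^sup>+ z. f (h(n := z)) \<partial>P n h \<partial>C 0 n (\<lambda>_. undefined))"
proof -
  have u: "(\<lambda>_. undefined) \<in> space (PiM {0..<0} M)"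
    by (simp add: space_PiM)
  have "(\<integral>\<^sup>+ h. f h \<partial>C 0 (Suc n) (\<lambda>_. undefined)) = (\<integral>\<^sup>+ h. \<integral>\<^sup>+ h'. f h' \<partial>eP n h \<partial>C 0 n (\<lambda>_. undefined))"
    using f measurable_eP[of n]
    by (simp, intro nn_integral_bind[where B="PiM {0..<Suc n} M"]) (simp_all add: measurable_cong_sets[OF sets_C[OF u]])
  also have "\<dots> = (\<integral>\<^sup>+ h. \<integral>\<^sup>+ z. f (h(n := z)) \<partial>P n h \<partial>C 0 n (\<lambda>_. undefined))"
    using f by (intro nn_integral_cong nn_integral_eP) (simp_all add: space_C[OF u])
  finally show ?thesis .
qed

lemma (in Ionescu_Tulcea) nn_integral_lim_restrict:
  assumes f: "f \<in> borel_measurable (PiM {0..<n} M)"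
  shows "(\<integral>\<^sup>+ \<omega>. f (restrict \<omega> {0..<n}) \<partial>PF.lim) = (\<integral>\<^sup>+ h. f h \<partial>C 0 n (\<lambda>_. undefined))"
proof -
  have u: "(\<lambda>_. undefined) \<in> space (PiM {0..<0} M)"
    by (simp add: space_PiM)
  \<comment> \<open>Ionescu-Tulcea marginals on a finite index set are computed on the smallest
    initial segment containing it, here the set itself.\<close>
  have up: "up_to {0..<n} = n"
    using up_to_iff[of "{0..<n}" n] up_to_iff[of "{0..<n}" "up_to {0..<n}"]
    by (cases n) (auto intro!: antisym simp: Suc_le_eq simp del: up_to_iff)
  have "(\<integral>\<^sup>+ \<omega>. f (restrict \<omega> {0..<n}) \<partial>PF.lim) = (\<integral>\<^sup>+ h. f h \<partial>distr PF.lim (PiM {0..<n} M) (\<lambda>x. restrict x {0..<n}))"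
    using f by (subst nn_integral_distr) (auto simp: measurable_cong_sets[OF PF.sets_lim] intro!: measurable_restrict_subset)
  also have "\<dots> = (\<integral>\<^sup>+ h. f h \<partial>CI {0..<n})"
    by (subst distr_lim) simp_all
  also have "\<dots> = (\<integral>\<^sup>+ h. f (restrict h {0..<n}) \<partial>C 0 n (\<lambda>_. undefined))"
    unfolding CI_def up using f
    by (subst nn_integral_distr) (auto simp: measurable_cong_sets[OF sets_C[OF u]] intro!: measurable_restrict_subset)
  also have "\<dots> = (\<integral>\<^sup>+ h. f h \<partial>C 0 n (\<lambda>_. undefined))"
    by (intro nn_integral_cong) (simp add: space_C[OF u] space_PiM PiE_restrict)
  finally show ?thesis .
qed

context ctmdp
begin

section \<open>Transition kernel and one-stage operator\<close>

lemma sets_pker [simp]: "sets (pker S qt qx z \<rho>) = sets (XM S)"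
  by (simp add: pker_def split: option.split)

lemma space_pker [simp]: "space (pker S qt qx z \<rho>) = Xset S"
  using sets_eq_imp_space_eq[OF sets_pker] by simp

lemma prob_space_pker:
  assumes "snd z \<in> space (optM S)" "\<rho> \<in> Rset A"
  shows "prob_space (pker S qt qx z \<rho>)"
  using assms by (auto simp: pker_def prob_space_jumpLaw intro!: prob_space_return)

lemma nn_integral_pker:
  assumes "snd z \<in> space (optM S)" "\<rho> \<in> Rset A" "f \<in> borel_measurable (XM S)"
  shows "(\<integral>\<^sup>+ y. f y \<partial>pker S qt qx z \<rho>) = (case snd z of None \<Rightarrow> f (\<infinity>, None) | Some x \<Rightarrow> jump_integral x \<rho> f)"
  using assms by (auto simp: pker_def nn_integral_jumpLaw nn_integral_return)

lemma measurable_pker_integral: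
  assumes f: "(\<lambda>(y, z). f y z) \<in> borel_measurable (Y \<Otimes>\<^sub>M XM S)"
    and w [measurable]: "(\<lambda>y. snd (w y)) \<in> Y \<rightarrow>\<^sub>M optM S" and \<rho> [measurable]: "\<rho> \<in> Y \<rightarrow>\<^sub>M RM A"
  shows "(\<lambda>y. \<integral>\<^sup>+ z. f y z \<partial>pker S qt qx (w y) (\<rho> y)) \<in> borel_measurable Y"
proof -
  have "(\<lambda>y. (y, \<infinity>, None)) \<in> Y \<rightarrow>\<^sub>M Y \<Otimes>\<^sub>M XM S"
    by (intro measurable_Pair measurable_ident_sets[OF refl] measurable_const) simp
  from measurable_compose[OF this f] have 1: "(\<lambda>y. f y (\<infinity>, None)) \<in> borel_measurable Y"
    by simp
  have 2: "(\<lambda>y. jump_integral (default (snd (w y))) (\<rho> y) (f y)) \<in> borel_measurable Y"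
    by (rule measurable_jump_integral[OF f]) measurable
  have "(\<lambda>y. case snd (w y) of None \<Rightarrow> f y (\<infinity>, None) | Some x \<Rightarrow> jump_integral x (\<rho> y) (f y)) \<in> borel_measurable Y"
    by (rule measurable_case_option[where o'="\<lambda>y. snd (w y)" and g="\<lambda>y x. jump_integral x (\<rho> y) (f y)", OF w 1 2])
  moreover have "(\<integral>\<^sup>+ z. f y z \<partial>pker S qt qx (w y) (\<rho> y))
      = (case snd (w y) of None \<Rightarrow> f y (\<infinity>, None) | Some x \<Rightarrow> jump_integral x (\<rho> y) (f y))" if y: "y \<in> space Y" for y
    using measurable_space[OF w y] measurable_space[OF \<rho> y] measurable_Pair2[OF f y]
    by (intro nn_integral_pker) simp_all
  ultimately show ?thesis
    by (subst measurable_cong) auto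
qed

lemma measurable_pker:
  assumes w: "(\<lambda>y. snd (w y)) \<in> Y \<rightarrow>\<^sub>M optM S" and \<rho>: "\<rho> \<in> Y \<rightarrow>\<^sub>M RM A"
  shows "(\<lambda>y. pker S qt qx (w y) (\<rho> y)) \<in> Y \<rightarrow>\<^sub>M prob_algebra (XM S)"
proof (rule measurable_prob_algebraI)
  show "prob_space (pker S qt qx (w y) (\<rho> y))" if y: "y \<in> space Y" for y
    using measurable_space[OF w y] measurable_space[OF \<rho> y] by (intro prob_space_pker) simp_all
  then show "(\<lambda>y. pker S qt qx (w y) (\<rho> y)) \<in> Y \<rightarrow>\<^sub>M subprob_algebra (XM S)"
  proof (intro measurable_subprob_algebra prob_space_imp_subprob_space)
    fix E assume E: "E \<in> sets (XM S)"
    have "(\<lambda>y. \<integral>\<^sup>+ z. indicator E z \<partial>pker S qt qx (w y) (\<rho> y)) \<in> borel_measurable Y"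
      using E by (intro measurable_pker_integral w \<rho>) (auto simp: case_prod_unfold)
    with E show "(\<lambda>y. emeasure (pker S qt qx (w y) (\<rho> y)) E) \<in> borel_measurable Y"
      by simp
  qed simp_all
qed

lemma measurable_lcost:
  assumes w [measurable]: "(\<lambda>y. snd (w y)) \<in> Y \<rightarrow>\<^sub>M optM S" and \<rho>: "\<rho> \<in> Y \<rightarrow>\<^sub>M RM A"
    and w': "(\<lambda>y. fst (w' y)) \<in> borel_measurable Y"
  shows "(\<lambda>y. lcost c (w y) (\<rho> y) (w' y)) \<in> borel_measurable Y"
  unfolding lcost_def
proof (rule measurable_case_option[OF w])
  show "(\<lambda>y. Ic c (default (snd (w y))) (\<rho> y) (fst (w' y))) \<in> borel_measurable Y"
    using \<rho> w' by (intro measurable_Ic) measurable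
qed simp

text \<open>The one-stage operator of the multiplicative criterion: the exponential of a sum of
  costs is a product, so the cost of a stage multiplies the value of what follows.\<close>

definition step :: "ennreal \<times> 's option \<Rightarrow> (real \<Rightarrow> 'a measure) \<Rightarrow> (ennreal \<times> 's option \<Rightarrow> ennreal) \<Rightarrow> ennreal" where
  "step w \<rho> f = (\<integral>\<^sup>+ z. exp_plus (lcost c w \<rho> z) * f z \<partial>pker S qt qx w \<rho>)"

lemma measurable_step:
  assumes f [measurable]: "(\<lambda>(y, z). f y z) \<in> borel_measurable (Y \<Otimes>\<^sub>M XM S)"
    and w: "(\<lambda>y. snd (w y)) \<in> Y \<rightarrow>\<^sub>M optM S" and \<rho>: "\<rho> \<in> Y \<rightarrow>\<^sub>M RM A"
  shows "(\<lambda>y. step (w y) (\<rho> y) (f y)) \<in> borel_measurable Y"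
  unfolding step_def
proof (rule measurable_pker_integral[OF _ w \<rho>])
  have [measurable]: "(\<lambda>p. lcost c (w (fst p)) (\<rho> (fst p)) (snd p)) \<in> borel_measurable (Y \<Otimes>\<^sub>M XM S)"
    by (rule measurable_lcost)
       (rule measurable_compose[OF measurable_fst w] measurable_compose[OF measurable_fst \<rho>] measurable_compose[OF measurable_snd measurable_fst_XM])+
  show "(\<lambda>(y, z). exp_plus (lcost c (w y) (\<rho> y) z) * f y z) \<in> borel_measurable (Y \<Otimes>\<^sub>M XM S)"
    by measurable
qed

lemma borel_measurable_pker: "borel_measurable (pker S qt qx w \<rho>) = borel_measurable (XM S)"
  by (rule measurable_cong_sets) simp_all

lemma measurable_exp_lcost:
  assumes "snd w \<in> space (optM S)" "\<rho> \<in> Rset A"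
  shows "(\<lambda>z. exp_plus (lcost c w \<rho> z)) \<in> borel_measurable (XM S)"
  by (rule measurable_compose[OF measurable_lcost measurable_exp_plus]) (use assms in auto)

lemma step_cong: "(\<And>z. z \<in> Xset S \<Longrightarrow> f z = g z) \<Longrightarrow> step w \<rho> f = step w \<rho> g"
  unfolding step_def by (intro nn_integral_cong) simp

lemma step_mono: "(\<And>z. z \<in> Xset S \<Longrightarrow> f z \<le> g z) \<Longrightarrow> step w \<rho> f \<le> step w \<rho> g"
  unfolding step_def by (intro nn_integral_mono mult_left_mono) simp_all

lemma step_cmult:
  assumes "snd w \<in> space (optM S)" "\<rho> \<in> Rset A" and f: "f \<in> borel_measurable (XM S)"
  shows "step w \<rho> (\<lambda>z. r * f z) = r * step w \<rho> f"
proof -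
  have "step w \<rho> (\<lambda>z. r * f z) = (\<integral>\<^sup>+ z. r * (exp_plus (lcost c w \<rho> z) * f z) \<partial>pker S qt qx w \<rho>)"
    unfolding step_def by (simp add: mult_ac)
  also have "\<dots> = r * step w \<rho> f"
    unfolding step_def using f measurable_exp_lcost[OF assms(1,2)]
    by (intro nn_integral_cmult) (simp add: borel_measurable_pker)
  finally show ?thesis .
qed

lemma step_SUP:
  assumes "snd w \<in> space (optM S)" "\<rho> \<in> Rset A" and f: "\<And>n::nat. f n \<in> borel_measurable (XM S)"
    and inc: "\<And>n z. z \<in> Xset S \<Longrightarrow> f n z \<le> f (Suc n) z"
  shows "step w \<rho> (\<lambda>z. SUP n. f n z) = (SUP n. step w \<rho> (f n))"
proof -
  have "step w \<rho> (\<lambda>z. SUP n. f n z) = (\<integral>\<^sup>+ z. (SUP n. exp_plus (lcost c w \<rho> z) * f n z) \<partial>pker S qt qx w \<rho>)"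
    unfolding step_def by (simp add: SUP_mult_left_ennreal)
  also have "\<dots> = (SUP n. step w \<rho> (f n))"
    unfolding step_def
  proof (rule nn_integral_monotone_convergence_SUP_AE)
    show "AE z in pker S qt qx w \<rho>. exp_plus (lcost c w \<rho> z) * f n z \<le> exp_plus (lcost c w \<rho> z) * f (Suc n) z" for n
      using inc by (intro AE_I2 mult_left_mono) simp_all
    show "(\<lambda>z. exp_plus (lcost c w \<rho> z) * f n z) \<in> borel_measurable (pker S qt qx w \<rho>)" for n
      using f measurable_exp_lcost[OF assms(1,2)] by (simp add: borel_measurable_pker)
  qed
  finally show ?thesis .
qed

lemma one_le_step:
  assumes "snd w \<in> space (optM S)" "\<rho> \<in> Rset A" "\<And>z. z \<in> Xset S \<Longrightarrow> 1 \<le> f z"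
  shows "1 \<le> step w \<rho> f"
proof -
  interpret prob_space "pker S qt qx w \<rho>"
    by (rule prob_space_pker[OF assms(1,2)])
  have "(\<integral>\<^sup>+ z. 1 \<partial>pker S qt qx w \<rho>) \<le> step w \<rho> f"
    unfolding step_def using mult_mono[OF one_le_exp_plus assms(3)] by (intro nn_integral_mono) simp
  then show ?thesis
    using emeasure_space_1 by simp
qed

section \<open>Histories and finite-horizon values\<close>

abbreviation HM :: "nat \<Rightarrow> (nat \<Rightarrow> ennreal \<times> 's option) measure" where
  "HM n \<equiv> PiM {0..<Suc n} (Tc S)"

lemma Tc_Suc [simp]: "Tc S (Suc n) = XM S"
  by (simp add: Tc_def)

lemma space_Tc_0 [simp]: "space (Tc S 0) = (\<lambda>y. (0, Some y)) ` S"
  by (auto simp: Tc_def space_restrict_space space_pair_measure)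

lemma measurable_fst_Tc [measurable]: "fst \<in> Tc S i \<rightarrow>\<^sub>M borel"
  and measurable_snd_Tc [measurable]: "snd \<in> Tc S i \<rightarrow>\<^sub>M optM S"
  by (cases i; auto simp: Tc_def intro: measurable_restrict_space1)+

lemma measurable_HM_component:
  assumes "f \<in> Y \<rightarrow>\<^sub>M PiM J (Tc S)" "i \<in> J"
  shows "(\<lambda>y. f y i) \<in> Y \<rightarrow>\<^sub>M Tc S i" "(\<lambda>y. fst (f y i)) \<in> borel_measurable Y" "(\<lambda>y. snd (f y i)) \<in> Y \<rightarrow>\<^sub>M optM S"
proof -
  show *: "(\<lambda>y. f y i) \<in> Y \<rightarrow>\<^sub>M Tc S i"
    by (rule measurable_compose[OF assms(1) measurable_component_singleton[OF assms(2)]])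
  show "(\<lambda>y. fst (f y i)) \<in> borel_measurable Y" "(\<lambda>y. snd (f y i)) \<in> Y \<rightarrow>\<^sub>M optM S"
    by (rule measurable_compose[OF * measurable_fst_Tc] measurable_compose[OF * measurable_snd_Tc])+
qed

lemma HM_component_space:
  assumes "h \<in> space (PiM J (Tc S))" "i \<in> J"
  shows "h i \<in> space (Tc S i)" "snd (h i) \<in> space (optM S)"
proof -
  show "h i \<in> space (Tc S i)"
    using assms by (auto simp: space_PiM)
  then show "snd (h i) \<in> space (optM S)"
    by (rule measurable_space[OF measurable_snd_Tc])
qed

lemma measurable_HM_upd:
  assumes "f \<in> Y \<rightarrow>\<^sub>M HM n" "g \<in> Y \<rightarrow>\<^sub>M XM S"
  shows "(\<lambda>y. (f y)(Suc n := g y)) \<in> Y \<rightarrow>\<^sub>M HM (Suc n)"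
  using assms by (intro measurable_fun_upd[where J="{0..<Suc n}"]) auto

lemma HM_upd_space: "h \<in> space (HM n) \<Longrightarrow> z \<in> Xset S \<Longrightarrow> h(Suc n := z) \<in> space (HM (Suc n))"
  by (auto simp: space_PiM PiE_iff extensional_def less_Suc_eq)

text \<open>Weaker than membership in \<open>policies\<close>: each stage is measurable only as a
  map into \<open>RM A\<close>, and this is enough to define the values.\<close>

definition is_policy :: "(nat \<Rightarrow> (nat \<Rightarrow> ennreal \<times> 's option) \<Rightarrow> real \<Rightarrow> 'a measure) \<Rightarrow> bool" where
  "is_policy \<pi> \<longleftrightarrow> (\<forall>n. \<pi> n \<in> HM n \<rightarrow>\<^sub>M RM A)"

lemma is_policyD: "is_policy \<pi> \<Longrightarrow> \<pi> n \<in> HM n \<rightarrow>\<^sub>M RM A"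
  by (simp add: is_policy_def)

lemma is_policy_Rset: "is_policy \<pi> \<Longrightarrow> h \<in> space (HM n) \<Longrightarrow> \<pi> n h \<in> Rset A"
  using measurable_space[OF is_policyD, of \<pi> h n] by simp

lemma joint_measurable_RM:
  assumes "(\<lambda>(y, s). g y s) \<in> Y \<Otimes>\<^sub>M pos \<rightarrow>\<^sub>M PA"
  shows "g \<in> Y \<rightarrow>\<^sub>M RM A"
proof (rule measurable_RM[OF _ assms])
  fix y assume "y \<in> space Y"
  from measurable_Pair2[OF assms this] show "g y \<in> Rset A"
    by (simp add: Rset_def)
qed

lemma policies_iff: "\<pi> \<in> policies S A \<longleftrightarrow> (\<forall>n. (\<lambda>(h, s). \<pi> n h s) \<in> HM n \<Otimes>\<^sub>M pos \<rightarrow>\<^sub>M PA)"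
  by (simp add: policies_def atLeastLessThanSuc_atLeastAtMost)

lemma policies_is_policy: "\<pi> \<in> policies S A \<Longrightarrow> is_policy \<pi>"
  unfolding is_policy_def policies_iff by (auto intro: joint_measurable_RM)

text \<open>Backward recursion for the expected exponential cost: \<open>n\<close> counts the stages
  still to be paid for, \<open>i\<close> is the position reached in the history. With no stage left
  the exponential of the empty cost is 1.\<close>

primrec Uval :: "(nat \<Rightarrow> (nat \<Rightarrow> ennreal \<times> 's option) \<Rightarrow> real \<Rightarrow> 'a measure) \<Rightarrow> nat \<Rightarrow> nat
    \<Rightarrow> (nat \<Rightarrow> ennreal \<times> 's option) \<Rightarrow> ennreal" where
  "Uval \<pi> 0 i h = 1"
| "Uval \<pi> (Suc n) i h = step (h i) (\<pi> i h) (\<lambda>z. Uval \<pi> n (Suc i) (h(Suc i := z)))"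

text \<open>The parameter is what later makes the value of a coded policy jointly measurable in the
  state and the code. The position \<open>i\<close> varies in the induction because the recursion
  moves one stage ahead.\<close>

lemma measurable_Uval_param:
  assumes \<pi>: "\<And>i. (\<lambda>(\<zeta>, h). \<pi> \<zeta> i h) \<in> Z \<Otimes>\<^sub>M HM i \<rightarrow>\<^sub>M RM A"
  shows "(\<lambda>(\<zeta>, h). Uval (\<pi> \<zeta>) n i h) \<in> borel_measurable (Z \<Otimes>\<^sub>M HM i)"
proof (induction n arbitrary: i)
  case (Suc n)
  let ?Y = "Z \<Otimes>\<^sub>M HM i"
  have "(\<lambda>q. (fst (fst q), (snd (fst q))(Suc i := snd q))) \<in> ?Y \<Otimes>\<^sub>M XM S \<rightarrow>\<^sub>M Z \<Otimes>\<^sub>M HM (Suc i)"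
    by (intro measurable_Pair measurable_HM_upd) measurable
  from measurable_compose[OF this Suc]
  have "(\<lambda>(p, z). Uval (\<pi> (fst p)) n (Suc i) ((snd p)(Suc i := z))) \<in> borel_measurable (?Y \<Otimes>\<^sub>M XM S)"
    by (simp add: case_prod_unfold)
  then have "(\<lambda>p. step (snd p i) (\<pi> (fst p) i (snd p)) (\<lambda>z. Uval (\<pi> (fst p)) n (Suc i) ((snd p)(Suc i := z)))) \<in> borel_measurable ?Y"
    using \<pi>[of i] by (intro measurable_step measurable_HM_component(3)[OF measurable_snd]) (auto simp: case_prod_unfold)
  then show ?case
    by (simp add: case_prod_unfold)
qed (simp add: case_prod_unfold)

lemma measurable_Uval:
  assumes "is_policy \<pi>"
  shows "Uval \<pi> n i \<in> borel_measurable (HM i)"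
proof -
  \<comment> \<open>A one-point parameter space reduces the claim to the parametrised
    version.\<close>
  have "(\<lambda>(\<zeta>, h). \<pi> i h) \<in> count_space {()} \<Otimes>\<^sub>M HM i \<rightarrow>\<^sub>M RM A" for i
    unfolding case_prod_unfold by (rule measurable_compose[OF measurable_snd is_policyD[OF assms]])
  from measurable_Uval_param[of "\<lambda>_. \<pi>", OF this]
  have *: "(\<lambda>p. Uval \<pi> n i (snd p)) \<in> borel_measurable (count_space {()} \<Otimes>\<^sub>M HM i)"
    by (simp add: case_prod_unfold)
  have "(\<lambda>h. ((), h)) \<in> HM i \<rightarrow>\<^sub>M count_space {()} \<Otimes>\<^sub>M HM i"
    by measurable
  from measurable_compose[OF this *] show ?thesis by simp
qed

lemma measurable_Uval_upd:
  assumes "is_policy \<pi>" "h \<in> space (HM i)"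
  shows "(\<lambda>z. Uval \<pi> n (Suc i) (h(Suc i := z))) \<in> borel_measurable (XM S)"
  by (rule measurable_compose[OF measurable_HM_upd measurable_Uval[OF assms(1)]]) (use assms(2) in auto)

section \<open>Forward expectations along a policy\<close>

definition run_cost :: "(nat \<Rightarrow> (nat \<Rightarrow> ennreal \<times> 's option) \<Rightarrow> real \<Rightarrow> 'a measure) \<Rightarrow> nat
    \<Rightarrow> (nat \<Rightarrow> ennreal \<times> 's option) \<Rightarrow> ennreal" where
  "run_cost \<pi> n h = (\<Sum>k<n. lcost c (h k) (\<pi> k (restrict h {0..<Suc k})) (h (Suc k)))"

lemma totcost_eq: "totcost c \<pi> \<omega> = (SUP n. run_cost \<pi> n \<omega>)"
  unfolding totcost_def run_cost_def lcost_def atLeastLessThanSuc_atLeastAtMost suminf_eq_SUP ..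

lemma run_cost_restrict: "run_cost \<pi> n (restrict \<omega> {0..<Suc n}) = run_cost \<pi> n \<omega>"
  unfolding run_cost_def
proof (intro sum.cong refl)
  fix k assume "k \<in> {..<n}"
  then have "restrict (restrict \<omega> {0..<Suc n}) {0..<Suc k} = restrict \<omega> {0..<Suc k}"
    by (auto simp: restrict_def fun_eq_iff)
  with \<open>k \<in> {..<n}\<close> show "lcost c (restrict \<omega> {0..<Suc n} k) (\<pi> k (restrict (restrict \<omega> {0..<Suc n}) {0..<Suc k})) (restrict \<omega> {0..<Suc n} (Suc k))
     = lcost c (\<omega> k) (\<pi> k (restrict \<omega> {0..<Suc k})) (\<omega> (Suc k))"
    by simp
qed

lemma measurable_run_cost:
  assumes "is_policy \<pi>"
  shows "run_cost \<pi> n \<in> borel_measurable (HM n)"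
  unfolding run_cost_def
proof (rule borel_measurable_sum)
  fix k assume k: "k \<in> {..<n}"
  have "(\<lambda>h. restrict h {0..<Suc k}) \<in> HM n \<rightarrow>\<^sub>M HM k"
    using k by (intro measurable_restrict_subset) auto
  from measurable_compose[OF this is_policyD[OF assms]]
  show "(\<lambda>h. lcost c (h k) (\<pi> k (restrict h {0..<Suc k})) (h (Suc k))) \<in> borel_measurable (HM n)"
    using k by (intro measurable_lcost measurable_HM_component[OF measurable_ident_sets[OF refl]]) auto
qed

lemma run_cost_Suc:
  assumes h: "h \<in> space (HM n)"
  shows "run_cost \<pi> (Suc n) (h(Suc n := z)) = run_cost \<pi> n h + lcost c (h n) (\<pi> n h) z"
proof -
  have r: "restrict (h(Suc n := z)) {0..<Suc k} = restrict h {0..<Suc k}" if "k \<le> n" for k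
    using that by (auto simp: restrict_def fun_eq_iff)
  have "restrict h {0..<Suc n} = h"
    using h by (simp add: space_PiM PiE_restrict)
  then show ?thesis
    unfolding run_cost_def by (simp add: r)
qed

definition hist0 :: "'s \<Rightarrow> nat \<Rightarrow> ennreal \<times> 's option" where
  "hist0 x = (\<lambda>_. undefined)(0 := (0, Some x))"

lemma hist0_space: "x \<in> S \<Longrightarrow> hist0 x \<in> space (HM 0)"
  by (auto simp: hist0_def space_PiM PiE_iff extensional_def)

lemma Ionescu_Tulcea_CTker:
  assumes x: "x \<in> S" and \<pi>: "is_policy \<pi>"
  shows "Ionescu_Tulcea (CTker S qt qx x \<pi>) (Tc S)"
proof -
  have *: "CTker S qt qx x \<pi> i \<in> PiM {0..<i} (Tc S) \<rightarrow>\<^sub>M prob_algebra (Tc S i)" for i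
  proof (cases i)
    case 0
    have "(\<lambda>_. return (Tc S 0) (0, Some x)) \<in> PiM {0..<0} (Tc S) \<rightarrow>\<^sub>M prob_algebra (Tc S 0)"
      using x by (intro measurable_const) (auto simp: space_prob_algebra intro!: prob_space_return)
    then show ?thesis
      by (simp add: 0 CTker_def[abs_def])
  next
    case (Suc n)
    have "(\<lambda>h. pker S qt qx (h n) (\<pi> n h)) \<in> HM n \<rightarrow>\<^sub>M prob_algebra (XM S)"
      by (intro measurable_pker measurable_HM_component(3)[OF measurable_ident_sets[OF refl]] is_policyD[OF \<pi>]) simp
    then show ?thesis
      by (simp add: Suc CTker_def[abs_def])
  qed
  show ?thesis
  proof (rule Ionescu_Tulcea.intro)
    show "CTker S qt qx x \<pi> i \<in> PiM {0..<i} (Tc S) \<rightarrow>\<^sub>M subprob_algebra (Tc S i)" for i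
      by (rule measurable_prob_algebraD[OF *])
    show "prob_space (CTker S qt qx x \<pi> i h)" if "h \<in> space (PiM {0..<i} (Tc S))" for i h
      using measurable_space[OF * that] by (simp add: space_prob_algebra)
  qed
qed

definition hlaw :: "'s \<Rightarrow> (nat \<Rightarrow> (nat \<Rightarrow> ennreal \<times> 's option) \<Rightarrow> real \<Rightarrow> 'a measure) \<Rightarrow> nat
    \<Rightarrow> (nat \<Rightarrow> ennreal \<times> 's option) measure" where
  "hlaw x \<pi> n = Ionescu_Tulcea.C (CTker S qt qx x \<pi>) (Tc S) 0 (Suc n) (\<lambda>_. undefined)"

context
  fixes x \<pi>
  assumes x: "x \<in> S" and \<pi>: "is_policy \<pi>"
begin

lemma sets_hlaw: "sets (hlaw x \<pi> n) = sets (HM n)"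
  and prob_space_hlaw: "prob_space (hlaw x \<pi> n)"
proof -
  interpret IT: Ionescu_Tulcea "CTker S qt qx x \<pi>" "Tc S"
    by (rule Ionescu_Tulcea_CTker[OF x \<pi>])
  have u: "(\<lambda>_. undefined) \<in> space (PiM {0..<0} (Tc S))"
    by (simp add: space_PiM)
  show "sets (hlaw x \<pi> n) = sets (HM n)" "prob_space (hlaw x \<pi> n)"
    unfolding hlaw_def using IT.sets_C[OF u, of "Suc n"] IT.prob_space_C[OF u, of "Suc n"] by simp_all
qed

lemma nn_integral_hlaw_0:
  assumes f: "f \<in> borel_measurable (HM 0)"
  shows "(\<integral>\<^sup>+ h. f h \<partial>hlaw x \<pi> 0) = f (hist0 x)"
proof -
  interpret IT: Ionescu_Tulcea "CTker S qt qx x \<pi>" "Tc S"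
    by (rule Ionescu_Tulcea_CTker[OF x \<pi>])
  have u: "(\<lambda>_. undefined) \<in> space (PiM {0..<0} (Tc S))"
    by (simp add: space_PiM)
    have fu: "(\<lambda>z. f ((\<lambda>_. undefined)(0 := z))) \<in> borel_measurable (Tc S 0)"
      by (rule measurable_compose[OF measurable_fun_upd[where J="{}"] f]) (auto intro!: measurable_const simp: space_PiM)
    have "(\<integral>\<^sup>+ h. f h \<partial>hlaw x \<pi> 0) = (\<integral>\<^sup>+ h. \<integral>\<^sup>+ z. f (h(0 := z)) \<partial>CTker S qt qx x \<pi> 0 h \<partial>return (PiM {0..<0} (Tc S)) (\<lambda>_. undefined))"
      unfolding hlaw_def by (subst IT.nn_integral_C_Suc[OF f]) simp
    also have "\<dots> = (\<integral>\<^sup>+ h. f (hist0 x) \<partial>return (PiM {0..<0} (Tc S)) (\<lambda>_. undefined))"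
      using fu x by (intro nn_integral_cong) (auto simp: CTker_def space_PiM hist0_def nn_integral_return)
    finally show ?thesis
      using u by (simp add: nn_integral_return)
qed

lemma nn_integral_hlaw_Suc:
  assumes g: "g \<in> borel_measurable (HM (Suc n))"
  shows "(\<integral>\<^sup>+ h. g h \<partial>hlaw x \<pi> (Suc n)) = (\<integral>\<^sup>+ h. \<integral>\<^sup>+ z. g (h(Suc n := z)) \<partial>pker S qt qx (h n) (\<pi> n h) \<partial>hlaw x \<pi> n)"
proof -
  interpret IT: Ionescu_Tulcea "CTker S qt qx x \<pi>" "Tc S"
    by (rule Ionescu_Tulcea_CTker[OF x \<pi>])
  show ?thesis
    unfolding hlaw_def IT.nn_integral_C_Suc[OF g] by (simp add: CTker_def)
qed

text \<open>Up to a finite horizon the cost depends on finitely many coordinates, whose law is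
  \<open>hlaw\<close>; monotone convergence recovers the full cost.\<close>

lemma Vpol_eq_SUP_run_cost: "Vpol S qt qx c x \<pi> = (SUP n. \<integral>\<^sup>+ h. exp_plus (run_cost \<pi> n h) \<partial>hlaw x \<pi> n)"
proof -
  interpret IT: Ionescu_Tulcea "CTker S qt qx x \<pi>" "Tc S"
    by (rule Ionescu_Tulcea_CTker[OF x \<pi>])
  have u: "(\<lambda>_. undefined) \<in> space (PiM {0..<0} (Tc S))"
    by (simp add: space_PiM)
  have restr: "(\<lambda>\<omega>. restrict \<omega> {0..<Suc n}) \<in> IT.PF.lim \<rightarrow>\<^sub>M HM n" for n
    by (auto simp: measurable_cong_sets[OF IT.PF.sets_lim] intro!: measurable_restrict_subset)
  have rc: "(\<lambda>\<omega>. exp_plus (run_cost \<pi> n \<omega>)) \<in> borel_measurable IT.PF.lim" for n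
    using measurable_compose[OF measurable_compose[OF restr measurable_run_cost[OF \<pi>]] measurable_exp_plus]
    by (simp add: run_cost_restrict)
  have inc: "incseq (\<lambda>n. run_cost \<pi> n \<omega>)" for \<omega>
    by (intro incseq_SucI) (simp add: run_cost_def)
  have "Vpol S qt qx c x \<pi> = (\<integral>\<^sup>+ \<omega>. (SUP n. exp_plus (run_cost \<pi> n \<omega>)) \<partial>IT.PF.lim)"
    unfolding Vpol_def Ppol_def totcost_eq by (simp add: exp_plus_SUP[OF inc])
  also have "\<dots> = (SUP n. \<integral>\<^sup>+ \<omega>. exp_plus (run_cost \<pi> n \<omega>) \<partial>IT.PF.lim)"
    using inc by (intro nn_integral_monotone_convergence_SUP rc)
      (auto simp: incseq_def le_fun_def intro: exp_plus_mono)
  also have "\<dots> = (SUP n. \<integral>\<^sup>+ h. exp_plus (run_cost \<pi> n h) \<partial>hlaw x \<pi> n)"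
  proof (intro SUP_cong refl)
    fix n
    have "(\<integral>\<^sup>+ \<omega>. exp_plus (run_cost \<pi> n (restrict \<omega> {0..<Suc n})) \<partial>IT.PF.lim) = (\<integral>\<^sup>+ h. exp_plus (run_cost \<pi> n h) \<partial>hlaw x \<pi> n)"
      unfolding hlaw_def
      by (rule IT.nn_integral_lim_restrict) (rule measurable_compose[OF measurable_run_cost[OF \<pi>] measurable_exp_plus])
    then show "(\<integral>\<^sup>+ \<omega>. exp_plus (run_cost \<pi> n \<omega>) \<partial>IT.PF.lim) = (\<integral>\<^sup>+ h. exp_plus (run_cost \<pi> n h) \<partial>hlaw x \<pi> n)"
      by (simp only: run_cost_restrict)
  qed
  finally show "Vpol S qt qx c x \<pi> = (SUP n. \<integral>\<^sup>+ h. exp_plus (run_cost \<pi> n h) \<partial>hlaw x \<pi> n)" .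
qed

end

lemma space_hlaw: "x \<in> S \<Longrightarrow> is_policy \<pi> \<Longrightarrow> space (hlaw x \<pi> n) = space (HM n)"
  using sets_eq_imp_space_eq[OF sets_hlaw] by blast

text \<open>The first \<open>n\<close> stages are paid for forwards, everything beyond enters
  through \<open>g\<close>. This separates the law of the past, under which measurable choices are
  made, from the continuation value.\<close>

definition fwd :: "'s \<Rightarrow> (nat \<Rightarrow> (nat \<Rightarrow> ennreal \<times> 's option) \<Rightarrow> real \<Rightarrow> 'a measure) \<Rightarrow> nat
    \<Rightarrow> ((nat \<Rightarrow> ennreal \<times> 's option) \<Rightarrow> ennreal) \<Rightarrow> ennreal" where
  "fwd x \<pi> n g = (\<integral>\<^sup>+ h. exp_plus (run_cost \<pi> n h) * g h \<partial>hlaw x \<pi> n)"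

lemma fwd_0:
  assumes "x \<in> S" "is_policy \<pi>" "g \<in> borel_measurable (HM 0)"
  shows "fwd x \<pi> 0 g = g (hist0 x)"
  unfolding fwd_def using assms by (simp add: run_cost_def nn_integral_hlaw_0)

lemma fwd_Suc:
  assumes x: "x \<in> S" and \<pi>: "is_policy \<pi>" and g: "g \<in> borel_measurable (HM (Suc n))"
  shows "fwd x \<pi> (Suc n) g = fwd x \<pi> n (\<lambda>h. step (h n) (\<pi> n h) (\<lambda>z. g (h(Suc n := z))))"
proof -
  have "(\<lambda>h. exp_plus (run_cost \<pi> (Suc n) h) * g h) \<in> borel_measurable (HM (Suc n))"
    using g measurable_compose[OF measurable_run_cost[OF \<pi>] measurable_exp_plus]
    by (intro borel_measurable_times_ennreal)
  then have "fwd x \<pi> (Suc n) g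
      = (\<integral>\<^sup>+ h. \<integral>\<^sup>+ z. exp_plus (run_cost \<pi> (Suc n) (h(Suc n := z))) * g (h(Suc n := z)) \<partial>pker S qt qx (h n) (\<pi> n h) \<partial>hlaw x \<pi> n)"
    unfolding fwd_def by (rule nn_integral_hlaw_Suc[OF x \<pi>])
  also have "\<dots> = fwd x \<pi> n (\<lambda>h. step (h n) (\<pi> n h) (\<lambda>z. g (h(Suc n := z))))"
    unfolding fwd_def
  proof (intro nn_integral_cong)
    fix h assume "h \<in> space (hlaw x \<pi> n)"
    then have h: "h \<in> space (HM n)" by (simp add: space_hlaw[OF x \<pi>])
    have "(\<lambda>z. h(Suc n := z)) \<in> XM S \<rightarrow>\<^sub>M HM (Suc n)"
      using h by (intro measurable_HM_upd) auto
    from measurable_compose[OF this g] have gm: "(\<lambda>z. g (h(Suc n := z))) \<in> borel_measurable (XM S)" .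
    have "(\<integral>\<^sup>+ z. exp_plus (run_cost \<pi> (Suc n) (h(Suc n := z))) * g (h(Suc n := z)) \<partial>pker S qt qx (h n) (\<pi> n h))
       = (\<integral>\<^sup>+ z. exp_plus (run_cost \<pi> n h) * (exp_plus (lcost c (h n) (\<pi> n h) z) * g (h(Suc n := z))) \<partial>pker S qt qx (h n) (\<pi> n h))"
      by (simp only: run_cost_Suc[OF h] exp_plus_add mult.assoc)
    also have "\<dots> = exp_plus (run_cost \<pi> n h) * step (h n) (\<pi> n h) (\<lambda>z. g (h(Suc n := z)))"
      unfolding step_def
      using gm measurable_exp_lcost[OF HM_component_space(2)[OF h] is_policy_Rset[OF \<pi> h], of n]
      by (intro nn_integral_cmult) (simp add: borel_measurable_pker)
    finally show "(\<integral>\<^sup>+ z. exp_plus (run_cost \<pi> (Suc n) (h(Suc n := z))) * g (h(Suc n := z)) \<partial>pker S qt qx (h n) (\<pi> n h))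
       = exp_plus (run_cost \<pi> n h) * step (h n) (\<pi> n h) (\<lambda>z. g (h(Suc n := z)))" .
  qed
  finally show ?thesis .
qed

text \<open>Stages are transferred one at a time from the forward weight to the backward recursion;
  the number \<open>m\<close> of stages already transferred has to be free in the induction.\<close>

lemma fwd_add:
  assumes x: "x \<in> S" and \<pi>: "is_policy \<pi>"
  shows "fwd x \<pi> (k + n) (\<lambda>_. 1) = fwd x \<pi> k (Uval \<pi> n k)"
proof -
  have "fwd x \<pi> (k + n) (Uval \<pi> m (k + n)) = fwd x \<pi> k (Uval \<pi> (n + m) k)" for m
  proof (induction n arbitrary: m)
    case (Suc n)
    have "Uval \<pi> (Suc m) (k + n) = (\<lambda>h. step (h (k + n)) (\<pi> (k + n) h) (\<lambda>z. Uval \<pi> m (Suc (k + n)) (h(Suc (k + n) := z))))"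
      by (simp add: fun_eq_iff)
    then have "fwd x \<pi> (k + Suc n) (Uval \<pi> m (k + Suc n)) = fwd x \<pi> (k + n) (Uval \<pi> (Suc m) (k + n))"
      using fwd_Suc[OF x \<pi> measurable_Uval[OF \<pi>], of "k + n" m] by simp
    also have "\<dots> = fwd x \<pi> k (Uval \<pi> (n + Suc m) k)"
      by (rule Suc)
    finally show ?case by (simp del: Uval.simps)
  qed simp
  moreover have "Uval \<pi> 0 i = (\<lambda>_. 1)" for i
    by (simp add: fun_eq_iff)
  ultimately show ?thesis by (metis add.right_neutral)
qed

theorem Vpol_eq:
  assumes x: "x \<in> S" and \<pi>: "is_policy \<pi>"
  shows "Vpol S qt qx c x \<pi> = (SUP n. Uval \<pi> n 0 (hist0 x))"
proof -
  have "Vpol S qt qx c x \<pi> = (SUP n. fwd x \<pi> n (\<lambda>_. 1))"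
    using Vpol_eq_SUP_run_cost[OF x \<pi>] by (simp add: fwd_def)
  also have "\<dots> = (SUP n. Uval \<pi> n 0 (hist0 x))"
    using fwd_add[OF x \<pi>, of 0] fwd_0[OF x \<pi> measurable_Uval[OF \<pi>]] by simp
  finally show ?thesis .
qed

subsection \<open>Strategies of the embedded decision process\<close>

abbreviation DH :: "nat \<Rightarrow> (nat \<Rightarrow> (ennreal \<times> 's option) + (real \<Rightarrow> 'a measure)) measure" where
  "DH n \<equiv> PiM {0..<2 * n + 1} (Dc S A)"

lemma measurable_Dc_proj:
  shows "even i \<Longrightarrow> projl \<in> Dc S A i \<rightarrow>\<^sub>M XM S" "odd i \<Longrightarrow> projr \<in> Dc S A i \<rightarrow>\<^sub>M RM A"
  by (auto simp: Dc_def intro!: measurable_embed_measure1)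

lemma measurable_Dc_inj:
  shows "even i \<Longrightarrow> Inl \<in> XM S \<rightarrow>\<^sub>M Dc S A i" "odd i \<Longrightarrow> Inr \<in> RM A \<rightarrow>\<^sub>M Dc S A i"
  by (auto simp: Dc_def intro!: measurable_embed_measure2)

lemma space_Dc: "space (Dc S A i) = (if even i then Inl ` Xset S else Inr ` Rset A)"
  by (simp add: Dc_def space_embed_measure)

lemma measurable_DH_component:
  assumes f: "f \<in> Y \<rightarrow>\<^sub>M PiM J (Dc S A)" and i: "i \<in> J"
  shows "even i \<Longrightarrow> (\<lambda>y. projl (f y i)) \<in> Y \<rightarrow>\<^sub>M XM S" "odd i \<Longrightarrow> (\<lambda>y. projr (f y i)) \<in> Y \<rightarrow>\<^sub>M RM A"
proof -
  have *: "(\<lambda>y. f y i) \<in> Y \<rightarrow>\<^sub>M Dc S A i"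
    by (rule measurable_compose[OF f measurable_component_singleton[OF i]])
  show "even i \<Longrightarrow> (\<lambda>y. projl (f y i)) \<in> Y \<rightarrow>\<^sub>M XM S" "odd i \<Longrightarrow> (\<lambda>y. projr (f y i)) \<in> Y \<rightarrow>\<^sub>M RM A"
    by (rule measurable_compose[OF * measurable_Dc_proj(1)], assumption)
       (rule measurable_compose[OF * measurable_Dc_proj(2)], assumption)
qed

definition dupd :: "nat \<Rightarrow> (nat \<Rightarrow> (ennreal \<times> 's option) + (real \<Rightarrow> 'a measure)) \<Rightarrow> (real \<Rightarrow> 'a measure)
    \<Rightarrow> ennreal \<times> 's option \<Rightarrow> nat \<Rightarrow> (ennreal \<times> 's option) + (real \<Rightarrow> 'a measure)" where
  "dupd n H \<rho> z = H(2 * n + 1 := Inr \<rho>, 2 * n + 2 := Inl z)"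

lemma measurable_dupd:
  assumes H: "H \<in> Y \<rightarrow>\<^sub>M DH n" and \<rho>: "\<rho> \<in> Y \<rightarrow>\<^sub>M RM A" and z: "z \<in> Y \<rightarrow>\<^sub>M XM S"
  shows "(\<lambda>y. dupd n (H y) (\<rho> y) (z y)) \<in> Y \<rightarrow>\<^sub>M DH (Suc n)"
proof -
  have "(\<lambda>y. (H y)(2 * n + 1 := Inr (\<rho> y))) \<in> Y \<rightarrow>\<^sub>M PiM {0..<2 * n + 2} (Dc S A)"
    by (rule measurable_fun_upd[OF _ H]) (auto intro: measurable_compose[OF \<rho> measurable_Dc_inj(2)])
  then show ?thesis
    unfolding dupd_def
    by (rule measurable_fun_upd[rotated]) (auto intro: measurable_compose[OF z measurable_Dc_inj(1)])
qed

lemma dupd_space: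
  assumes "H \<in> space (DH n)" "\<rho> \<in> Rset A" "z \<in> Xset S"
  shows "dupd n H \<rho> z \<in> space (DH (Suc n))"
proof -
  have "dupd n H \<rho> \<in> XM S \<rightarrow>\<^sub>M DH (Suc n)"
    using assms by (intro measurable_dupd measurable_const measurable_ident_sets[OF refl]) simp_all
  from measurable_space[OF this, of z] assms(3) show ?thesis by simp
qed

lemma strategiesD: "\<sigma> \<in> strategies S A \<Longrightarrow> \<sigma> n \<in> DH n \<rightarrow>\<^sub>M prob_algebra (RM A)"
  by (simp add: strategies_def)

lemma strategy_kernel:
  assumes "\<sigma> \<in> strategies S A" "H \<in> space (DH n)"
  shows "prob_space (\<sigma> n H)" "sets (\<sigma> n H) = sets (RM A)" "space (\<sigma> n H) = Rset A"
    "borel_measurable (\<sigma> n H) = borel_measurable (RM A)"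
proof -
  show 1: "prob_space (\<sigma> n H)" and 2: "sets (\<sigma> n H) = sets (RM A)"
    using measurable_space[OF strategiesD[OF assms(1)] assms(2)] by (auto simp: space_prob_algebra)
  show "space (\<sigma> n H) = Rset A" "borel_measurable (\<sigma> n H) = borel_measurable (RM A)"
    using sets_eq_imp_space_eq[OF 2] measurable_cong_sets[OF 2 refl] by simp_all
qed

lemma DH_component_space:
  assumes "H \<in> space (DH n)" "k \<le> n"
  shows "projl (H (2 * k)) \<in> Xset S" "snd (projl (H (2 * k))) \<in> space (optM S)"
proof -
  have "H (2 * k) \<in> space (Dc S A (2 * k))"
    using assms by (auto simp: space_PiM)
  then show *: "projl (H (2 * k)) \<in> Xset S"
    by (auto simp: space_Dc)
  show "snd (projl (H (2 * k))) \<in> space (optM S)"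
    using measurable_space[OF measurable_snd_XM, of "projl (H (2 * k))"] * by simp
qed

text \<open>The counterpart of \<open>Uval\<close> for a strategy: \<open>m\<close> stages remain
  and \<open>n\<close> is the position, with the action of each stage drawn at random first.\<close>

primrec Wval :: "(nat \<Rightarrow> (nat \<Rightarrow> (ennreal \<times> 's option) + (real \<Rightarrow> 'a measure)) \<Rightarrow> (real \<Rightarrow> 'a measure) measure)
    \<Rightarrow> nat \<Rightarrow> nat \<Rightarrow> (nat \<Rightarrow> (ennreal \<times> 's option) + (real \<Rightarrow> 'a measure)) \<Rightarrow> ennreal" where
  "Wval \<sigma> 0 n H = 1"
| "Wval \<sigma> (Suc m) n H = (\<integral>\<^sup>+ \<rho>. step (projl (H (2 * n))) \<rho> (\<lambda>z. Wval \<sigma> m (Suc n) (dupd n H \<rho> z)) \<partial>\<sigma> n H)"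

lemma measurable_step_dupd:
  assumes g: "g \<in> borel_measurable (DH (Suc n))" and H: "H \<in> Y \<rightarrow>\<^sub>M DH n" and \<rho>: "\<rho> \<in> Y \<rightarrow>\<^sub>M RM A"
    and w: "(\<lambda>y. snd (w y)) \<in> Y \<rightarrow>\<^sub>M optM S"
  shows "(\<lambda>y. step (w y) (\<rho> y) (\<lambda>z. g (dupd n (H y) (\<rho> y) z))) \<in> borel_measurable Y"
proof (rule measurable_step[OF _ w \<rho>])
  show "(\<lambda>(y, z). g (dupd n (H y) (\<rho> y) z)) \<in> borel_measurable (Y \<Otimes>\<^sub>M XM S)"
    unfolding case_prod_unfold
    by (rule measurable_compose[OF measurable_dupd g])
       (rule measurable_compose[OF measurable_fst H] measurable_compose[OF measurable_fst \<rho>] measurable_snd)+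
qed

lemma measurable_step_dupd_pair:
  assumes g: "g \<in> borel_measurable (DH (Suc n))"
  shows "(\<lambda>(H, \<rho>). step (projl (H (2 * n))) \<rho> (\<lambda>z. g (dupd n H \<rho> z))) \<in> borel_measurable (DH n \<Otimes>\<^sub>M RM A)"
  unfolding case_prod_unfold
  by (rule measurable_step_dupd[OF g])
     (auto intro!: measurable_compose[OF measurable_DH_component(1)[OF measurable_fst] measurable_snd_XM])

lemma measurable_Wval:
  assumes \<sigma>: "\<sigma> \<in> strategies S A"
  shows "Wval \<sigma> m n \<in> borel_measurable (DH n)"
proof (induction m arbitrary: n)
  case (Suc m)
  have "(\<lambda>H. \<integral>\<^sup>+ \<rho>. step (projl (H (2 * n))) \<rho> (\<lambda>z. Wval \<sigma> m (Suc n) (dupd n H \<rho> z)) \<partial>\<sigma> n H) \<in> borel_measurable (DH n)"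
    by (rule nn_integral_measurable_subprob_algebra2[OF measurable_step_dupd_pair[OF Suc]])
       (rule measurable_prob_algebraD[OF strategiesD[OF \<sigma>]])
  then show ?case by simp
next
  case 0
  have "Wval \<sigma> 0 n = (\<lambda>_. 1)"
    by (simp add: fun_eq_iff)
  then show ?case by simp
qed

definition dcost :: "nat \<Rightarrow> (nat \<Rightarrow> (ennreal \<times> 's option) + (real \<Rightarrow> 'a measure)) \<Rightarrow> ennreal" where
  "dcost n \<omega> = (\<Sum>k<n. lcost c (projl (\<omega> (2 * k))) (projr (\<omega> (2 * k + 1))) (projl (\<omega> (2 * k + 2))))"

lemma dcost_restrict: "dcost n (restrict \<omega> {0..<2 * n + 1}) = dcost n \<omega>"
  unfolding dcost_def by (intro sum.cong) auto

lemma measurable_dcost: "dcost n \<in> borel_measurable (DH n)"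
  unfolding dcost_def
proof (rule borel_measurable_sum)
  fix k assume k: "k \<in> {..<n}"
  note comp = measurable_DH_component[OF measurable_ident_sets[OF refl]]
  show "(\<lambda>H. lcost c (projl (H (2 * k))) (projr (H (2 * k + 1))) (projl (H (2 * k + 2)))) \<in> borel_measurable (DH n)"
    using k by (intro measurable_lcost measurable_compose[OF comp(1) measurable_snd_XM] measurable_compose[OF comp(1) measurable_fst_XM] comp(2)) auto
qed

lemma dcost_Suc: "dcost (Suc n) (dupd n H \<rho> z) = dcost n H + lcost c (projl (H (2 * n))) \<rho> z"
proof -
  have "dcost n (dupd n H \<rho> z) = dcost n H"
    unfolding dcost_def by (intro sum.cong) (auto simp: dupd_def)
  moreover have "dupd n H \<rho> z (2 * n) = H (2 * n)" "dupd n H \<rho> z (2 * n + 1) = Inr \<rho>" "dupd n H \<rho> z (2 * n + 2) = Inl z"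
    by (simp_all add: dupd_def)
  ultimately show ?thesis
    by (simp add: dcost_def)
qed

definition dinit :: "ennreal \<times> 's option \<Rightarrow> nat \<Rightarrow> (ennreal \<times> 's option) + (real \<Rightarrow> 'a measure)" where
  "dinit z = (\<lambda>_. undefined)(0 := Inl z)"

lemma dinit_space: "z \<in> Xset S \<Longrightarrow> dinit z \<in> space (DH 0)"
  by (auto simp: dinit_def space_PiM PiE_iff extensional_def space_Dc)

lemma Ionescu_Tulcea_DTker:
  assumes z: "z \<in> Xset S" and \<sigma>: "\<sigma> \<in> strategies S A"
  shows "Ionescu_Tulcea (DTker S A qt qx z \<sigma>) (Dc S A)"
proof -
  have *: "DTker S A qt qx z \<sigma> i \<in> PiM {0..<i} (Dc S A) \<rightarrow>\<^sub>M prob_algebra (Dc S A i)" for i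
  proof -
    have "i = 0 \<or> (\<exists>n. i = 2 * n + 1) \<or> (\<exists>n. i = 2 * n + 2)"
      by presburger
    then consider "i = 0" | n where "i = 2 * n + 1" | n where "i = 2 * n + 2"
      by blast
    then show ?thesis
    proof cases
      case 1
      have "(\<lambda>_. return (Dc S A 0) (Inl z)) \<in> PiM {0..<0} (Dc S A) \<rightarrow>\<^sub>M prob_algebra (Dc S A 0)"
        using z by (intro measurable_const) (auto simp: space_prob_algebra space_Dc intro!: prob_space_return)
      then show ?thesis
        by (simp add: 1 DTker_def[abs_def])
    next
      case 2
      have "(\<lambda>h. distr (\<sigma> n h) (Dc S A i) Inr) \<in> DH n \<rightarrow>\<^sub>M prob_algebra (Dc S A i)"
        by (rule measurable_compose[OF strategiesD[OF \<sigma>] measurable_distr_prob_space])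
           (simp add: 2 measurable_Dc_inj)
      then show ?thesis
        by (simp add: 2 DTker_def[abs_def])
    next
      case 3
      note comp = measurable_DH_component[OF measurable_ident_sets[OF refl, of "PiM {0..<i} (Dc S A)"]]
      have "(\<lambda>h. pker S qt qx (projl (h (2 * n))) (projr (h (2 * n + 1)))) \<in> PiM {0..<i} (Dc S A) \<rightarrow>\<^sub>M prob_algebra (XM S)"
        by (intro measurable_pker measurable_compose[OF comp(1) measurable_snd_XM] comp(2)) (auto simp: 3)
      then have "(\<lambda>h. distr (pker S qt qx (projl (h (2 * n))) (projr (h (2 * n + 1)))) (Dc S A i) Inl)
          \<in> PiM {0..<i} (Dc S A) \<rightarrow>\<^sub>M prob_algebra (Dc S A i)"
        by (rule measurable_compose[OF _ measurable_distr_prob_space]) (simp add: 3 measurable_Dc_inj)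
      then show ?thesis
        by (simp add: 3 DTker_def[abs_def])
    qed
  qed
  show ?thesis
  proof (rule Ionescu_Tulcea.intro)
    show "DTker S A qt qx z \<sigma> i \<in> PiM {0..<i} (Dc S A) \<rightarrow>\<^sub>M subprob_algebra (Dc S A i)" for i
      by (rule measurable_prob_algebraD[OF *])
    show "prob_space (DTker S A qt qx z \<sigma> i h)" if "h \<in> space (PiM {0..<i} (Dc S A))" for i h
      using measurable_space[OF * that] by (simp add: space_prob_algebra)
  qed
qed

context
  fixes z \<sigma>
  assumes z: "z \<in> Xset S" and \<sigma>: "\<sigma> \<in> strategies S A"
begin

interpretation IT: Ionescu_Tulcea "DTker S A qt qx z \<sigma>" "Dc S A"
  by (rule Ionescu_Tulcea_DTker[OF z \<sigma>])

definition dlaw :: "nat \<Rightarrow> (nat \<Rightarrow> (ennreal \<times> 's option) + (real \<Rightarrow> 'a measure)) measure" where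
  "dlaw n = IT.C 0 (2 * n + 1) (\<lambda>_. undefined)"

definition dfwd :: "nat \<Rightarrow> ((nat \<Rightarrow> (ennreal \<times> 's option) + (real \<Rightarrow> 'a measure)) \<Rightarrow> ennreal) \<Rightarrow> ennreal" where
  "dfwd n g = (\<integral>\<^sup>+ H. exp_plus (dcost n H) * g H \<partial>dlaw n)"

lemma undefined_space: "(\<lambda>_. undefined) \<in> space (PiM {0..<0} (Dc S A))"
  by (simp add: space_PiM)

lemma space_dlaw: "space (dlaw n) = space (DH n)"
  unfolding dlaw_def using IT.space_C[OF undefined_space, of "2 * n + 1"] by simp

lemma dfwd_0:
  assumes g: "g \<in> borel_measurable (DH 0)"
  shows "dfwd 0 g = g (dinit z)"
proof -
  have gm: "g \<in> borel_measurable (PiM {0..<Suc 0} (Dc S A))"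
    using g by simp
  have gu: "(\<lambda>y. g ((\<lambda>_. undefined)(0 := y))) \<in> borel_measurable (Dc S A 0)"
    by (rule measurable_compose[OF measurable_fun_upd[where J="{}"] gm]) (auto intro!: measurable_const simp: space_PiM)
  have "dfwd 0 g = (\<integral>\<^sup>+ h. g h \<partial>IT.C 0 (Suc 0) (\<lambda>_. undefined))"
    by (simp add: dfwd_def dlaw_def dcost_def del: IT.C.simps)
  also have "\<dots> = (\<integral>\<^sup>+ h. \<integral>\<^sup>+ y. g (h(0 := y)) \<partial>DTker S A qt qx z \<sigma> 0 h \<partial>return (PiM {0..<0} (Dc S A)) (\<lambda>_. undefined))"
    by (subst IT.nn_integral_C_Suc[OF gm]) simp
  also have "\<dots> = (\<integral>\<^sup>+ h. g (dinit z) \<partial>return (PiM {0..<0} (Dc S A)) (\<lambda>_. undefined))"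
    using gu z by (intro nn_integral_cong) (auto simp: DTker_def space_PiM dinit_def nn_integral_return space_Dc)
  finally show ?thesis
    using undefined_space by (simp add: nn_integral_return)
qed

text \<open>One stage consists of two Ionescu-Tulcea extensions, first the action and then the
  state, so the measure is unfolded twice; \<open>f'\<close> is what is left after the state has
  been integrated out.\<close>

lemma dfwd_Suc:
  assumes g: "g \<in> borel_measurable (DH (Suc n))"
  shows "dfwd (Suc n) g = dfwd n (\<lambda>H. \<integral>\<^sup>+ \<rho>. step (projl (H (2 * n))) \<rho> (\<lambda>z. g (dupd n H \<rho> z)) \<partial>\<sigma> n H)"
proof -
  define f where "f H = exp_plus (dcost (Suc n) H) * g H" for H
  have f: "f \<in> borel_measurable (DH (Suc n))"
    unfolding f_def using g measurable_compose[OF measurable_dcost measurable_exp_plus]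
    by (intro borel_measurable_times_ennreal)
  then have f1: "f \<in> borel_measurable (PiM {0..<Suc (2 * n + 2)} (Dc S A))"
    by simp
  define f' where "f' h = (\<integral>\<^sup>+ y. f (h(2 * n + 2 := y)) \<partial>DTker S A qt qx z \<sigma> (2 * n + 2) h)" for h
  have f': "f' \<in> borel_measurable (PiM {0..<Suc (2 * n + 1)} (Dc S A))"
    unfolding f'_def
  proof (rule nn_integral_measurable_subprob_algebra2)
    have "(\<lambda>p. (fst p)(2 * n + 2 := snd p)) \<in> PiM {0..<Suc (2 * n + 1)} (Dc S A) \<Otimes>\<^sub>M Dc S A (2 * n + 2) \<rightarrow>\<^sub>M PiM {0..<Suc (2 * n + 2)} (Dc S A)"
      by (rule measurable_fun_upd[OF _ measurable_fst measurable_snd]) auto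
    from measurable_compose[OF this f1]
    show "(\<lambda>(h, y). f (h(2 * n + 2 := y))) \<in> borel_measurable (PiM {0..<Suc (2 * n + 1)} (Dc S A) \<Otimes>\<^sub>M Dc S A (2 * n + 2))"
      by (simp add: case_prod_unfold)
    show "DTker S A qt qx z \<sigma> (2 * n + 2) \<in> PiM {0..<Suc (2 * n + 1)} (Dc S A) \<rightarrow>\<^sub>M subprob_algebra (Dc S A (2 * n + 2))"
      using IT.P[of "2 * n + 2"] by simp
  qed
  have "dfwd (Suc n) g = (\<integral>\<^sup>+ H. f H \<partial>IT.C 0 (Suc (2 * n + 2)) (\<lambda>_. undefined))"
    by (simp add: dfwd_def dlaw_def f_def del: IT.C.simps)
  also have "\<dots> = (\<integral>\<^sup>+ h. f' h \<partial>IT.C 0 (Suc (2 * n + 1)) (\<lambda>_. undefined))"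
    unfolding f'_def by (subst IT.nn_integral_C_Suc[OF f1]) (simp del: IT.C.simps)
  also have "\<dots> = (\<integral>\<^sup>+ h. \<integral>\<^sup>+ y. f' (h(2 * n + 1 := y)) \<partial>DTker S A qt qx z \<sigma> (2 * n + 1) h \<partial>dlaw n)"
    unfolding dlaw_def by (rule IT.nn_integral_C_Suc[OF f'])
  also have "\<dots> = dfwd n (\<lambda>H. \<integral>\<^sup>+ \<rho>. step (projl (H (2 * n))) \<rho> (\<lambda>z. g (dupd n H \<rho> z)) \<partial>\<sigma> n H)"
    unfolding dfwd_def
  proof (intro nn_integral_cong)
    fix H assume "H \<in> space (dlaw n)"
    then have H: "H \<in> space (DH n)" by (simp add: space_dlaw)
    note sk = strategy_kernel[OF \<sigma> H]
    have H1: "(\<lambda>y. H(2 * n + 1 := y)) \<in> Dc S A (2 * n + 1) \<rightarrow>\<^sub>M PiM {0..<Suc (2 * n + 1)} (Dc S A)"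
      using H by (intro measurable_fun_upd[where J="{0..<2 * n + 1}"]) auto
    have f'H: "f' (H(2 * n + 1 := Inr \<rho>)) = exp_plus (dcost n H) * step (projl (H (2 * n))) \<rho> (\<lambda>z. g (dupd n H \<rho> z))"
      if \<rho>: "\<rho> \<in> Rset A" for \<rho>
    proof -
      let ?K = "pker S qt qx (projl (H (2 * n))) \<rho>"
      have fm: "(\<lambda>y. f (H(2 * n + 1 := Inr \<rho>, 2 * n + 2 := y))) \<in> borel_measurable (Dc S A (2 * n + 2))"
      proof -
        have "H(2 * n + 1 := Inr \<rho>) \<in> space (PiM {0..<Suc (2 * n + 1)} (Dc S A))"
          using \<rho> by (intro measurable_space[OF H1]) (simp add: space_Dc)
        then have "(\<lambda>y. (H(2 * n + 1 := Inr \<rho>))(2 * n + 2 := y)) \<in> Dc S A (2 * n + 2) \<rightarrow>\<^sub>M PiM {0..<Suc (2 * n + 2)} (Dc S A)"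
          by (rule measurable_fun_upd[OF _ measurable_const measurable_ident_sets[OF refl], rotated]) auto
        from measurable_compose[OF this f1] show ?thesis .
      qed
      have "f' (H(2 * n + 1 := Inr \<rho>)) = (\<integral>\<^sup>+ y. f (H(2 * n + 1 := Inr \<rho>, 2 * n + 2 := y)) \<partial>distr ?K (Dc S A (2 * n + 2)) Inl)"
        by (simp add: f'_def DTker_def)
      also have "\<dots> = (\<integral>\<^sup>+ z. f (dupd n H \<rho> z) \<partial>?K)"
        unfolding dupd_def using fm
        by (subst nn_integral_distr) (auto simp: measurable_cong_sets[OF sets_pker refl] measurable_Dc_inj)
      also have "\<dots> = (\<integral>\<^sup>+ z. exp_plus (dcost n H) * (exp_plus (lcost c (projl (H (2 * n))) \<rho> z) * g (dupd n H \<rho> z)) \<partial>?K)"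
        unfolding f_def by (simp only: dcost_Suc exp_plus_add mult.assoc)
      also have "\<dots> = exp_plus (dcost n H) * step (projl (H (2 * n))) \<rho> (\<lambda>z. g (dupd n H \<rho> z))"
        unfolding step_def
      proof (rule nn_integral_cmult)
        have "(\<lambda>z. g (dupd n H \<rho> z)) \<in> borel_measurable (XM S)"
          using H \<rho> by (intro measurable_compose[OF measurable_dupd g]) auto
        then show "(\<lambda>z. exp_plus (lcost c (projl (H (2 * n))) \<rho> z) * g (dupd n H \<rho> z)) \<in> borel_measurable ?K"
          unfolding borel_measurable_pker
          by (intro borel_measurable_times_ennreal measurable_exp_lcost \<rho> DH_component_space(2)[OF H]) auto
      qed
      finally show ?thesis .
    qed
    have "(\<integral>\<^sup>+ y. f' (H(2 * n + 1 := y)) \<partial>DTker S A qt qx z \<sigma> (2 * n + 1) H)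
        = (\<integral>\<^sup>+ y. f' (H(2 * n + 1 := y)) \<partial>distr (\<sigma> n H) (Dc S A (2 * n + 1)) Inr)"
      by (simp add: DTker_def)
    also have "\<dots> = (\<integral>\<^sup>+ \<rho>. f' (H(2 * n + 1 := Inr \<rho>)) \<partial>\<sigma> n H)"
    proof (rule nn_integral_distr)
      show "Inr \<in> \<sigma> n H \<rightarrow>\<^sub>M Dc S A (2 * n + 1)"
        using measurable_Dc_inj(2)[of "2 * n + 1"] by (simp add: measurable_cong_sets[OF sk(2) refl])
      show "(\<lambda>y. f' (H(2 * n + 1 := y))) \<in> borel_measurable (distr (\<sigma> n H) (Dc S A (2 * n + 1)) Inr)"
        unfolding measurable_distr_eq1 by (rule measurable_compose[OF H1 f'])
    qed
    also have "\<dots> = (\<integral>\<^sup>+ \<rho>. exp_plus (dcost n H) * step (projl (H (2 * n))) \<rho> (\<lambda>z. g (dupd n H \<rho> z)) \<partial>\<sigma> n H)"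
      by (intro nn_integral_cong f'H) (simp add: sk)
    also have "\<dots> = exp_plus (dcost n H) * (\<integral>\<^sup>+ \<rho>. step (projl (H (2 * n))) \<rho> (\<lambda>z. g (dupd n H \<rho> z)) \<partial>\<sigma> n H)"
      using measurable_Pair2[OF measurable_step_dupd_pair[OF g] H]
      by (intro nn_integral_cmult) (simp add: sk)
    finally show "(\<integral>\<^sup>+ y. f' (H(2 * n + 1 := y)) \<partial>DTker S A qt qx z \<sigma> (2 * n + 1) H)
        = exp_plus (dcost n H) * (\<integral>\<^sup>+ \<rho>. step (projl (H (2 * n))) \<rho> (\<lambda>z. g (dupd n H \<rho> z)) \<partial>\<sigma> n H)" .
  qed
  finally show ?thesis .
qed

lemma dfwd_Wval: "dfwd n (Wval \<sigma> m n) = Wval \<sigma> (n + m) 0 (dinit z)"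
proof (induction n arbitrary: m)
  case 0
  then show ?case
    using dfwd_0[OF measurable_Wval[OF \<sigma>]] by simp
next
  case (Suc n)
  have "Wval \<sigma> (Suc m) n = (\<lambda>H. \<integral>\<^sup>+ \<rho>. step (projl (H (2 * n))) \<rho> (\<lambda>z. Wval \<sigma> m (Suc n) (dupd n H \<rho> z)) \<partial>\<sigma> n H)"
    by (simp add: fun_eq_iff)
  then have "dfwd (Suc n) (Wval \<sigma> m (Suc n)) = dfwd n (Wval \<sigma> (Suc m) n)"
    using dfwd_Suc[OF measurable_Wval[OF \<sigma>], of n m] by simp
  then show ?case
    using Suc[of "Suc m"] by (simp del: Wval.simps)
qed

theorem Vstr_eq: "Vstr S A qt qx c z \<sigma> = (SUP n. Wval \<sigma> n 0 (dinit z))"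
proof -
  have restr: "(\<lambda>\<omega>. restrict \<omega> {0..<2 * n + 1}) \<in> IT.PF.lim \<rightarrow>\<^sub>M DH n" for n
    by (auto simp: measurable_cong_sets[OF IT.PF.sets_lim] intro!: measurable_restrict_subset)
  have dm: "(\<lambda>H. exp_plus (dcost n H)) \<in> borel_measurable (DH n)" for n
    by (rule measurable_compose[OF measurable_dcost measurable_exp_plus])
  have rc: "(\<lambda>\<omega>. exp_plus (dcost n \<omega>)) \<in> borel_measurable IT.PF.lim" for n
    using measurable_compose[OF restr dm] by (simp only: dcost_restrict)
  have inc: "incseq (\<lambda>n. dcost n \<omega>)" for \<omega>
    by (intro incseq_SucI) (simp add: dcost_def)
  have tot: "(\<Sum>n. lcost c (projl (\<omega> (2 * n))) (projr (\<omega> (2 * n + 1))) (projl (\<omega> (2 * n + 2)))) = (SUP n. dcost n \<omega>)" for \<omega>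
    unfolding dcost_def suminf_eq_SUP ..
  have "Vstr S A qt qx c z \<sigma> = (\<integral>\<^sup>+ \<omega>. (SUP n. exp_plus (dcost n \<omega>)) \<partial>IT.PF.lim)"
    unfolding Vstr_def Pstr_def tot by (simp add: exp_plus_SUP[OF inc])
  also have "\<dots> = (SUP n. \<integral>\<^sup>+ \<omega>. exp_plus (dcost n \<omega>) \<partial>IT.PF.lim)"
    using inc by (intro nn_integral_monotone_convergence_SUP rc)
      (auto simp: incseq_def le_fun_def intro: exp_plus_mono)
  also have "\<dots> = (SUP n. dfwd n (Wval \<sigma> 0 n))"
  proof (intro SUP_cong refl)
    fix n
    have "(\<integral>\<^sup>+ \<omega>. exp_plus (dcost n (restrict \<omega> {0..<2 * n + 1})) \<partial>IT.PF.lim) = (\<integral>\<^sup>+ h. exp_plus (dcost n h) \<partial>dlaw n)"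
      unfolding dlaw_def by (rule IT.nn_integral_lim_restrict[OF dm])
    then show "(\<integral>\<^sup>+ \<omega>. exp_plus (dcost n \<omega>) \<partial>IT.PF.lim) = dfwd n (Wval \<sigma> 0 n)"
      by (simp only: dcost_restrict) (simp add: dfwd_def)
  qed
  also have "\<dots> = (SUP n. Wval \<sigma> n 0 (dinit z))"
    by (simp only: dfwd_Wval add_0_right)
  finally show ?thesis .
qed

end

section \<open>Policies as strategies of the embedded process\<close>

lemma step_snd_cong: "snd w = snd w' \<Longrightarrow> step w \<rho> f = step w' \<rho> f"
  \<comment> \<open>Neither the kernel nor the stage cost reads the elapsed time in
    \<open>w\<close>; the independence of the value from the initial time rests on this.\<close>
  unfolding step_def lcost_def pker_def by simp

text \<open>Policies see the dummy time 0 at the start whereas the embedded process starts with an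
  arbitrary time, so coordinate 0 is rebuilt instead of copied.\<close>

definition states :: "nat \<Rightarrow> (nat \<Rightarrow> (ennreal \<times> 's option) + (real \<Rightarrow> 'a measure)) \<Rightarrow> nat \<Rightarrow> ennreal \<times> 's option" where
  "states n H = (\<lambda>i\<in>{0..<Suc n}. if i = 0 then (0, Some (default (snd (projl (H 0))))) else projl (H (2 * i)))"

lemma measurable_states: "states n \<in> DH n \<rightarrow>\<^sub>M HM n"
  unfolding states_def
proof (rule measurable_restrict)
  fix i assume i: "i \<in> {0..<Suc n}"
  note comp = measurable_DH_component[OF measurable_ident_sets[OF refl, of "DH n"]]
  show "(\<lambda>H. if i = 0 then (0, Some (default (snd (projl (H 0))))) else projl (H (2 * i))) \<in> DH n \<rightarrow>\<^sub>M Tc S i"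
  proof (cases i)
    case 0
    have [measurable]: "(\<lambda>H. snd (projl (H 0))) \<in> DH n \<rightarrow>\<^sub>M optM S"
      by (rule measurable_compose[OF comp(1) measurable_snd_XM]) auto
    have "(\<lambda>H. default (snd (projl (H 0)))) \<in> DH n \<rightarrow>\<^sub>M BM S"
      by measurable
    then have "(\<lambda>H. (0, Some (default (snd (projl (H 0)))))) \<in> DH n \<rightarrow>\<^sub>M Tc S 0"
      unfolding Tc_def using measurable_space[of "\<lambda>H. default (snd (projl (H 0)))" "DH n" "BM S"]
      by (auto intro!: measurable_restrict_space2)
    with 0 show ?thesis by simp
  next
    case (Suc j)
    with i comp(1)[of "2 * i"] show ?thesis by simp
  qed
qed

definition policy_strategy :: "(nat \<Rightarrow> (nat \<Rightarrow> ennreal \<times> 's option) \<Rightarrow> real \<Rightarrow> 'a measure)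
    \<Rightarrow> nat \<Rightarrow> (nat \<Rightarrow> (ennreal \<times> 's option) + (real \<Rightarrow> 'a measure)) \<Rightarrow> (real \<Rightarrow> 'a measure) measure" where
  "policy_strategy \<pi> n H = return (RM A) (\<pi> n (states n H))"

lemma policy_strategy: 
  assumes \<pi>: "is_policy \<pi>"
  shows "policy_strategy \<pi> \<in> strategies S A"
proof -
  have "policy_strategy \<pi> n \<in> DH n \<rightarrow>\<^sub>M prob_algebra (RM A)" for n
    unfolding policy_strategy_def
    by (rule measurable_compose[OF measurable_compose[OF measurable_states is_policyD[OF \<pi>]] measurable_return_prob_space])
  then show ?thesis by (simp add: strategies_def)
qed

lemma states_dupd: "states (Suc n) (dupd n H \<rho> z) = (states n H)(Suc n := z)"
  by (auto simp: states_def dupd_def fun_eq_iff restrict_def)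

text \<open>Drawing from a point mass changes nothing, so the two recursions agree stage by stage.
  The start must be a genuine state because \<open>states\<close> would replace the cemetery by a
  default.\<close>

lemma Wval_policy_strategy:
  assumes \<pi>: "is_policy \<pi>" and "H \<in> space (DH n)" "snd (projl (H 0)) \<noteq> None"
  shows "Wval (policy_strategy \<pi>) m n H = Uval \<pi> m n (states n H)"
  using assms(2,3)
proof (induction m arbitrary: n H)
  case (Suc m)
  note H = Suc.prems(1)
  let ?\<rho> = "\<pi> n (states n H)"
  have \<rho>: "?\<rho> \<in> Rset A"
    using measurable_space[OF measurable_states H] by (rule is_policy_Rset[OF \<pi>])
  have "Wval (policy_strategy \<pi>) (Suc m) n H = step (projl (H (2 * n))) ?\<rho> (\<lambda>z. Wval (policy_strategy \<pi>) m (Suc n) (dupd n H ?\<rho> z))"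
    using \<rho> measurable_Pair2[OF measurable_step_dupd_pair[OF measurable_Wval[OF policy_strategy[OF \<pi>]]] H]
    by (simp add: policy_strategy_def nn_integral_return)
  also have "\<dots> = step (projl (H (2 * n))) ?\<rho> (\<lambda>z. Uval \<pi> m (Suc n) ((states n H)(Suc n := z)))"
  proof (rule step_cong)
    fix z assume "z \<in> Xset S"
    then have "dupd n H ?\<rho> z \<in> space (DH (Suc n))"
      using \<rho> H by (intro dupd_space)
    moreover have "dupd n H ?\<rho> z 0 = H 0"
      by (simp add: dupd_def)
    ultimately have "Wval (policy_strategy \<pi>) m (Suc n) (dupd n H ?\<rho> z) = Uval \<pi> m (Suc n) (states (Suc n) (dupd n H ?\<rho> z))"
      using Suc.prems(2) by (intro Suc.IH) simp_all
    then show "Wval (policy_strategy \<pi>) m (Suc n) (dupd n H ?\<rho> z) = Uval \<pi> m (Suc n) ((states n H)(Suc n := z))"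
      by (simp only: states_dupd)
  qed
  also have "\<dots> = step (states n H n) ?\<rho> (\<lambda>z. Uval \<pi> m (Suc n) ((states n H)(Suc n := z)))"
    by (rule step_snd_cong) (use Suc.prems(2) in \<open>auto simp: states_def\<close>)
  finally show ?case by simp
qed simp

theorem Vbold_le_Vpol:
  assumes x: "x \<in> S" and \<theta>: "0 < \<theta>" and \<pi>: "is_policy \<pi>"
  shows "Vbold S A qt qx c (ennreal \<theta>, Some x) \<le> Vpol S qt qx c x \<pi>"
proof -
  let ?z = "(ennreal \<theta>, Some x)"
  have z: "?z \<in> Xset S"
    using x \<theta> by (auto simp: Xset_def)
  have "states 0 (dinit ?z) = hist0 x"
    by (auto simp: states_def dinit_def hist0_def fun_eq_iff restrict_def)
  then have "Vstr S A qt qx c ?z (policy_strategy \<pi>) = Vpol S qt qx c x \<pi>"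
    using Wval_policy_strategy[OF \<pi> dinit_space[OF z]]
    by (simp add: Vstr_eq[OF z policy_strategy[OF \<pi>]] Vpol_eq[OF x \<pi>] dinit_def)
  then show ?thesis
    unfolding Vbold_def using policy_strategy[OF \<pi>] by (metis INF_lower)
qed

end

section \<open>Derandomisation\<close>

instance prod :: (polish_space, polish_space) polish_space ..

text \<open>Otherwise the integral is finite, and the difference between \<open>f\<close> and its
  integral is strictly positive everywhere although its own integral is zero.\<close>

lemma (in prob_space) nn_integral_ge_point:
  assumes f: "f \<in> borel_measurable M"
  shows "\<exists>x\<in>space M. f x \<le> (\<integral>\<^sup>+ x. f x \<partial>M)"
proof (rule ccontr)
  let ?I = "\<integral>\<^sup>+ x. f x \<partial>M"
  assume "\<not> (\<exists>x\<in>space M. f x \<le> ?I)"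
  then have gt: "?I < f x" if "x \<in> space M" for x
    using that by (auto simp: not_le)
  obtain x0 where "x0 \<in> space M"
    using not_empty by blast
  then have fin: "?I < \<infinity>"
    using gt[of x0] by (auto simp: less_top[symmetric] top_unique)
  have "(\<integral>\<^sup>+ x. f x - ?I \<partial>M) = ?I - (\<integral>\<^sup>+ x. ?I \<partial>M)"
    using f fin gt by (intro nn_integral_diff) (auto simp: emeasure_space_1 less_imp_le)
  also have "\<dots> = 0"
    using fin by (simp add: emeasure_space_1 diff_eq_0_ennreal)
  finally have "AE x in M. f x - ?I = 0"
    using f by (subst (asm) nn_integral_0_iff_AE) auto
  then have "AE x in M. False"
    using AE_space
  proof eventually_elim
    case (elim x)
    then have "f x \<le> ?I"
      using fin by (simp add: ennreal_minus_eq_0 diff_eq_0_iff_ennreal)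
    with gt[of x] elim show ?case by simp
  qed
  then show False by simp
qed

context ctmdp
begin

definition relax :: "(nat \<Rightarrow> nat) \<Rightarrow> real \<Rightarrow> 'a measure" where
  "relax = (SOME \<Phi>. (\<lambda>(z, t). \<Phi> z t) \<in> baire \<Otimes>\<^sub>M borel \<rightarrow>\<^sub>M PA \<and>
     (\<forall>\<rho> \<in> Rset A. \<exists>z. AE t in lborel. 0 < t \<longrightarrow> \<Phi> z t = \<rho> t))"

lemma relax_measurable: "(\<lambda>(z, t). relax z t) \<in> baire \<Otimes>\<^sub>M borel \<rightarrow>\<^sub>M PA"
  and relax_surj: "\<rho> \<in> Rset A \<Longrightarrow> \<exists>z. AE t in lborel. 0 < t \<longrightarrow> relax z t = \<rho> t"
proof -
  obtain \<Phi> :: "(nat \<Rightarrow> nat) \<Rightarrow> real \<Rightarrow> 'a measure" where \<Phi>: "(\<lambda>(z, t). \<Phi> z t) \<in> baire \<Otimes>\<^sub>M borel \<rightarrow>\<^sub>M PA"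
    "\<And>\<rho>. \<rho> \<in> Rset A \<Longrightarrow> \<exists>z. AE t in lborel. 0 < t \<longrightarrow> \<Phi> z t = \<rho> t"
    using universal_relaxed_control[OF A_borel A_ne] by blast
  have "(\<lambda>(z, t). relax z t) \<in> baire \<Otimes>\<^sub>M borel \<rightarrow>\<^sub>M PA \<and>
     (\<forall>\<rho> \<in> Rset A. \<exists>z. AE t in lborel. 0 < t \<longrightarrow> relax z t = \<rho> t)"
    unfolding relax_def by (rule someI[of _ \<Phi>]) (use \<Phi> in blast)
  then show "(\<lambda>(z, t). relax z t) \<in> baire \<Otimes>\<^sub>M borel \<rightarrow>\<^sub>M PA"
    "\<rho> \<in> Rset A \<Longrightarrow> \<exists>z. AE t in lborel. 0 < t \<longrightarrow> relax z t = \<rho> t" by blast+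
qed

lemma measurable_relax_joint:
  assumes "f \<in> Y \<rightarrow>\<^sub>M baire"
  shows "(\<lambda>(y, t). relax (f y) t) \<in> Y \<Otimes>\<^sub>M pos \<rightarrow>\<^sub>M PA"
proof -
  have "(\<lambda>p. (f (fst p), snd p)) \<in> Y \<Otimes>\<^sub>M pos \<rightarrow>\<^sub>M baire \<Otimes>\<^sub>M borel"
    by (intro measurable_Pair measurable_compose[OF measurable_fst assms] measurable_compose[OF measurable_snd measurable_pos_ident(1)])
  from measurable_compose[OF this relax_measurable] show ?thesis
    by (simp add: case_prod_unfold)
qed

lemma measurable_relax: "relax \<in> baire \<rightarrow>\<^sub>M RM A"
  by (rule joint_measurable_RM[OF measurable_relax_joint]) simp

lemma relax_Rset: "relax z \<in> Rset A"
  using measurable_space[OF measurable_relax, of z] by simp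

text \<open>The theorem \<open>universal_AE\<close> needs a Polish domain, while histories live in a subspace of
  an extended space; they are therefore embedded into sequences of triples of a time, a state and a flag.\<close>
definition enc :: "nat \<Rightarrow> (nat \<Rightarrow> ennreal \<times> 's option) \<Rightarrow> nat \<Rightarrow> real \<times> 's \<times> real" where
  "enc n h i = (if i < Suc n then (enn2real (fst (h i)), default (snd (h i)), if snd (h i) = None then 0 else 1)
     else (0, default None, 0))"

text \<open>A left inverse of \<open>enc n\<close> on histories. Points that encode no history are
  repaired coordinatewise into legal entries, so that \<open>dec n\<close> maps the whole sequence
  space measurably into \<open>HM n\<close>.\<close>

definition dec :: "nat \<Rightarrow> (nat \<Rightarrow> real \<times> 's \<times> real) \<Rightarrow> nat \<Rightarrow> ennreal \<times> 's option" where
  "dec n p = (\<lambda>i\<in>{0..<Suc n}. case p i of (t, y, r) \<Rightarrow>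
     if i = 0 then (0, Some (if y \<in> S then y else default None))
     else if 0 < t \<and> y \<in> S \<and> r = 1 then (ennreal t, Some y) else (\<infinity>, None))"

lemma measurable_enc: "enc n \<in> HM n \<rightarrow>\<^sub>M borel"
  unfolding measurable_cong_sets[OF refl sets_PiM_equal_borel[symmetric]]
proof (rule measurable_PiM_single')
  fix i
  show "(\<lambda>h. enc n h i) \<in> HM n \<rightarrow>\<^sub>M borel"
  proof (cases "i < Suc n")
    case True
    note comp = measurable_HM_component[OF measurable_ident_sets[OF refl, of "HM n"], of i]
    have [measurable]: "(\<lambda>h. fst (h i)) \<in> borel_measurable (HM n)" "(\<lambda>h. snd (h i)) \<in> HM n \<rightarrow>\<^sub>M optM S"
      using comp True by simp_all
    have [measurable]: "(\<lambda>h. default (snd (h i))) \<in> HM n \<rightarrow>\<^sub>M borel"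
    proof -
      have "(\<lambda>h. default (snd (h i))) \<in> HM n \<rightarrow>\<^sub>M BM S"
        by measurable
      then show ?thesis
        unfolding measurable_restrict_space2_iff by simp
    qed
    have "(\<lambda>h. (enn2real (fst (h i)), default (snd (h i)), if snd (h i) = None then 0 else 1 :: real)) \<in> HM n \<rightarrow>\<^sub>M borel"
      by (intro borel_measurable_Pair) measurable
    with True show ?thesis by (simp add: enc_def)
  qed (simp add: enc_def)
qed simp

lemma measurable_dec: "dec n \<in> borel \<rightarrow>\<^sub>M HM n"
  unfolding dec_def
proof (rule measurable_restrict)
  fix i assume i: "i \<in> {0..<Suc n}"
  have pi: "(\<lambda>p. p i) \<in> (borel :: (nat \<Rightarrow> real \<times> 's \<times> real) measure) \<rightarrow>\<^sub>M borel"
    unfolding measurable_cong_sets[OF sets_PiM_equal_borel[symmetric] refl]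
    by (rule measurable_component_singleton) simp
  then have "(\<lambda>p. p i) \<in> (borel :: (nat \<Rightarrow> real \<times> 's \<times> real) measure) \<rightarrow>\<^sub>M borel \<Otimes>\<^sub>M borel \<Otimes>\<^sub>M borel"
    by (simp add: borel_prod)
  then have m [measurable]: "(\<lambda>p. fst (p i)) \<in> (borel :: (nat \<Rightarrow> real \<times> 's \<times> real) measure) \<rightarrow>\<^sub>M borel"
    "(\<lambda>p. fst (snd (p i))) \<in> (borel :: (nat \<Rightarrow> real \<times> 's \<times> real) measure) \<rightarrow>\<^sub>M borel"
    "(\<lambda>p. snd (snd (p i))) \<in> (borel :: (nat \<Rightarrow> real \<times> 's \<times> real) measure) \<rightarrow>\<^sub>M borel"
    by measurable
  note [measurable] = S_borel
  define y where "y p = (if fst (snd (p i)) \<in> S then fst (snd (p i)) else default None)" for p :: "nat \<Rightarrow> real \<times> 's \<times> real"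
  have "y \<in> borel \<rightarrow>\<^sub>M borel"
    unfolding y_def by measurable
  then have [measurable]: "y \<in> borel \<rightarrow>\<^sub>M BM S"
    by (rule measurable_restrict_space2[rotated]) (auto simp: y_def default_None)
  show "(\<lambda>p :: nat \<Rightarrow> real \<times> 's \<times> real. case p i of (t, y, r) \<Rightarrow> if i = 0 then (0, Some (if y \<in> S then y else default None))
     else if 0 < t \<and> y \<in> S \<and> r = 1 then (ennreal t, Some y) else (\<infinity>, None)) \<in> borel \<rightarrow>\<^sub>M Tc S i"
  proof (cases i)
    case 0
    have "y p \<in> S" for p
      by (simp add: y_def default_None)
    moreover have "(\<lambda>p. (0, Some (y p))) \<in> borel \<rightarrow>\<^sub>M borel \<Otimes>\<^sub>M optM S"
      by measurable
    ultimately have mm: "(\<lambda>p. (0, Some (y p))) \<in> borel \<rightarrow>\<^sub>M Tc S 0"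
      unfolding Tc_def by (auto intro!: measurable_restrict_space2)
    then show ?thesis
      unfolding y_def 0 by (simp add: case_prod_unfold)
  next
    case (Suc j)
    have "(\<lambda>p. if 0 < fst (p i) \<and> fst (snd (p i)) \<in> S \<and> snd (snd (p i)) = 1 then (ennreal (fst (p i)), Some (y p)) else (\<infinity>, None))
       \<in> borel \<rightarrow>\<^sub>M XM S"
      unfolding measurable_XM_iff
    proof
      have "(\<lambda>_. (\<infinity>, None)) \<in> (borel :: (nat \<Rightarrow> real \<times> 's \<times> real) measure) \<rightarrow>\<^sub>M borel \<Otimes>\<^sub>M optM S"
        by (intro measurable_const) (simp add: space_pair_measure)
      moreover have "(\<lambda>p. (ennreal (fst (p i)), Some (y p))) \<in> borel \<rightarrow>\<^sub>M borel \<Otimes>\<^sub>M optM S"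
        by measurable
      ultimately show "(\<lambda>p. if 0 < fst (p i) \<and> fst (snd (p i)) \<in> S \<and> snd (snd (p i)) = 1 then (ennreal (fst (p i)), Some (y p)) else (\<infinity>, None))
       \<in> borel \<rightarrow>\<^sub>M borel \<Otimes>\<^sub>M optM S"
        by (intro measurable_If) measurable
      have "(ennreal t, Some y') \<in> Xset S" if "0 < t" "y' \<in> S" for t y'
        using that by (auto simp: Xset_def)
      then show "(\<lambda>p. if 0 < fst (p i) \<and> fst (snd (p i)) \<in> S \<and> snd (snd (p i)) = 1 then (ennreal (fst (p i)), Some (y p)) else (\<infinity>, None))
       \<in> space borel \<rightarrow> Xset S"
        by (simp add: Pi_iff y_def)
    qed
    also have "(\<lambda>p. if 0 < fst (p i) \<and> fst (snd (p i)) \<in> S \<and> snd (snd (p i)) = 1 then (ennreal (fst (p i)), Some (y p)) else (\<infinity>, None))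
       = (\<lambda>p. case p i of (t, y, r) \<Rightarrow> if i = 0 then (0, Some (if y \<in> S then y else default None))
           else if 0 < t \<and> y \<in> S \<and> r = 1 then (ennreal t, Some y) else (\<infinity>, None))"
      using Suc by (auto simp: fun_eq_iff y_def case_prod_unfold)
    finally show ?thesis
      using Suc by simp
  qed
qed

lemma dec_enc:
  assumes h: "h \<in> space (HM n)"
  shows "dec n (enc n h) = h"
proof
  fix i
  show "dec n (enc n h) i = h i"
  proof (cases "i < Suc n")
    case True
    then have hi: "h i \<in> space (Tc S i)"
      using HM_component_space[OF h, of i] by simp
    show ?thesis
    proof (cases i)
      case 0
      with hi show ?thesis by (auto simp: dec_def enc_def)
    next
      case (Suc j)
      with hi have "h i \<in> Xset S" by simp
      with True Suc show ?thesis
        by (auto simp: dec_def enc_def Xset_def)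
    qed
  next
    case False
    with h show ?thesis
      by (auto simp: dec_def space_PiM PiE_iff extensional_def)
  qed
qed

text \<open>The decision rule of stage \<open>n\<close> is coded by the single point
  \<open>\<zeta> n\<close>, so that stages can be fixed one after another.\<close>

definition cpol :: "(nat \<Rightarrow> nat \<Rightarrow> nat) \<Rightarrow> nat \<Rightarrow> (nat \<Rightarrow> ennreal \<times> 's option) \<Rightarrow> real \<Rightarrow> 'a measure" where
  "cpol \<zeta> n h = relax (universal (\<zeta> n) (enc n h))"

lemma measurable_cpol_code:
  assumes "(\<lambda>y. f y n) \<in> Y \<rightarrow>\<^sub>M baire" "h \<in> Y \<rightarrow>\<^sub>M HM n"
  shows "(\<lambda>y. universal (f y n) (enc n (h y))) \<in> Y \<rightarrow>\<^sub>M baire"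
  by (rule measurable_universal[OF assms(1) measurable_compose[OF assms(2) measurable_enc]])

lemma cpol_policies: "cpol \<zeta> \<in> policies S A"
  unfolding policies_iff cpol_def
  by (intro allI measurable_relax_joint measurable_cpol_code) auto

lemma cpol_is_policy: "is_policy (cpol \<zeta>)"
  by (rule policies_is_policy[OF cpol_policies])

text \<open>The law and the cost of the first \<open>k\<close> stages involve only decisions before
  \<open>k\<close>; this lets the decision at \<open>k\<close> be altered without disturbing the
  past.\<close>

lemma fwd_cong:
  assumes x: "x \<in> S" and \<pi>: "is_policy \<pi>" "is_policy \<pi>'" and eq: "\<And>j. j < k \<Longrightarrow> \<pi> j = \<pi>' j"
    and g: "g \<in> borel_measurable (HM k)"
  shows "fwd x \<pi> k g = fwd x \<pi>' k g"
  using eq g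
proof (induction k arbitrary: g)
  case 0
  then show ?case
    using x \<pi> by (simp add: fwd_0)
next
  case (Suc k)
  have "(\<lambda>h. step (h k) (\<pi> k h) (\<lambda>z. g (h(Suc k := z)))) \<in> borel_measurable (HM k)"
  proof (rule measurable_step)
    show "(\<lambda>(h, z). g (h(Suc k := z))) \<in> borel_measurable (HM k \<Otimes>\<^sub>M XM S)"
      unfolding case_prod_unfold
      by (rule measurable_compose[OF measurable_HM_upd Suc.prems(2)]) auto
  qed (auto intro: measurable_HM_component[OF measurable_ident_sets[OF refl]] is_policyD[OF \<pi>(1)])
  then show ?case
    using Suc.IH Suc.prems x \<pi> by (simp add: fwd_Suc)
qed

context
  fixes \<sigma>
  assumes \<sigma>: "\<sigma> \<in> strategies S A"
begin

definition Winf :: "nat \<Rightarrow> (nat \<Rightarrow> (ennreal \<times> 's option) + (real \<Rightarrow> 'a measure)) \<Rightarrow> ennreal" where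
  "Winf n H = (SUP m. Wval \<sigma> m n H)"

lemma measurable_Winf: "Winf n \<in> borel_measurable (DH n)"
  unfolding Winf_def by (intro borel_measurable_SUP measurable_Wval[OF \<sigma>]) auto

lemma Wval_mono:
  assumes "H \<in> space (DH n)"
  shows "Wval \<sigma> m n H \<le> Wval \<sigma> (Suc m) n H"
  using assms
proof (induction m arbitrary: n H)
  case 0
  interpret prob_space "\<sigma> n H"
    by (rule strategy_kernel[OF \<sigma> 0])
  have "(\<integral>\<^sup>+ \<rho>. 1 \<partial>\<sigma> n H) \<le> Wval \<sigma> (Suc 0) n H"
    unfolding Wval.simps
    by (intro nn_integral_mono one_le_step DH_component_space(2)[OF 0 order_refl])
       (simp_all add: strategy_kernel[OF \<sigma> 0])
  then show ?case
    by (simp add: emeasure_space_1)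
next
  case (Suc m)
  show ?case
    unfolding Wval.simps(2)[of \<sigma> "Suc m"] Wval.simps(2)[of \<sigma> m n H]
    by (intro nn_integral_mono step_mono Suc.IH dupd_space[OF Suc.prems])
       (simp_all add: strategy_kernel[OF \<sigma> Suc.prems])
qed

lemma one_le_Winf: "1 \<le> Winf n H"
  unfolding Winf_def by (rule SUP_upper2[of 0]) auto

text \<open>The finite-horizon values of the strategy increase with the horizon, so the recursion
  passes to the limit under both integrals.\<close>

lemma Winf_eq:
  assumes H: "H \<in> space (DH n)"
  shows "Winf n H = (\<integral>\<^sup>+ \<rho>. step (projl (H (2 * n))) \<rho> (\<lambda>z. Winf (Suc n) (dupd n H \<rho> z)) \<partial>\<sigma> n H)"
proof -
  note sk = strategy_kernel[OF \<sigma> H]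
  let ?w = "projl (H (2 * n))"
  have inc: "Wval \<sigma> m (Suc n) (dupd n H \<rho> z) \<le> Wval \<sigma> (Suc m) (Suc n) (dupd n H \<rho> z)"
    if "\<rho> \<in> Rset A" "z \<in> Xset S" for m \<rho> z
    by (rule Wval_mono[OF dupd_space[OF H that]])
  have "step ?w \<rho> (\<lambda>z. Winf (Suc n) (dupd n H \<rho> z)) = (SUP m. step ?w \<rho> (\<lambda>z. Wval \<sigma> m (Suc n) (dupd n H \<rho> z)))"
    if \<rho>: "\<rho> \<in> Rset A" for \<rho>
  proof -
    have m: "(\<lambda>z. Wval \<sigma> m (Suc n) (dupd n H \<rho> z)) \<in> borel_measurable (XM S)" for m
      using H \<rho> by (intro measurable_compose[OF measurable_dupd measurable_Wval[OF \<sigma>]]) auto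
    show ?thesis
      unfolding Winf_def by (rule step_SUP) (use DH_component_space(2)[OF H order_refl] \<rho> m inc in auto)
  qed
  then have "(\<integral>\<^sup>+ \<rho>. step ?w \<rho> (\<lambda>z. Winf (Suc n) (dupd n H \<rho> z)) \<partial>\<sigma> n H)
      = (\<integral>\<^sup>+ \<rho>. (SUP m. step ?w \<rho> (\<lambda>z. Wval \<sigma> m (Suc n) (dupd n H \<rho> z))) \<partial>\<sigma> n H)"
    by (intro nn_integral_cong) (simp add: sk)
  also have "\<dots> = (SUP m. \<integral>\<^sup>+ \<rho>. step ?w \<rho> (\<lambda>z. Wval \<sigma> m (Suc n) (dupd n H \<rho> z)) \<partial>\<sigma> n H)"
  proof (rule nn_integral_monotone_convergence_SUP_AE)
    show "AE \<rho> in \<sigma> n H. step ?w \<rho> (\<lambda>z. Wval \<sigma> m (Suc n) (dupd n H \<rho> z)) \<le> step ?w \<rho> (\<lambda>z. Wval \<sigma> (Suc m) (Suc n) (dupd n H \<rho> z))" for m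
      by (intro AE_I2 step_mono inc) (simp_all add: sk)
    show "(\<lambda>\<rho>. step ?w \<rho> (\<lambda>z. Wval \<sigma> m (Suc n) (dupd n H \<rho> z))) \<in> borel_measurable (\<sigma> n H)" for m
      using measurable_Pair2[OF measurable_step_dupd_pair[OF measurable_Wval[OF \<sigma>]] H] by (simp add: sk)
  qed
  also have "\<dots> = (SUP m. Wval \<sigma> (Suc m) n H)"
    by simp
  also have "\<dots> = Winf n H"
    unfolding Winf_def
  proof (rule antisym)
    show "(SUP m. Wval \<sigma> m n H) \<le> (SUP m. Wval \<sigma> (Suc m) n H)"
      by (intro SUP_mono) (use Wval_mono[OF H] in blast)
  qed (rule SUP_least, rule SUP_upper, simp)
  finally show ?thesis by simp
qed

context
  fixes x \<theta>
  assumes x: "x \<in> S" and \<theta>: "(0::real) < \<theta>"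
begin

text \<open>When actions are produced by a policy, the DTMDP history is a function of the states alone.\<close>
primrec full :: "(nat \<Rightarrow> nat \<Rightarrow> nat) \<Rightarrow> nat \<Rightarrow> (nat \<Rightarrow> ennreal \<times> 's option) \<Rightarrow> nat \<Rightarrow> (ennreal \<times> 's option) + (real \<Rightarrow> 'a measure)" where
  "full \<zeta> 0 h = dinit (ennreal \<theta>, snd (h 0))"
| "full \<zeta> (Suc k) h = dupd k (full \<zeta> k (restrict h {0..<Suc k})) (cpol \<zeta> k (restrict h {0..<Suc k})) (h (Suc k))"

lemma measurable_full: "full \<zeta> k \<in> HM k \<rightarrow>\<^sub>M DH k"
proof (induction k)
  case 0
  have sn: "(\<lambda>h. snd (h 0)) \<in> HM 0 \<rightarrow>\<^sub>M optM S"
    by (rule measurable_HM_component(3)[OF measurable_ident_sets[OF refl]]) simp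
  have "(\<lambda>h. (ennreal \<theta>, snd (h 0))) \<in> HM 0 \<rightarrow>\<^sub>M XM S"
    unfolding measurable_XM_iff
  proof
    show "(\<lambda>h. (ennreal \<theta>, snd (h 0))) \<in> HM 0 \<rightarrow>\<^sub>M borel \<Otimes>\<^sub>M optM S"
      using sn by measurable
    have "snd (h 0) \<in> Some ` S" if "h \<in> space (HM 0)" for h
      using HM_component_space(1)[OF that, of 0] by auto
    then show "(\<lambda>h. (ennreal \<theta>, snd (h 0))) \<in> space (HM 0) \<rightarrow> Xset S"
      using \<theta> by (fastforce simp: Xset_def)
  qed
  then have "(\<lambda>h. (\<lambda>_. undefined)(0 := Inl (ennreal \<theta>, snd (h 0)))) \<in> HM 0 \<rightarrow>\<^sub>M DH 0"
    by (intro measurable_fun_upd[where J="{}"] measurable_compose[OF _ measurable_Dc_inj(1)] measurable_const)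
       (auto simp: space_PiM)
  moreover have "full \<zeta> 0 = (\<lambda>h. (\<lambda>_. undefined)(0 := Inl (ennreal \<theta>, snd (h 0))))"
    by (simp add: dinit_def fun_eq_iff)
  ultimately show ?case by (simp only:)
next
  case (Suc k)
  have r: "(\<lambda>h. restrict h {0..<Suc k}) \<in> HM (Suc k) \<rightarrow>\<^sub>M HM k"
    by (intro measurable_restrict_subset) auto
  have z: "(\<lambda>h. h (Suc k)) \<in> HM (Suc k) \<rightarrow>\<^sub>M XM S"
    using measurable_HM_component(1)[OF measurable_ident_sets[OF refl, of "HM (Suc k)"], of "Suc k"] by simp
  have "(\<lambda>h. dupd k (full \<zeta> k (restrict h {0..<Suc k})) (cpol \<zeta> k (restrict h {0..<Suc k})) (h (Suc k))) \<in> HM (Suc k) \<rightarrow>\<^sub>M DH (Suc k)"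
    by (intro measurable_dupd measurable_compose[OF r Suc] measurable_compose[OF r is_policyD[OF cpol_is_policy]] z)
  then show ?case
    by (simp cong: measurable_cong)
qed

lemma full_upd:
  assumes h: "h \<in> space (HM k)"
  shows "full \<zeta> (Suc k) (h(Suc k := z)) = dupd k (full \<zeta> k h) (cpol \<zeta> k h) z"
proof -
  have "restrict (h(Suc k := z)) {0..<Suc k} = h"
    using h by (auto simp: space_PiM PiE_iff extensional_def fun_eq_iff restrict_def)
  then show ?thesis by simp
qed

lemma full_space: "h \<in> space (HM k) \<Longrightarrow> full \<zeta> k h \<in> space (DH k)"
  by (rule measurable_space[OF measurable_full])

lemma full_snd:
  assumes "h \<in> space (HM k)"
  shows "snd (projl (full \<zeta> k h (2 * k))) = snd (h k)"
  using assms by (cases k) (auto simp: dinit_def dupd_def)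

lemma full_cong:
  assumes "\<And>j. j < k \<Longrightarrow> \<zeta> j = \<zeta>' j"
  shows "full \<zeta> k h = full \<zeta>' k h"
  using assms by (induction k arbitrary: h) (simp_all add: cpol_def)

text \<open>A hybrid cost: the first \<open>k\<close> stages follow the coded policy, everything
  after them follows the given strategy.\<close>

definition Jval :: "(nat \<Rightarrow> nat \<Rightarrow> nat) \<Rightarrow> nat \<Rightarrow> ennreal" where
  "Jval \<zeta> k = fwd x (cpol \<zeta>) k (\<lambda>h. Winf k (full \<zeta> k h))"

lemma measurable_Winf_full: "(\<lambda>h. Winf k (full \<zeta> k h)) \<in> borel_measurable (HM k)"
  by (rule measurable_compose[OF measurable_full measurable_Winf])

lemma Jval_cong:
  assumes "\<And>j. j < k \<Longrightarrow> \<zeta> j = \<zeta>' j"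
  shows "Jval \<zeta> k = Jval \<zeta>' k"
proof -
  have "Jval \<zeta> k = fwd x (cpol \<zeta>) k (\<lambda>h. Winf k (full \<zeta>' k h))"
    unfolding Jval_def using full_cong[OF assms] by simp
  also have "\<dots> = Jval \<zeta>' k"
    unfolding Jval_def
    by (rule fwd_cong[OF x cpol_is_policy cpol_is_policy _ measurable_Winf_full]) (simp add: cpol_def fun_eq_iff assms)
  finally show ?thesis .
qed

text \<open>Some action does no worse than the average over the randomised choice, and by measurable
  selection it can be picked as a coded function of the history.\<close>
lemma Jval_step: "\<exists>a. Jval (\<zeta>(k := a)) (Suc k) \<le> Jval \<zeta> k"
proof -
  \<comment> \<open>The cost of using the control \<open>\<rho>\<close> at stage \<open>k\<close>
    and the strategy from then on.\<close>
  define F where "F h \<rho> = step (h k) \<rho> (\<lambda>z. Winf (Suc k) (dupd k (full \<zeta> k h) \<rho> z))" for h \<rho>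
  define M where "M = hlaw x (cpol \<zeta>) k"
  have sM: "sets M = sets (HM k)" and spM: "space M = space (HM k)"
    unfolding M_def by (rule sets_hlaw[OF x cpol_is_policy]) (rule space_hlaw[OF x cpol_is_policy])
  interpret M: prob_space M
    unfolding M_def by (rule prob_space_hlaw[OF x cpol_is_policy])
  have Fm: "(\<lambda>y. F (h y) (\<rho> y)) \<in> borel_measurable Y" if h: "h \<in> Y \<rightarrow>\<^sub>M HM k" and \<rho>: "\<rho> \<in> Y \<rightarrow>\<^sub>M RM A" for h \<rho> and Y :: "'z measure"
    unfolding F_def
    by (rule measurable_step_dupd[OF measurable_Winf measurable_compose[OF h measurable_full] \<rho> measurable_HM_component(3)[OF h]]) simp
  have F_ex: "\<exists>z. F h (relax z) \<le> Winf k (full \<zeta> k h)" if h: "h \<in> space (HM k)" for h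
  proof -
    have FRM: "F h \<in> borel_measurable (RM A)"
      using Fm[of "\<lambda>_. h" "RM A" "\<lambda>\<rho>. \<rho>"] h by simp
    interpret s: prob_space "\<sigma> k (full \<zeta> k h)"
      by (rule strategy_kernel[OF \<sigma> full_space[OF h]])
    obtain \<rho> where \<rho>: "\<rho> \<in> Rset A" and le: "F h \<rho> \<le> (\<integral>\<^sup>+ \<rho>. F h \<rho> \<partial>\<sigma> k (full \<zeta> k h))"
      using s.nn_integral_ge_point[of "F h"] FRM by (auto simp: strategy_kernel[OF \<sigma> full_space[OF h]])
    have "(\<integral>\<^sup>+ \<rho>. F h \<rho> \<partial>\<sigma> k (full \<zeta> k h)) = Winf k (full \<zeta> k h)"
      unfolding Winf_eq[OF full_space[OF h]] F_def
      by (intro nn_integral_cong step_snd_cong) (simp add: full_snd[OF h])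
    \<comment> \<open>The good control agrees with a coded one at almost every time, and measurable
      functions on \<open>RM A\<close> cannot tell the two apart.\<close>
    moreover obtain z where "AE t in lborel. 0 < t \<longrightarrow> relax z t = \<rho> t"
      using relax_surj[OF \<rho>] by blast
    then have "F h (relax z) = F h \<rho>"
      by (rule RM_AE_cong[OF FRM relax_Rset \<rho>])
    ultimately show ?thesis
      using le by (intro exI[of _ z]) simp
  qed
  have "Measurable.pred (M \<Otimes>\<^sub>M baire) (\<lambda>(h, z). F h (relax z) \<le> Winf k (full \<zeta> k h))"
  proof -
    have [measurable]: "fst \<in> M \<Otimes>\<^sub>M baire \<rightarrow>\<^sub>M HM k"
      using measurable_fst[of M baire] by (simp add: measurable_cong_sets[OF refl sM])
    have [measurable]: "(\<lambda>p. relax (snd p)) \<in> M \<Otimes>\<^sub>M baire \<rightarrow>\<^sub>M RM A"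
      by (rule measurable_compose[OF measurable_snd measurable_relax])
    have [measurable]: "(\<lambda>p. F (fst p) (relax (snd p))) \<in> borel_measurable (M \<Otimes>\<^sub>M baire)"
      by (rule Fm) measurable
    have [measurable]: "(\<lambda>p. Winf k (full \<zeta> k (fst p))) \<in> borel_measurable (M \<Otimes>\<^sub>M baire)"
      by (rule measurable_compose[OF _ measurable_Winf_full]) measurable
    show ?thesis
      unfolding case_prod_unfold by measurable
  qed
  then obtain \<phi> where \<phi>: "\<phi> \<in> M \<rightarrow>\<^sub>M baire" "AE h in M. F h (relax (\<phi> h)) \<le> Winf k (full \<zeta> k h)"
    by (rule measurable_selection_AE[OF M.finite_measure_axioms _ F_ex, unfolded spM]) blast+
  have em: "enc k \<in> M \<rightarrow>\<^sub>M borel"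
    using measurable_enc by (simp add: measurable_cong_sets[OF sM refl])
  have "\<phi> \<in> HM k \<rightarrow>\<^sub>M baire"
    using \<phi>(1) by (simp add: measurable_cong_sets[OF sM refl])
  from measurable_compose[OF measurable_dec this]
  have \<phi>d: "(\<lambda>p. \<phi> (dec k p)) \<in> borel \<rightarrow>\<^sub>M baire" .
  have "finite_measure (distr M borel (enc k))"
    using M.prob_space_distr[OF em] by (rule prob_space.finite_measure)
  \<comment> \<open>The selector is some measurable function of the history. Modulo a null set of
    the law of encoded histories it is the universal function at a fixed parameter \<open>a\<close>,
    which becomes the code of stage \<open>k\<close>.\<close>
  then obtain a where "AE p in distr M borel (enc k). universal a p = \<phi> (dec k p)"
    using universal_AE[OF _ _ \<phi>d] by fastforce
  then have "AE h in M. universal a (enc k h) = \<phi> (dec k (enc k h))"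
    by (rule AE_distrD[OF em])
  then have a: "AE h in M. F h (relax (universal a (enc k h))) \<le> Winf k (full \<zeta> k h)"
    using \<phi>(2) AE_space by eventually_elim (simp add: spM dec_enc)
  let ?\<zeta> = "\<zeta>(k := a)"
  have cp: "cpol ?\<zeta> j = cpol \<zeta> j" if "j < k" for j
    using that by (simp add: cpol_def fun_eq_iff)
  have fl: "full ?\<zeta> k h = full \<zeta> k h" for h
    by (rule full_cong) simp
  have Fk: "(\<lambda>h. F h (cpol ?\<zeta> k h)) \<in> borel_measurable (HM k)"
    by (rule Fm[OF measurable_ident_sets[OF refl] is_policyD[OF cpol_is_policy]])
  have "Jval ?\<zeta> (Suc k) = fwd x (cpol ?\<zeta>) k (\<lambda>h. step (h k) (cpol ?\<zeta> k h) (\<lambda>z. Winf (Suc k) (full ?\<zeta> (Suc k) (h(Suc k := z)))))"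
    unfolding Jval_def by (rule fwd_Suc[OF x cpol_is_policy measurable_Winf_full])
  also have "\<dots> = fwd x (cpol ?\<zeta>) k (\<lambda>h. F h (cpol ?\<zeta> k h))"
    unfolding fwd_def F_def
    by (intro nn_integral_cong) (simp add: space_hlaw[OF x cpol_is_policy] full_upd fl del: full.simps)
  also have "\<dots> = fwd x (cpol \<zeta>) k (\<lambda>h. F h (cpol ?\<zeta> k h))"
    by (rule fwd_cong[OF x cpol_is_policy cpol_is_policy cp Fk])
  also have "\<dots> \<le> Jval \<zeta> k"
    unfolding Jval_def fwd_def M_def[symmetric]
  proof (rule nn_integral_mono_AE)
    show "AE h in M. exp_plus (run_cost (cpol \<zeta>) k h) * F h (cpol ?\<zeta> k h) \<le> exp_plus (run_cost (cpol \<zeta>) k h) * Winf k (full \<zeta> k h)"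
      using a by eventually_elim (auto simp: cpol_def intro: mult_left_mono)
  qed
  finally show ?thesis by blast
qed

text \<open>Along codes chosen by \<open>Jval_step\<close> the hybrid costs decrease from the value
  of the strategy, and they dominate the coded cost of the first \<open>k\<close> stages because a
  continuation value is at least 1. The bound therefore survives the limit in \<open>k\<close>, and
  the limit of the hybrid costs need not be identified.\<close>

theorem derandomise: "\<exists>\<zeta>. Vpol S qt qx c x (cpol \<zeta>) \<le> Vstr S A qt qx c (ennreal \<theta>, Some x) \<sigma>"
proof -
  \<comment> \<open>The choice is legitimate because \<open>Jval\<close> at a stage reads only the
    codes of earlier stages.\<close>
  have "\<exists>\<zeta>. \<forall>k. Jval (\<zeta>(k := \<zeta> k)) (Suc k) \<le> Jval \<zeta> k"
  proof (rule dependent_wellorder_choice[of "\<lambda>\<zeta> k a. Jval (\<zeta>(k := a)) (Suc k) \<le> Jval \<zeta> k"])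
    fix a :: "nat \<Rightarrow> nat" and f g :: "nat \<Rightarrow> nat \<Rightarrow> nat" and k :: nat
    assume eq: "\<And>y. y < k \<Longrightarrow> f y = g y"
    have "Jval f k = Jval g k"
      by (rule Jval_cong[OF eq])
    moreover have "Jval (f(k := a)) (Suc k) = Jval (g(k := a)) (Suc k)"
      by (rule Jval_cong) (auto simp: less_Suc_eq eq)
    ultimately show "(Jval (f(k := a)) (Suc k) \<le> Jval f k) = (Jval (g(k := a)) (Suc k) \<le> Jval g k)"
      by simp
  qed (rule Jval_step)
  then obtain \<zeta> where \<zeta>: "\<And>k. Jval \<zeta> (Suc k) \<le> Jval \<zeta> k"
    by auto
  have "Jval \<zeta> k \<le> Jval \<zeta> 0" for k
    by (induction k) (auto intro: order_trans[OF \<zeta>])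
  moreover have "fwd x (cpol \<zeta>) k (\<lambda>_. 1) \<le> Jval \<zeta> k" for k
    unfolding Jval_def fwd_def by (intro nn_integral_mono mult_left_mono one_le_Winf) simp
  ultimately have "(SUP k. fwd x (cpol \<zeta>) k (\<lambda>_. 1)) \<le> Jval \<zeta> 0"
    by (intro SUP_least) (blast intro: order_trans)
  also have "Jval \<zeta> 0 = Winf 0 (dinit (ennreal \<theta>, Some x))"
    unfolding Jval_def by (subst fwd_0[OF x cpol_is_policy measurable_Winf_full]) (simp add: hist0_def)
  also have "\<dots> = Vstr S A qt qx c (ennreal \<theta>, Some x) \<sigma>"
    unfolding Winf_def by (rule Vstr_eq[symmetric, OF _ \<sigma>]) (use x \<theta> in \<open>auto simp: Xset_def\<close>)
  finally have "Vpol S qt qx c x (cpol \<zeta>) \<le> Vstr S A qt qx c (ennreal \<theta>, Some x) \<sigma>"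
    using Vpol_eq_SUP_run_cost[OF x cpol_is_policy] by (simp add: fwd_def)
  then show ?thesis by blast
qed

end

end

end

section \<open>The optimality equation\<close>

lemma ennreal_le_mult_epsilon:
  fixes a b :: ennreal
  assumes "\<And>e. 0 < e \<Longrightarrow> a \<le> ennreal (1 + e) * b"
  shows "a \<le> b"
proof (cases b)
  case (real r)
  show ?thesis
  proof (rule ennreal_le_epsilon)
    fix e :: real assume "0 < e"
    \<comment> \<open>Dividing by \<open>r + 1\<close> covers \<open>r = 0\<close> and bounds the
      surplus \<open>r * e / (r + 1)\<close> by \<open>e\<close>.\<close>
    have "a \<le> ennreal (1 + e / (r + 1)) * b"
      using real \<open>0 < e\<close> by (intro assms) simp
    also have "\<dots> = ennreal ((1 + e / (r + 1)) * r)"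
      using real \<open>0 < e\<close> by (simp add: ennreal_mult del: ennreal_plus)
    also have "\<dots> \<le> ennreal (r + e)"
      using real \<open>0 < e\<close> by (intro ennreal_leI) (simp add: field_simps)
    also have "\<dots> = b + ennreal e"
      using real \<open>0 < e\<close> by simp
    finally show "a \<le> b + ennreal e" .
  qed
qed simp

text \<open>The infimum need not be Borel measurable; the majorant is built from selections at
  rational levels.\<close>

lemma INF_baire_modification:
  fixes f :: "'x \<Rightarrow> (nat \<Rightarrow> nat) \<Rightarrow> ennreal"
  assumes M: "finite_measure M" and f: "(\<lambda>(y, z). f y z) \<in> borel_measurable (M \<Otimes>\<^sub>M baire)"
  obtains w where "w \<in> borel_measurable M" "\<And>y. y \<in> space M \<Longrightarrow> (INF z. f y z) \<le> w y"
    "AE y in M. w y = (INF z. f y z)"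
proof -
  \<comment> \<open>Negative rationals give the level 0, below which no value lies; the set selected
    for such a level is empty.\<close>
  define r :: "nat \<Rightarrow> ennreal" where "r n = ennreal (real_of_rat (nat_to_rat_surj n))" for n
  have "\<exists>p. fst p \<in> sets M \<and> fst (snd p) \<in> null_sets M \<and> {y \<in> space M. \<exists>z. f y z < r n} \<subseteq> fst p \<union> fst (snd p) \<and>
     (\<forall>y\<in>fst p. f y (snd (snd p) y) < r n)" for n
  proof -
    let ?B = "{p \<in> space (M \<Otimes>\<^sub>M baire). (\<lambda>(y, z). f y z) p < r n}"
    have "?B \<in> sets (M \<Otimes>\<^sub>M baire)"
      using f by measurable
    then obtain E N \<phi> where *: "E \<in> sets M" "N \<in> null_sets M" "fst ` ?B \<subseteq> E \<union> N"
        "\<And>x. x \<in> E \<Longrightarrow> (x, \<phi> x) \<in> ?B"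
      by (rule measurable_selection[OF M]) blast
    have "{y \<in> space M. \<exists>z. f y z < r n} \<subseteq> fst ` ?B"
    proof safe
      fix y z assume "y \<in> space M" "f y z < r n"
      then show "y \<in> fst ` ?B"
        by (intro image_eqI[of _ _ "(y, z)"]) (auto simp: space_pair_measure)
    qed
    with * show ?thesis
      by (intro exI[of _ "(E, N, \<phi>)"]) auto
  qed
  then have "\<forall>n. \<exists>p. fst p \<in> sets M \<and> fst (snd p) \<in> null_sets M \<and> {y \<in> space M. \<exists>z. f y z < r n} \<subseteq> fst p \<union> fst (snd p) \<and>
     (\<forall>y\<in>fst p. f y (snd (snd p) y) < r n)"
    by blast
  from choice[OF this] obtain p where p: "\<And>n. fst (p n) \<in> sets M" "\<And>n. fst (snd (p n)) \<in> null_sets M"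
      "\<And>n. {y \<in> space M. \<exists>z. f y z < r n} \<subseteq> fst (p n) \<union> fst (snd (p n))"
      "\<And>n y. y \<in> fst (p n) \<Longrightarrow> f y (snd (snd (p n)) y) < r n"
    by blast
  \<comment> \<open>A level counts at \<open>y\<close> only where a selected parameter attains a
    value below it, which keeps \<open>w\<close> above the infimum everywhere. Almost everywhere all
    the levels above the infimum are counted.\<close>
  define w where "w y = (INF n. if y \<in> fst (p n) then r n else \<infinity>)" for y
  show thesis
  proof
    note [measurable] = p(1)
    show "w \<in> borel_measurable M"
      unfolding w_def by measurable
    show le: "(INF z. f y z) \<le> w y" for y
      unfolding w_def
    proof (rule INF_greatest)
      fix n
      show "(INF z. f y z) \<le> (if y \<in> fst (p n) then r n else \<infinity>)"
        using p(4)[of y n] by (auto intro: INF_lower2 less_imp_le)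
    qed
    have "(\<Union>n. fst (snd (p n))) \<in> null_sets M"
      using p(2) by (rule null_sets_UN)
    then have "AE y in M. y \<notin> (\<Union>n. fst (snd (p n)))"
      by (rule AE_not_in)
    then show "AE y in M. w y = (INF z. f y z)"
      using AE_space
    proof eventually_elim
      case (elim y)
      have "w y \<le> (INF z. f y z)"
      proof (rule ccontr)
        assume "\<not> w y \<le> (INF z. f y z)"
        then have "(INF z. f y z) < w y" by simp
        then obtain b where b: "(INF z. f y z) < b" "b < w y"
          using dense by blast
        obtain q where "b < ennreal (real_of_rat q)" "ennreal (real_of_rat q) < w y"
          using ennreal_rat_dense[OF b(2)] by blast
        moreover obtain n where "q = nat_to_rat_surj n"
          using surjD[OF surj_nat_to_rat_surj] by blast
        ultimately have n: "b < r n" "r n < w y"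
          unfolding r_def by simp_all
        have "\<exists>z. f y z < r n"
          using order.strict_trans[OF b(1) n(1)] by (simp add: INF_less_iff)
        with elim p(3)[of n] have "y \<in> fst (p n)"
          by blast
        then have "w y \<le> r n"
          unfolding w_def by (intro INF_lower2[of n]) auto
        with n(2) show False by simp
      qed
      with le[of y] show ?case by (rule antisym[rotated])
    qed
  qed
qed

section \<open>Coded policies and lower semianalyticity\<close>

context ctmdp
begin

text \<open>A whole sequence of stage codes is packed into one point of Baire space, so that the
  infimum runs over a single parameter.\<close>

definition code :: "(nat \<Rightarrow> nat) \<Rightarrow> nat \<Rightarrow> nat \<Rightarrow> nat" where
  "code z n k = z (prod_encode (n, k))"

lemma code_surj: "\<exists>z. code z = \<zeta>"
  by (rule exI[of _ "\<lambda>m. case prod_decode m of (n, k) \<Rightarrow> \<zeta> n k"]) (simp add: code_def fun_eq_iff)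

lemma measurable_code: "f \<in> Y \<rightarrow>\<^sub>M baire \<Longrightarrow> (\<lambda>y. code (f y) n) \<in> Y \<rightarrow>\<^sub>M baire"
  unfolding code_def by (rule measurable_baireI) (rule measurable_baire_component)

abbreviation Vc :: "'s \<Rightarrow> (nat \<Rightarrow> nat) \<Rightarrow> ennreal" where
  "Vc x z \<equiv> Vpol S qt qx c x (cpol (code z))"

abbreviation V :: "'s \<Rightarrow> ennreal" where
  "V x \<equiv> Vstar S A qt qx c x"

lemma
  assumes x: "x \<in> S" and \<theta>: "0 < \<theta>"
  shows Vbold_eq_Vstar: "Vbold S A qt qx c (ennreal \<theta>, Some x) = V x"
    and Vstar_eq_INF_code: "V x = (INF z. Vc x z)"
proof -
  have "Vbold S A qt qx c (ennreal \<theta>, Some x) \<le> V x"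
    unfolding Vstar_def by (intro INF_greatest Vbold_le_Vpol[OF x \<theta>] policies_is_policy)
  moreover have "V x \<le> (INF z. Vc x z)"
    unfolding Vstar_def by (intro INF_greatest INF_lower cpol_policies)
  moreover have "(INF z. Vc x z) \<le> Vbold S A qt qx c (ennreal \<theta>, Some x)"
    unfolding Vbold_def
  proof (rule INF_greatest)
    fix \<sigma> assume "\<sigma> \<in> strategies S A"
    from derandomise[OF this x \<theta>] obtain \<zeta> where
      \<zeta>: "Vpol S qt qx c x (cpol \<zeta>) \<le> Vstr S A qt qx c (ennreal \<theta>, Some x) \<sigma>" ..
    obtain z where "code z = \<zeta>"
      using code_surj by blast
    with \<zeta> show "(INF z. Vc x z) \<le> Vstr S A qt qx c (ennreal \<theta>, Some x) \<sigma>"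
      by (intro INF_lower2[of z]) auto
  qed
  ultimately show "Vbold S A qt qx c (ennreal \<theta>, Some x) = V x" "V x = (INF z. Vc x z)"
    by (auto intro: antisym order_trans)
qed

lemma measurable_hist0: "hist0 \<in> BM S \<rightarrow>\<^sub>M HM 0"
proof -
  have "(\<lambda>x. (0, Some x)) \<in> BM S \<rightarrow>\<^sub>M Tc S 0"
    unfolding Tc_def by (auto intro!: measurable_restrict_space2)
  then show ?thesis
    unfolding hist0_def
    by (intro measurable_fun_upd[where J="{}"] measurable_const) (auto simp: space_PiM)
qed

lemma measurable_Vc: "(\<lambda>(x, z). Vc x z) \<in> borel_measurable (BM S \<Otimes>\<^sub>M baire)"
proof -
  have "(\<lambda>(z, h). cpol (code z) i h) \<in> baire \<Otimes>\<^sub>M HM i \<rightarrow>\<^sub>M RM A" for i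
    unfolding cpol_def case_prod_unfold
    by (rule measurable_compose[OF measurable_cpol_code measurable_relax])
       (auto intro: measurable_code)
  from measurable_Uval_param[OF this]
  have U: "(\<lambda>(z, h). Uval (cpol (code z)) n 0 h) \<in> borel_measurable (baire \<Otimes>\<^sub>M HM 0)" for n .
  have "(\<lambda>p. (snd p, hist0 (fst p))) \<in> BM S \<Otimes>\<^sub>M baire \<rightarrow>\<^sub>M baire \<Otimes>\<^sub>M HM 0"
    by (intro measurable_Pair measurable_snd measurable_compose[OF measurable_fst measurable_hist0])
  from measurable_compose[OF this U]
  have "(\<lambda>p. SUP n. Uval (cpol (code (snd p))) n 0 (hist0 (fst p))) \<in> borel_measurable (BM S \<Otimes>\<^sub>M baire)"
    by (intro borel_measurable_SUP) (simp_all add: case_prod_unfold)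
  then show ?thesis
    by (rule measurable_cong[THEN iffD1, rotated])
       (auto simp: space_pair_measure Vpol_eq cpol_is_policy)
qed

theorem lower_semianalytic_Vstar: "lower_semianalytic S V"
  unfolding lower_semianalytic_def analytic_in_def
proof
  fix r :: real
  let ?B = "{p \<in> S \<times> UNIV. Vc (fst p) (snd p) < ennreal r}"
  have "{p \<in> space (BM S \<Otimes>\<^sub>M baire). (case p of (x, z) \<Rightarrow> Vc x z) < ennreal r} \<in> sets (BM S \<Otimes>\<^sub>M baire)"
    using measurable_Vc by measurable
  then have B: "?B \<in> sets (BM S \<Otimes>\<^sub>M baire)"
    by (simp add: space_pair_measure case_prod_unfold)
  \<comment> \<open>A measurable retraction of the full product onto \<open>S \<times> UNIV\<close>;
    it turns measurability relative to \<open>S\<close> into a Borel set of the ambient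
    space.\<close>
  define F where "F p = (if fst p \<in> S then fst p else default None, snd p)" for p :: "'s \<times> (nat \<Rightarrow> nat)"
  have "(\<lambda>p. if fst p \<in> S then fst p else default None) \<in> borel \<Otimes>\<^sub>M baire \<rightarrow>\<^sub>M borel"
    using S_borel by measurable
  then have F: "F \<in> borel \<Otimes>\<^sub>M baire \<rightarrow>\<^sub>M BM S \<Otimes>\<^sub>M baire"
    unfolding F_def by (intro measurable_Pair measurable_snd measurable_restrict_space2) (auto simp: default_None)
  have "F -` ?B \<inter> space (borel \<Otimes>\<^sub>M baire) \<in> sets (borel \<Otimes>\<^sub>M baire)"
    using F B by (rule measurable_sets)
  moreover have "S \<times> UNIV \<in> sets (borel \<Otimes>\<^sub>M baire)"
    using S_borel by (intro pair_measureI) auto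
  ultimately have "(F -` ?B \<inter> space (borel \<Otimes>\<^sub>M baire)) \<inter> (S \<times> UNIV) \<in> sets (borel \<Otimes>\<^sub>M baire)"
    by (rule sets.Int)
  also have "(F -` ?B \<inter> space (borel \<Otimes>\<^sub>M baire)) \<inter> (S \<times> UNIV) = ?B"
    by (auto simp: F_def space_pair_measure)
  finally have "?B \<in> sets borel"
    unfolding borel_prod .
  moreover have "{x \<in> S. enn2ereal (V x) < ereal r} = fst ` ?B"
  proof -
    \<comment> \<open>For negative \<open>r\<close> both sides are false, since
      \<open>ennreal r\<close> is 0.\<close>
    have "enn2ereal v < ereal r \<longleftrightarrow> v < ennreal r" for v
      by (cases v; cases "0 \<le> r") (auto simp: ennreal_less_iff ennreal_neg)
    \<comment> \<open>An infimum lies strictly below a level exactly if some value does; the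
      existential quantifier over codes is the projection.\<close>
    then have "{x \<in> S. enn2ereal (V x) < ereal r} = {x \<in> S. \<exists>z. Vc x z < ennreal r}"
      using Vstar_eq_INF_code[OF _ zero_less_one] by (auto simp: INF_less_iff)
    also have "\<dots> = fst ` ?B"
      by force
    finally show ?thesis .
  qed
  ultimately show "\<exists>B\<in>sets (borel :: ('s \<times> (nat \<Rightarrow> nat)) measure). B \<subseteq> S \<times> UNIV \<and> {x \<in> S. enn2ereal (V x) < ereal r} = fst ` B"
    by (intro bexI[of _ ?B]) auto
qed

section \<open>Conditioning on the first jump\<close>

definition rhs :: "('s \<Rightarrow> ennreal) \<Rightarrow> 's \<Rightarrow> (real \<Rightarrow> 'a measure) \<Rightarrow> ennreal" where
  "rhs v x \<rho> = (\<integral>\<^sup>+ \<tau> \<in> {0<..}.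
       eexp (enn2ereal (Ic c x \<rho> (ennreal \<tau>)) - enn2ereal (Iq qx x \<rho> (ennreal \<tau>)))
       * (\<integral>\<^sup>+ y. v y \<partial>qmix S qt x (\<rho> \<tau>)) \<partial>lborel)
     + eexp (- enn2ereal (Iq qx x \<rho> \<infinity>)) * eexp (enn2ereal (Ic c x \<rho> \<infinity>))"

lemma step_eq:
  assumes x: "x \<in> S" and \<rho>: "\<rho> \<in> Rset A" and f: "f \<in> borel_measurable (XM S)"
  shows "step (t, Some x) \<rho> f = (\<integral>\<^sup>+ \<tau> \<in> {0<..}.
       eexp (enn2ereal (Ic c x \<rho> (ennreal \<tau>)) - enn2ereal (Iq qx x \<rho> (ennreal \<tau>)))
       * (\<integral>\<^sup>+ y. f (ennreal \<tau>, Some y) \<partial>qmix S qt x (\<rho> \<tau>)) \<partial>lborel)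
     + exp_minus (Iq qx x \<rho> \<infinity>) * (exp_plus (Ic c x \<rho> \<infinity>) * f (\<infinity>, None))"
proof -
  have s: "snd (t, Some x) \<in> space (optM S)" for t :: ennreal
    using x by simp
  have fm: "(\<lambda>z. exp_plus (lcost c (t, Some x) \<rho> z) * f z) \<in> borel_measurable (XM S)"
    by (intro borel_measurable_times_ennreal measurable_exp_lcost[OF s \<rho>] f)
  have "step (t, Some x) \<rho> f = jump_integral x \<rho> (\<lambda>z. exp_plus (lcost c (t, Some x) \<rho> z) * f z)"
    unfolding step_def using nn_integral_pker[OF s \<rho> fm] by simp
  also have "\<dots> = (\<integral>\<^sup>+ \<tau> \<in> {0<..}.
       eexp (enn2ereal (Ic c x \<rho> (ennreal \<tau>)) - enn2ereal (Iq qx x \<rho> (ennreal \<tau>)))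
       * (\<integral>\<^sup>+ y. f (ennreal \<tau>, Some y) \<partial>qmix S qt x (\<rho> \<tau>)) \<partial>lborel)
     + exp_minus (Iq qx x \<rho> \<infinity>) * (exp_plus (Ic c x \<rho> \<infinity>) * f (\<infinity>, None))"
    unfolding jump_integral_def lcost_def
  proof (intro arg_cong2[where f="(+)"] nn_integral_cong)
    fix \<tau> :: real
    show "exp_minus (Iq qx x \<rho> (ennreal \<tau>)) * (\<integral>\<^sup>+ s. exp_plus (case snd (t, Some x) of None \<Rightarrow> 0 | Some x \<Rightarrow> Ic c x \<rho> (fst (ennreal \<tau>, Some s))) * f (ennreal \<tau>, Some s) \<partial>qmix S qt x (\<rho> \<tau>)) * indicator {0<..} \<tau>
      = eexp (enn2ereal (Ic c x \<rho> (ennreal \<tau>)) - enn2ereal (Iq qx x \<rho> (ennreal \<tau>))) * (\<integral>\<^sup>+ y. f (ennreal \<tau>, Some y) \<partial>qmix S qt x (\<rho> \<tau>)) * indicator {0<..} \<tau>"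
    proof (cases "0 < \<tau>")
      case True
      have "(\<lambda>s. f (ennreal \<tau>, Some s)) \<in> borel_measurable (qmix S qt x (\<rho> \<tau>))"
        using measurable_Rset_mean_kernel(2)[OF x \<rho> f True] by (simp add: measurable_cong_sets[OF sets_qmix refl])
      from nn_integral_cmult[OF this, of "exp_plus (Ic c x \<rho> (ennreal \<tau>))"]
      have i: "(\<integral>\<^sup>+ s. exp_plus (case snd (t, Some x) of None \<Rightarrow> 0 | Some x \<Rightarrow> Ic c x \<rho> (fst (ennreal \<tau>, Some s))) * f (ennreal \<tau>, Some s) \<partial>qmix S qt x (\<rho> \<tau>))
          = exp_plus (Ic c x \<rho> (ennreal \<tau>)) * (\<integral>\<^sup>+ s. f (ennreal \<tau>, Some s) \<partial>qmix S qt x (\<rho> \<tau>))"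
        by simp
      show ?thesis
        \<comment> \<open>The rates at \<open>x\<close> are bounded, so the rate accumulated up to a
          finite time is finite and the exponential of the difference splits.\<close>
        unfolding i eexp_diff[OF Iq_finite[OF x \<rho>]] by (simp only: mult_ac)
    qed simp
  qed simp
  finally show ?thesis .
qed

lemma Uval_mono:
  assumes \<pi>: "is_policy \<pi>" and h: "h \<in> space (HM i)"
  shows "Uval \<pi> n i h \<le> Uval \<pi> (Suc n) i h"
  using h
proof (induction n arbitrary: i h)
  case 0
  show ?case
    unfolding Uval.simps
    by (rule one_le_step[OF HM_component_space(2)[OF 0] is_policy_Rset[OF \<pi> 0]]) simp_all
next
  case (Suc n)
  show ?case
    unfolding Uval.simps(2)[of \<pi> "Suc n"] Uval.simps(2)[of \<pi> n i h]
    by (intro step_mono Suc.IH HM_upd_space Suc.prems)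
qed

text \<open>The values increase with the horizon, so the supremum may start at horizon one, where
  the first stage is split off; \<open>step_SUP\<close> then moves the supremum behind that
  stage.\<close>

lemma Vpol_step:
  assumes x: "x \<in> S" and \<pi>: "is_policy \<pi>"
  shows "Vpol S qt qx c x \<pi> = step (0, Some x) (\<pi> 0 (hist0 x)) (\<lambda>z. SUP n. Uval \<pi> n 1 ((hist0 x)(1 := z)))"
proof -
  note h0 = hist0_space[OF x]
  have "Vpol S qt qx c x \<pi> = (SUP n. Uval \<pi> (Suc n) 0 (hist0 x))"
    unfolding Vpol_eq[OF x \<pi>]
  proof (rule antisym)
    show "(SUP n. Uval \<pi> n 0 (hist0 x)) \<le> (SUP n. Uval \<pi> (Suc n) 0 (hist0 x))"
      by (intro SUP_mono) (use Uval_mono[OF \<pi> h0] in blast)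
  qed (rule SUP_least, rule SUP_upper, simp)
  also have "\<dots> = (SUP n. step (0, Some x) (\<pi> 0 (hist0 x)) (\<lambda>z. Uval \<pi> n 1 ((hist0 x)(1 := z))))"
    by (simp add: hist0_def)
  also have "\<dots> = step (0, Some x) (\<pi> 0 (hist0 x)) (\<lambda>z. SUP n. Uval \<pi> n 1 ((hist0 x)(1 := z)))"
  proof (rule step_SUP[symmetric])
    show "(\<lambda>z. Uval \<pi> n 1 ((hist0 x)(1 := z))) \<in> borel_measurable (XM S)" for n
      using measurable_Uval_upd[OF \<pi> h0] by simp
    show "Uval \<pi> n 1 ((hist0 x)(1 := z)) \<le> Uval \<pi> (Suc n) 1 ((hist0 x)(1 := z))" if "z \<in> Xset S" for n z
      using Uval_mono[OF \<pi> HM_upd_space[OF h0 that]] by simp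
  qed (use x is_policy_Rset[OF \<pi> h0] in auto)
  finally show ?thesis .
qed

lemma measurable_Vpol_tail:
  assumes x: "x \<in> S" and \<pi>: "is_policy \<pi>"
  shows "(\<lambda>z. SUP n. Uval \<pi> n 1 ((hist0 x)(1 := z))) \<in> borel_measurable (XM S)"
  using measurable_Uval_upd[OF \<pi> hist0_space[OF x]] by (intro borel_measurable_SUP) simp_all

text \<open>A history of the process restarted after the first jump is turned into one that starts
  in \<open>x\<close>; the dummy time of the restarted history gives way to the jump time
  \<open>t\<close>.\<close>

definition cons_hist :: "'s \<Rightarrow> ennreal \<Rightarrow> nat \<Rightarrow> (nat \<Rightarrow> ennreal \<times> 's option) \<Rightarrow> nat \<Rightarrow> ennreal \<times> 's option" where
  "cons_hist x t n h = (\<lambda>i\<in>{0..<Suc (Suc n)}. if i = 0 then (0, Some x) else if i = 1 then (t, snd (h 0)) else h (i - 1))"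

definition shift :: "(nat \<Rightarrow> (nat \<Rightarrow> ennreal \<times> 's option) \<Rightarrow> real \<Rightarrow> 'a measure) \<Rightarrow> 's \<Rightarrow> ennreal
    \<Rightarrow> nat \<Rightarrow> (nat \<Rightarrow> ennreal \<times> 's option) \<Rightarrow> real \<Rightarrow> 'a measure" where
  "shift \<pi> x t n h = \<pi> (Suc n) (cons_hist x t n h)"

lemma measurable_cons_hist:
  assumes x: "x \<in> S" and t: "0 < t"
  shows "cons_hist x (ennreal t) n \<in> HM n \<rightarrow>\<^sub>M HM (Suc n)"
  unfolding cons_hist_def
proof (rule measurable_restrict)
  fix i assume i: "i \<in> {0..<Suc (Suc n)}"
  note comp = measurable_HM_component[OF measurable_ident_sets[OF refl, of "HM n"]]
  consider "i = 0" | "i = 1" | j where "i = Suc (Suc j)"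
    by (cases i; cases "i - 1") auto
  then show "(\<lambda>h. if i = 0 then (0, Some x) else if i = 1 then (ennreal t, snd (h 0)) else h (i - 1)) \<in> HM n \<rightarrow>\<^sub>M Tc S i"
  proof cases
    case 1
    then show ?thesis using x by (auto intro!: measurable_const)
  next
    case 2
    have sn: "(\<lambda>h. snd (h 0)) \<in> HM n \<rightarrow>\<^sub>M optM S"
      by (rule comp(3)) simp
    have "(\<lambda>h. (ennreal t, snd (h 0))) \<in> HM n \<rightarrow>\<^sub>M XM S"
      unfolding measurable_XM_iff
    proof
      show "(\<lambda>h. (ennreal t, snd (h 0))) \<in> HM n \<rightarrow>\<^sub>M borel \<Otimes>\<^sub>M optM S"
        using sn by measurable
      have "snd (h 0) \<in> Some ` S" if "h \<in> space (HM n)" for h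
        using HM_component_space(1)[OF that, of 0] by auto
      then show "(\<lambda>h. (ennreal t, snd (h 0))) \<in> space (HM n) \<rightarrow> Xset S"
        using t by (fastforce simp: Xset_def)
    qed
    with 2 show ?thesis by simp
  next
    case 3
    with i comp(1)[of "Suc j"] show ?thesis by simp
  qed
qed

lemma shift_is_policy:
  assumes \<pi>: "\<pi> \<in> policies S A" and x: "x \<in> S" and t: "0 < t"
  shows "shift \<pi> x (ennreal t) \<in> policies S A"
  unfolding policies_iff shift_def
proof
  fix n
  have "(\<lambda>p. (cons_hist x (ennreal t) n (fst p), snd p)) \<in> HM n \<Otimes>\<^sub>M pos \<rightarrow>\<^sub>M HM (Suc n) \<Otimes>\<^sub>M pos"
    by (intro measurable_Pair measurable_snd measurable_compose[OF measurable_fst measurable_cons_hist[OF x t]])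
  moreover have "(\<lambda>(h, s). \<pi> (Suc n) h s) \<in> HM (Suc n) \<Otimes>\<^sub>M pos \<rightarrow>\<^sub>M PA"
    using \<pi> unfolding policies_iff by blast
  ultimately have "(\<lambda>p. (\<lambda>(h, s). \<pi> (Suc n) h s) (cons_hist x (ennreal t) n (fst p), snd p)) \<in> HM n \<Otimes>\<^sub>M pos \<rightarrow>\<^sub>M PA"
    by (rule measurable_compose)
  then show "(\<lambda>(h, s). \<pi> (Suc n) (cons_hist x (ennreal t) n h) s) \<in> HM n \<Otimes>\<^sub>M pos \<rightarrow>\<^sub>M PA"
    by (simp add: case_prod_unfold)
qed

lemma cons_hist_upd: "(cons_hist x t i h)(Suc (Suc i) := z) = cons_hist x t (Suc i) (h(Suc i := z))"
  by (auto simp: cons_hist_def fun_eq_iff restrict_def)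

lemma Uval_shift: "Uval \<pi> n (Suc i) (cons_hist x t i h) = Uval (shift \<pi> x t) n i h"
proof (induction n arbitrary: i h)
  case (Suc n)
  have "snd (cons_hist x t i h (Suc i)) = snd (h i)"
    by (cases i) (auto simp: cons_hist_def)
  then have "step (cons_hist x t i h (Suc i)) (shift \<pi> x t i h) (\<lambda>z. Uval (shift \<pi> x t) n (Suc i) (h(Suc i := z)))
      = Uval (shift \<pi> x t) (Suc n) i h"
    unfolding Uval.simps by (rule step_snd_cong)
  then show ?case
    unfolding Uval.simps cons_hist_upd Suc.IH by (simp add: shift_def)
qed simp

lemma Uval_shift_hist0: "Uval \<pi> n 1 ((hist0 x)(1 := (t, Some y))) = Uval (shift \<pi> x t) n 0 (hist0 y)"
proof -
  have "(hist0 x)(1 := (t, Some y)) = cons_hist x t 0 (hist0 y)"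
    by (auto simp: hist0_def cons_hist_def fun_eq_iff restrict_def)
  then show ?thesis
    using Uval_shift[of \<pi> n 0] by simp
qed

text \<open>For each jump time the policy induces a policy started afresh in the new state, whose
  value is at least \<open>V\<close> there. The comparison under the integral uses monotonicity
  alone, so measurability of \<open>V\<close> is not an issue in this direction.\<close>

theorem Vstar_ge: 
  assumes x: "x \<in> S"
  shows "(INF \<rho> \<in> Rset A. rhs V x \<rho>) \<le> V x"
  unfolding Vstar_def[of S A qt qx c x]
proof (rule INF_greatest)
  fix \<pi> assume pol: "\<pi> \<in> policies S A"
  note \<pi> = policies_is_policy[OF pol]
  define \<rho> where "\<rho> = \<pi> 0 (hist0 x)"
  have \<rho>: "\<rho> \<in> Rset A"
    unfolding \<rho>_def by (rule is_policy_Rset[OF \<pi> hist0_space[OF x]])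
  define g where "g z = (SUP n. Uval \<pi> n 1 ((hist0 x)(1 := z)))" for z
  have g: "g \<in> borel_measurable (XM S)"
    unfolding g_def by (rule measurable_Vpol_tail[OF x \<pi>])
  have ge: "V y \<le> g (ennreal t, Some y)" if "0 < t" "y \<in> S" for t y
  proof -
    have sh: "shift \<pi> x (ennreal t) \<in> policies S A"
      by (rule shift_is_policy[OF pol x \<open>0 < t\<close>])
    then have "g (ennreal t, Some y) = Vpol S qt qx c y (shift \<pi> x (ennreal t))"
      unfolding g_def using that by (simp only: Uval_shift_hist0 Vpol_eq policies_is_policy)
    then show ?thesis
      unfolding Vstar_def using sh by (simp add: INF_lower)
  qed
  \<comment> \<open>In the event of no jump the right side of the equation has the factor 1 in place
    of a continuation value.\<close>
  have g1: "1 \<le> g z" for z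
    unfolding g_def by (rule SUP_upper2[of 0]) auto
  have "rhs V x \<rho> \<le> step (0, Some x) \<rho> g"
    unfolding step_eq[OF x \<rho> g] rhs_def
  proof (intro add_mono mult_left_mono nn_integral_mono)
    fix \<tau> :: real
    show "eexp (enn2ereal (Ic c x \<rho> (ennreal \<tau>)) - enn2ereal (Iq qx x \<rho> (ennreal \<tau>))) * (\<integral>\<^sup>+ y. V y \<partial>qmix S qt x (\<rho> \<tau>)) * indicator {0<..} \<tau>
      \<le> eexp (enn2ereal (Ic c x \<rho> (ennreal \<tau>)) - enn2ereal (Iq qx x \<rho> (ennreal \<tau>))) * (\<integral>\<^sup>+ y. g (ennreal \<tau>, Some y) \<partial>qmix S qt x (\<rho> \<tau>)) * indicator {0<..} \<tau>"
      using ge by (cases "0 < \<tau>") (auto intro!: mult_left_mono nn_integral_mono)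
    show "exp_plus (Ic c x \<rho> \<infinity>) \<le> exp_plus (Ic c x \<rho> \<infinity>) * g (\<infinity>, None)"
      using mult_left_mono[OF g1, of "exp_plus (Ic c x \<rho> \<infinity>)"] by simp
  qed simp
  also have "\<dots> = Vpol S qt qx c x \<pi>"
    unfolding Vpol_step[OF x \<pi>] g_def \<rho>_def ..
  finally show "(INF \<rho> \<in> Rset A. rhs V x \<rho>) \<le> Vpol S qt qx c x \<pi>"
    using \<rho> by (intro INF_lower2[of \<rho>])
qed

section \<open>Concatenation of policies at the first jump\<close>

definition tail_hist :: "nat \<Rightarrow> (nat \<Rightarrow> ennreal \<times> 's option) \<Rightarrow> nat \<Rightarrow> ennreal \<times> 's option" where
  "tail_hist n h = (\<lambda>i\<in>{0..<Suc n}. if i = 0 then (0, Some (default (snd (h 1)))) else h (Suc i))"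

text \<open>After the first jump the code is chosen from the state reached, and the history handed
  on has forgotten the initial state and the jump time.\<close>

definition concat_pol :: "(real \<Rightarrow> 'a measure) \<Rightarrow> ('s \<Rightarrow> nat \<Rightarrow> nat) \<Rightarrow> nat \<Rightarrow> (nat \<Rightarrow> ennreal \<times> 's option) \<Rightarrow> real \<Rightarrow> 'a measure" where
  "concat_pol \<rho> \<phi> n h = (case n of 0 \<Rightarrow> \<rho> | Suc m \<Rightarrow> cpol (code (\<phi> (default (snd (h 1))))) m (tail_hist m h))"

lemma measurable_tail_hist: "tail_hist n \<in> HM (Suc n) \<rightarrow>\<^sub>M HM n"
  unfolding tail_hist_def
proof (rule measurable_restrict)
  fix i assume i: "i \<in> {0..<Suc n}"
  note comp = measurable_HM_component[OF measurable_ident_sets[OF refl, of "HM (Suc n)"]]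
  show "(\<lambda>h. if i = 0 then (0, Some (default (snd (h 1)))) else h (Suc i)) \<in> HM (Suc n) \<rightarrow>\<^sub>M Tc S i"
  proof (cases i)
    case 0
    have "(\<lambda>h. snd (h 1)) \<in> HM (Suc n) \<rightarrow>\<^sub>M optM S"
      by (rule comp(3)) simp
    from measurable_compose[OF this measurable_default]
    have d: "(\<lambda>h. default (snd (h 1))) \<in> HM (Suc n) \<rightarrow>\<^sub>M BM S" .
    from measurable_space[OF d] have "default (snd (h 1)) \<in> S" if "h \<in> space (HM (Suc n))" for h
      using that by simp
    with d have "(\<lambda>h. (0, Some (default (snd (h 1))))) \<in> HM (Suc n) \<rightarrow>\<^sub>M Tc S 0"
      unfolding Tc_def by (auto intro!: measurable_restrict_space2 measurable_Pair measurable_compose[OF d measurable_Some])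
    with 0 show ?thesis by simp
  next
    case (Suc j)
    with i comp(1)[of "Suc i"] show ?thesis by simp
  qed
qed

lemma concat_pol_policies:
  assumes \<rho>: "\<rho> \<in> Rset A" and \<phi>: "\<phi> \<in> BM S \<rightarrow>\<^sub>M baire"
  shows "concat_pol \<rho> \<phi> \<in> policies S A"
  unfolding policies_iff
proof
  fix n
  show "(\<lambda>(h, s). concat_pol \<rho> \<phi> n h s) \<in> HM n \<Otimes>\<^sub>M pos \<rightarrow>\<^sub>M PA"
  proof (cases n)
    case 0
    then show ?thesis
      using measurable_compose[OF measurable_snd RsetD[OF \<rho>]] by (simp add: concat_pol_def case_prod_unfold)
  next
    case (Suc m)
    have "(\<lambda>h. snd (h 1)) \<in> HM (Suc m) \<rightarrow>\<^sub>M optM S"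
      by (rule measurable_HM_component(3)[OF measurable_ident_sets[OF refl]]) simp
    from measurable_compose[OF measurable_compose[OF this measurable_default] \<phi>]
    have "(\<lambda>h. \<phi> (default (snd (h 1)))) \<in> HM (Suc m) \<rightarrow>\<^sub>M baire" .
    then have "(\<lambda>h. universal (code (\<phi> (default (snd (h 1)))) m) (enc m (tail_hist m h))) \<in> HM (Suc m) \<rightarrow>\<^sub>M baire"
      by (intro measurable_cpol_code measurable_code measurable_tail_hist)
    from measurable_relax_joint[OF this] show ?thesis
      by (simp add: Suc concat_pol_def cpol_def)
  qed
qed

text \<open>Agreement is asked for only on histories from \<open>y\<close>:
  \<open>concat_pol\<close> reads its code off the first state of the tail, and this state stays
  fixed along the recursion.\<close>

lemma Uval_cong_hist:
  assumes "\<And>n h. h \<in> space (HM n) \<Longrightarrow> h 0 = (0, Some y) \<Longrightarrow> \<pi> n h = \<pi>' n h"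
    and "h \<in> space (HM i)" "h 0 = (0, Some y)"
  shows "Uval \<pi> n i h = Uval \<pi>' n i h"
  using assms(2,3)
proof (induction n arbitrary: i h)
  case (Suc n)
  have "step (h i) (\<pi>' i h) (\<lambda>z. Uval \<pi> n (Suc i) (h(Suc i := z))) = step (h i) (\<pi>' i h) (\<lambda>z. Uval \<pi>' n (Suc i) (h(Suc i := z)))"
  proof (rule step_cong)
    fix z assume "z \<in> Xset S"
    from HM_upd_space[OF Suc.prems(1) this]
    show "Uval \<pi> n (Suc i) (h(Suc i := z)) = Uval \<pi>' n (Suc i) (h(Suc i := z))"
      by (rule Suc.IH) (simp add: Suc.prems)
  qed
  then show ?case
    using assms(1)[OF Suc.prems] by simp
qed simp

text \<open>The cemetery is absorbing and incurs no cost, so each further stage contributes a factor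
  1.\<close>

lemma Uval_None:
  assumes \<pi>: "is_policy \<pi>" and "h \<in> space (HM i)" "snd (h i) = None"
  shows "Uval \<pi> n i h = 1"
  using assms(2,3)
proof (induction n arbitrary: i h)
  case (Suc n)
  note R = is_policy_Rset[OF \<pi> Suc.prems(1)]
  have m: "(\<lambda>z. exp_plus (lcost c (h i) (\<pi> i h) z) * Uval \<pi> n (Suc i) (h(Suc i := z))) \<in> borel_measurable (XM S)"
    by (intro borel_measurable_times_ennreal measurable_exp_lcost R measurable_Uval_upd[OF \<pi> Suc.prems(1)] HM_component_space(2)[OF Suc.prems(1)]) simp
  have "Uval \<pi> (Suc n) i h = exp_plus (lcost c (h i) (\<pi> i h) (\<infinity>, None)) * Uval \<pi> n (Suc i) (h(Suc i := (\<infinity>, None)))"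
    using nn_integral_pker[OF HM_component_space(2)[OF Suc.prems(1), of i] R m] Suc.prems(2) by (simp add: step_def)
  also have "Uval \<pi> n (Suc i) (h(Suc i := (\<infinity>, None))) = 1"
    by (rule Suc.IH[OF HM_upd_space[OF Suc.prems(1)]]) simp_all
  finally show ?case
    using Suc.prems(2) by (simp add: lcost_def)
qed simp

lemma concat_pol_value:
  assumes x: "x \<in> S" and \<rho>: "\<rho> \<in> Rset A" and \<phi>: "\<phi> \<in> BM S \<rightarrow>\<^sub>M baire"
  defines "g \<equiv> \<lambda>z. SUP n. Uval (concat_pol \<rho> \<phi>) n 1 ((hist0 x)(1 := z))"
  shows "Vpol S qt qx c x (concat_pol \<rho> \<phi>) = step (0, Some x) \<rho> g"
    and "z \<in> Xset S \<Longrightarrow> g z = (case snd z of None \<Rightarrow> 1 | Some y \<Rightarrow> Vc y (\<phi> y))"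
proof -
  note pol = concat_pol_policies[OF \<rho> \<phi>]
  note \<pi> = policies_is_policy[OF pol]
  show "Vpol S qt qx c x (concat_pol \<rho> \<phi>) = step (0, Some x) \<rho> g"
    unfolding Vpol_step[OF x \<pi>] g_def by (simp add: concat_pol_def)
  assume z: "z \<in> Xset S"
  then consider t y where "z = (ennreal t, Some y)" "0 < t" "y \<in> S" | "z = (\<infinity>, None)"
    by (auto simp: Xset_def)
  then show "g z = (case snd z of None \<Rightarrow> 1 | Some y \<Rightarrow> Vc y (\<phi> y))"
  proof cases
    case 1
    have eq: "shift (concat_pol \<rho> \<phi>) x (ennreal t) n h = cpol (code (\<phi> y)) n h"
      if "h \<in> space (HM n)" "h 0 = (0, Some y)" for n h
    proof -
      have "tail_hist n (cons_hist x (ennreal t) n h) = h"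
        using that by (auto simp: tail_hist_def cons_hist_def fun_eq_iff restrict_def space_PiM PiE_iff extensional_def)
      moreover have "snd (cons_hist x (ennreal t) n h 1) = Some y"
        using that by (simp add: cons_hist_def)
      ultimately show ?thesis
        by (simp add: shift_def concat_pol_def)
    qed
    have "g z = (SUP n. Uval (shift (concat_pol \<rho> \<phi>) x (ennreal t)) n 0 (hist0 y))"
      unfolding g_def 1 by (simp only: Uval_shift_hist0)
    also have "\<dots> = (SUP n. Uval (cpol (code (\<phi> y))) n 0 (hist0 y))"
      by (intro SUP_cong refl Uval_cong_hist[OF eq] hist0_space[OF \<open>y \<in> S\<close>]) (simp_all add: hist0_def)
    finally show ?thesis
      by (simp add: 1 Vpol_eq[OF \<open>y \<in> S\<close> cpol_is_policy])
  next
    case 2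
    have "Uval (concat_pol \<rho> \<phi>) n 1 ((hist0 x)(1 := z)) = 1" for n
      using Uval_None[OF \<pi>, of "(hist0 x)(1 := z)" 1 n] HM_upd_space[OF hist0_space[OF x] z] 2 by simp
    then show ?thesis
      by (simp add: g_def 2)
  qed
qed

text \<open>The survival factor is strictly positive at finite times. A set of states that is null
  for the state after the jump is therefore null for the jump measure at almost every time.\<close>

lemma jumpLaw_AE_qmix:
  assumes x: "x \<in> S" and \<rho>: "\<rho> \<in> Rset A"
    and ae: "AE y in distr (jumpLaw S qt qx x \<rho>) (BM S) (\<lambda>z. default (snd z)). P y"
  shows "AE \<tau> in lborel. 0 < \<tau> \<longrightarrow> (AE y in qmix S qt x (\<rho> \<tau>). P y)"
proof -
  let ?\<mu> = "distr (jumpLaw S qt qx x \<rho>) (BM S) (\<lambda>z. default (snd z))"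
  have dm: "(\<lambda>z. default (snd z)) \<in> jumpLaw S qt qx x \<rho> \<rightarrow>\<^sub>M BM S"
    unfolding measurable_cong_sets[OF sets_jumpLaw refl] by measurable
  obtain N where N: "{y \<in> space ?\<mu>. \<not> P y} \<subseteq> N" "emeasure ?\<mu> N = 0" "N \<in> sets ?\<mu>"
    using ae by (rule AE_E)
  then have NS: "N \<in> sets (BM S)" by simp
  have im: "(\<lambda>z. indicator N (default (snd z)) :: ennreal) \<in> borel_measurable (XM S)"
    using NS by measurable
  have "0 = (\<integral>\<^sup>+ y. indicator N y \<partial>?\<mu>)"
    using N by simp
  also have "\<dots> = (\<integral>\<^sup>+ z. indicator N (default (snd z)) \<partial>jumpLaw S qt qx x \<rho>)"
    using dm NS by (subst nn_integral_distr) auto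
  also have "\<dots> = jump_integral x \<rho> (\<lambda>z. indicator N (default (snd z)))"
    by (rule nn_integral_jumpLaw[OF x \<rho> im])
  finally have "(\<integral>\<^sup>+ t \<in> {0<..}. exp_minus (Iq qx x \<rho> (ennreal t)) * (\<integral>\<^sup>+ s. indicator N s \<partial>qmix S qt x (\<rho> t)) \<partial>lborel) = 0"
    unfolding jump_integral_def by simp
  then have "AE t in lborel. exp_minus (Iq qx x \<rho> (ennreal t)) * (\<integral>\<^sup>+ s. indicator N s \<partial>qmix S qt x (\<rho> t)) * indicator {0<..} t = 0"
    using borel_measurable_lborel_pos[OF measurable_Rset_mean_kernel(1)[OF x \<rho> im]]
    by (subst (asm) nn_integral_0_iff_AE) simp_all
  then show ?thesis
  proof (rule eventually_mono, intro impI)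
    fix t :: real assume *: "exp_minus (Iq qx x \<rho> (ennreal t)) * (\<integral>\<^sup>+ s. indicator N s \<partial>qmix S qt x (\<rho> t)) * indicator {0<..} t = 0"
      and t: "0 < t"
    have "exp_minus (Iq qx x \<rho> (ennreal t)) \<noteq> 0"
      using Iq_finite[OF x \<rho>, of t] by (cases "Iq qx x \<rho> (ennreal t)") auto
    with * t have "(\<integral>\<^sup>+ s. indicator N s \<partial>qmix S qt x (\<rho> t)) = 0"
      by simp
    then have "N \<in> null_sets (qmix S qt x (\<rho> t))"
      using NS by (intro null_setsI) simp_all
    then show "AE y in qmix S qt x (\<rho> t). P y"
      using N(1) by (intro AE_I'[of N]) auto
  qed
qed

theorem Vstar_le:
  assumes x: "x \<in> S" and \<rho>: "\<rho> \<in> Rset A"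
  shows "V x \<le> rhs V x \<rho>"
proof -
  let ?J = "jumpLaw S qt qx x \<rho>"
  \<comment> \<open>The event of no jump is mapped to a default state. This can only add mass to
    \<open>?\<mu>\<close> and so leaves it with fewer null sets, which is harmless.\<close>
  let ?\<mu> = "distr ?J (BM S) (\<lambda>z. default (snd z))"
  have dm: "(\<lambda>z. default (snd z)) \<in> ?J \<rightarrow>\<^sub>M BM S"
    unfolding measurable_cong_sets[OF sets_jumpLaw refl] by measurable
  interpret J: prob_space ?J
    by (rule prob_space_jumpLaw[OF x \<rho>])
  interpret \<mu>: prob_space ?\<mu>
    by (rule J.prob_space_distr[OF dm])
  have VcM: "(\<lambda>(y, z). Vc y z) \<in> borel_measurable (?\<mu> \<Otimes>\<^sub>M baire)"
    using measurable_Vc by (simp cong: measurable_cong_sets)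
  obtain w where w: "w \<in> borel_measurable (BM S)" and w_ge: "\<And>y. y \<in> S \<Longrightarrow> V y \<le> w y"
    and w_eq: "AE y in ?\<mu>. w y = V y"
  proof (rule INF_baire_modification[OF \<mu>.finite_measure_axioms VcM])
    fix w assume w: "w \<in> borel_measurable ?\<mu>" "\<And>y. y \<in> space ?\<mu> \<Longrightarrow> (INF z. Vc y z) \<le> w y"
      "AE y in ?\<mu>. w y = (INF z. Vc y z)"
    show thesis
    proof (rule that)
      show "w \<in> borel_measurable (BM S)"
        using w(1) by simp
      show "V y \<le> w y" if "y \<in> S" for y
        using w(2)[of y] that by (simp add: Vstar_eq_INF_code[OF that zero_less_one])
      show "AE y in ?\<mu>. w y = V y"
        using w(3) AE_space by eventually_elim (simp add: Vstar_eq_INF_code[OF _ zero_less_one])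
    qed
  qed
  define gw where "gw z = (case snd z of None \<Rightarrow> 1 | Some y \<Rightarrow> w y)" for z :: "ennreal \<times> 's option"
  have gw: "gw \<in> borel_measurable (XM S)"
    unfolding gw_def
  proof (rule measurable_case_option[where g="\<lambda>_. w"])
    show "(\<lambda>z. w (default (snd z))) \<in> borel_measurable (XM S)"
      by (rule measurable_compose[OF _ w]) measurable
  qed measurable
  \<comment> \<open>Positivity of \<open>w y\<close> gives
    \<open>w y < ennreal (1 + e) * w y\<close> at finite values and so leaves room for an almost
    optimal code. The error is a factor and not a summand because a constant factor passes through
    \<open>step\<close>, whereas a summand would be weighted by exponential costs.\<close>
  have one_V: "1 \<le> V y" if "y \<in> S" for y
  proof -
    have "1 \<le> Vc y z" for z
      unfolding Vpol_eq[OF that cpol_is_policy] by (rule SUP_upper2[of 0]) auto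
    then show ?thesis
      unfolding Vstar_eq_INF_code[OF that zero_less_one] by (intro INF_greatest)
  qed
  have "V x \<le> ennreal (1 + e) * step (0, Some x) \<rho> gw" if e: "0 < e" for e :: real
  proof -
    have "\<exists>z. Vc y z \<le> ennreal (1 + e) * w y" if y: "y \<in> space ?\<mu>" for y
    proof (cases "w y = \<infinity>")
      case True
      then show ?thesis
        using e by (simp add: ennreal_mult_top)
    next
      case False
      have yS: "y \<in> S" using y by simp
      have "1 \<le> w y"
        using one_V[OF yS] w_ge[OF yS] by (rule order_trans)
      with False e have "w y < ennreal (1 + e) * w y"
        by (cases "w y") (auto simp: ennreal_mult[symmetric] ennreal_less_iff simp del: ennreal_plus)
      then have "(INF z. Vc y z) < ennreal (1 + e) * w y"
        using w_ge[OF yS] unfolding Vstar_eq_INF_code[OF yS zero_less_one] by (rule le_less_trans[rotated])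
      then show ?thesis
        by (auto simp: INF_less_iff intro: less_imp_le)
    qed
    moreover have "Measurable.pred (?\<mu> \<Otimes>\<^sub>M baire) (\<lambda>(y, z). Vc y z \<le> ennreal (1 + e) * w y)"
    proof -
      have [measurable]: "(\<lambda>p. Vc (fst p) (snd p)) \<in> borel_measurable (?\<mu> \<Otimes>\<^sub>M baire)"
        using VcM by (simp add: case_prod_unfold)
      have [measurable]: "w \<in> borel_measurable ?\<mu>"
        using w by simp
      show ?thesis
        unfolding case_prod_unfold by measurable
    qed
    ultimately obtain \<phi> where \<phi>': "\<phi> \<in> ?\<mu> \<rightarrow>\<^sub>M baire" "AE y in ?\<mu>. Vc y (\<phi> y) \<le> ennreal (1 + e) * w y"
      using measurable_selection_AE[OF \<mu>.finite_measure_axioms] by blast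
    then have \<phi>: "\<phi> \<in> BM S \<rightarrow>\<^sub>M baire" by simp
    have ae: "AE z in ?J. Vc (default (snd z)) (\<phi> (default (snd z))) \<le> ennreal (1 + e) * w (default (snd z))"
      by (rule AE_distrD[OF dm \<phi>'(2)])
    define g where "g z = (SUP n. Uval (concat_pol \<rho> \<phi>) n 1 ((hist0 x)(1 := z)))" for z
    note cv = concat_pol_value[OF x \<rho> \<phi>, folded g_def]
    have "V x \<le> Vpol S qt qx c x (concat_pol \<rho> \<phi>)"
      unfolding Vstar_def by (rule INF_lower[OF concat_pol_policies[OF \<rho> \<phi>]])
    also have "\<dots> = step (0, Some x) \<rho> g"
      by (rule cv(1))
    also have "\<dots> \<le> step (0, Some x) \<rho> (\<lambda>z. ennreal (1 + e) * gw z)"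
      unfolding step_def
    proof (rule nn_integral_mono_AE)
      have pk: "pker S qt qx (0, Some x) \<rho> = ?J"
        by (simp add: pker_def)
      have "AE z in ?J. g z \<le> ennreal (1 + e) * gw z"
        using ae AE_space
      proof eventually_elim
        case (elim z)
        have "1 \<le> ennreal (1 + e)"
          using e by (simp add: ennreal_le_1[symmetric] del: ennreal_plus flip: ennreal_1)
        with elim show ?case
          using cv(2)[of z] by (auto simp: gw_def split: option.splits)
      qed
      then have "AE z in ?J. exp_plus (lcost c (0, Some x) \<rho> z) * g z \<le> exp_plus (lcost c (0, Some x) \<rho> z) * (ennreal (1 + e) * gw z)"
        by eventually_elim (rule mult_left_mono, simp_all)
      then show "AE z in pker S qt qx (0, Some x) \<rho>. exp_plus (lcost c (0, Some x) \<rho> z) * g z \<le> exp_plus (lcost c (0, Some x) \<rho> z) * (ennreal (1 + e) * gw z)"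
        by (simp only: pk)
    qed
    also have "\<dots> = ennreal (1 + e) * step (0, Some x) \<rho> gw"
      using x by (intro step_cmult[OF _ \<rho> gw]) simp
    finally show ?thesis .
  qed
  then have "V x \<le> step (0, Some x) \<rho> gw"
    by (rule ennreal_le_mult_epsilon)
  also have "\<dots> \<le> rhs V x \<rho>"
    unfolding step_eq[OF x \<rho> gw] rhs_def
  proof (intro add_mono)
    show "(\<integral>\<^sup>+ \<tau> \<in> {0<..}. eexp (enn2ereal (Ic c x \<rho> (ennreal \<tau>)) - enn2ereal (Iq qx x \<rho> (ennreal \<tau>)))
          * (\<integral>\<^sup>+ y. gw (ennreal \<tau>, Some y) \<partial>qmix S qt x (\<rho> \<tau>)) \<partial>lborel)
      \<le> (\<integral>\<^sup>+ \<tau> \<in> {0<..}. eexp (enn2ereal (Ic c x \<rho> (ennreal \<tau>)) - enn2ereal (Iq qx x \<rho> (ennreal \<tau>)))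
          * (\<integral>\<^sup>+ y. V y \<partial>qmix S qt x (\<rho> \<tau>)) \<partial>lborel)"
    proof (rule nn_integral_mono_AE)
      show "AE \<tau> in lborel. eexp (enn2ereal (Ic c x \<rho> (ennreal \<tau>)) - enn2ereal (Iq qx x \<rho> (ennreal \<tau>)))
          * (\<integral>\<^sup>+ y. gw (ennreal \<tau>, Some y) \<partial>qmix S qt x (\<rho> \<tau>)) * indicator {0<..} \<tau>
        \<le> eexp (enn2ereal (Ic c x \<rho> (ennreal \<tau>)) - enn2ereal (Iq qx x \<rho> (ennreal \<tau>)))
          * (\<integral>\<^sup>+ y. V y \<partial>qmix S qt x (\<rho> \<tau>)) * indicator {0<..} \<tau>"
        \<comment> \<open>For almost every jump time the Borel majorant equals \<open>V\<close>
          almost everywhere under the jump measure, so it can be replaced by \<open>V\<close> inside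
          the integral.\<close>
        using jumpLaw_AE_qmix[OF x \<rho> w_eq]
      proof (rule eventually_mono)
        fix \<tau> :: real assume *: "0 < \<tau> \<longrightarrow> (AE y in qmix S qt x (\<rho> \<tau>). w y = V y)"
        have "(\<integral>\<^sup>+ y. gw (ennreal \<tau>, Some y) \<partial>qmix S qt x (\<rho> \<tau>)) \<le> (\<integral>\<^sup>+ y. V y \<partial>qmix S qt x (\<rho> \<tau>))" if "0 < \<tau>"
          using *[rule_format, OF that] by (intro nn_integral_mono_AE) (auto simp: gw_def elim!: eventually_mono)
        then show "eexp (enn2ereal (Ic c x \<rho> (ennreal \<tau>)) - enn2ereal (Iq qx x \<rho> (ennreal \<tau>)))
          * (\<integral>\<^sup>+ y. gw (ennreal \<tau>, Some y) \<partial>qmix S qt x (\<rho> \<tau>)) * indicator {0<..} \<tau>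
        \<le> eexp (enn2ereal (Ic c x \<rho> (ennreal \<tau>)) - enn2ereal (Iq qx x \<rho> (ennreal \<tau>)))
          * (\<integral>\<^sup>+ y. V y \<partial>qmix S qt x (\<rho> \<tau>)) * indicator {0<..} \<tau>"
          by (cases "0 < \<tau>") (auto intro: mult_left_mono)
      qed
    qed
  qed (simp add: gw_def)
  finally show ?thesis .
qed

theorem optimality_equation:
  assumes "x \<in> S"
  shows "V x = (INF \<rho> \<in> Rset A. rhs V x \<rho>)"
  by (intro antisym INF_greatest Vstar_le Vstar_ge assms)

end

theorem theorem4p1:
  fixes S :: "'s::polish_space set" and A :: "'a::polish_space set"
    and qt :: "'s \<Rightarrow> 'a \<Rightarrow> 's measure"
    and qx :: "'s \<Rightarrow> 'a \<Rightarrow> real"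
    and c :: "'s \<Rightarrow> 'a \<Rightarrow> real"
  assumes S_borel: "S \<in> sets borel" and S_ne: "S \<noteq> {}"
    and A_borel: "A \<in> sets borel" and A_ne: "A \<noteq> {}"
    and qt_sets: "\<And>x a. x \<in> S \<Longrightarrow> a \<in> A \<Longrightarrow> sets (qt x a) = sets (BM S)"
    and qt_finite: "\<And>x a. x \<in> S \<Longrightarrow> a \<in> A \<Longrightarrow> emeasure (qt x a) S < \<infinity>"
    and qt_diag: "\<And>x a. x \<in> S \<Longrightarrow> a \<in> A \<Longrightarrow> emeasure (qt x a) {x} = 0"
    and qt_meas: "\<And>\<Gamma>. \<Gamma> \<in> sets (BM S) \<Longrightarrow>
         (\<lambda>(x, a). emeasure (qt x a) \<Gamma>) \<in> borel_measurable (BM S \<Otimes>\<^sub>M BM A)"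
    and conservative: "\<And>x a. x \<in> S \<Longrightarrow> a \<in> A \<Longrightarrow> qx x a = measure (qt x a) S"
    and stable: "\<And>x. x \<in> S \<Longrightarrow> \<exists>K. \<forall>a \<in> A. qx x a \<le> K"
    and c_meas: "(\<lambda>(x, a). c x a) \<in> borel_measurable (BM S \<Otimes>\<^sub>M BM A)"
    and c_nonneg: "\<And>x a. x \<in> S \<Longrightarrow> a \<in> A \<Longrightarrow> 0 \<le> c x a"
  shows "(\<forall>x \<in> S. \<forall>\<theta>1 \<theta>2. 0 < \<theta>1 \<longrightarrow> 0 < \<theta>2 \<longrightarrow>
            Vbold S A qt qx c (ennreal \<theta>1, Some x) = Vbold S A qt qx c (ennreal \<theta>2, Some x))
       \<and> lower_semianalytic S (Vstar S A qt qx c)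
       \<and> (\<forall>x \<in> S. \<forall>\<theta>. 0 < \<theta> \<longrightarrow> Vstar S A qt qx c x = Vbold S A qt qx c (ennreal \<theta>, Some x))
       \<and> (\<forall>x \<in> S. Vstar S A qt qx c x =
            (INF \<rho> \<in> Rset A.
               (\<integral>\<^sup>+ \<tau> \<in> {0<..}.
                   eexp (enn2ereal (Ic c x \<rho> (ennreal \<tau>)) - enn2ereal (Iq qx x \<rho> (ennreal \<tau>)))
                   * (\<integral>\<^sup>+ y. Vstar S A qt qx c y \<partial>qmix S qt x (\<rho> \<tau>)) \<partial>lborel)
               + eexp (- enn2ereal (Iq qx x \<rho> \<infinity>)) * eexp (enn2ereal (Ic c x \<rho> \<infinity>))))"
proof -
  interpret ctmdp S A qt qx c
    by (rule ctmdp.intro) (fact S_borel S_ne A_borel A_ne qt_sets qt_finite qt_meas conservative stable c_meas)+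
  show ?thesis
    using Vbold_eq_Vstar lower_semianalytic_Vstar optimality_equation unfolding rhs_def
    by (intro conjI ballI allI impI) simp_all
qed

end
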